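(* Let $n,q\in\mathbb{N}$ and let $(C_j)_{j=0}^n$ be a Toeplitz non-negative definite sequence of complex $q\times q$ matrices. Then the central measure $\mu$ corresponding to $(C_j)_{j=0}^n$ admits, for all Borel subsets $B$ of $\mathbb{T}$, the representation $$\mu(B)=\frac1{2\pi}\int_B\operatorname{Re}\Lambda_n(\zeta)\,\lambda(d\zeta)+\sum_{v\in\mathcal{N}_n}X_{n,v}\,\delta_v(B),$$ where $\mathcal{N}_n$, $X_{n,v}$ and $\Lambda_n$ are built from $(C_j)_{j=0}^n$ as described in the context.
   Context: $\mathbb{T}$ is the unit circle; $\operatorname{Re}A=\frac12(A+A^* )$; $A^\dagger$ is the Moore–Penrose inverse; $A^\sharp$ the classical adjugate; $\lambda$ the linear Lebesgue (arc length, total mass $2\pi$) measure on the Borel sets of $\mathbb{T}$; $\delta_v$ the Dirac measure at $v$. Empty sums are zero matrices. For a sequence $(C_j)$ of complex $q\times q$ matrices put $C_{-j}:=C_j^*$, $T_m:=[C_{j-k}]_{j,k=0}^m$, $Y_m$ the block column with blocks $C_1,\dots,C_m$ (top to bottom), $Z_m:=[C_m,C_{m-1},\dots,C_1]$, and $M_{m+1}:=Z_mT_{m-1}^\dagger Y_m$ for $m\ge1$. The sequence $(C_j)_{j=0}^n$ is Toeplitz non-negative definite if $T_n$ is non-negative Hermitian; an infinite sequence is so if all $T_m$ are non-negative Hermitian. **Central measure.** Continue $(C_j)_{j=0}^n$ recursively by $C_j:=M_j$ for $j\ge n+1$. The resulting sequence $(C_j)_{j=0}^\infty$ is Toeplitz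 non-negative definite, so by Herglotz' theorem there is a unique non-negative Hermitian $q\times q$ measure $\mu$ on $\mathbb{T}$ (countably additive map from the Borel sets of $\mathbb{T}$ into the non-negative Hermitian $q\times q$ matrices) with $\int_{\mathbb{T}}\zeta^{-j}\mu(d\zeta)=C_j$ for all $j\in\{0,1,2,\dots\}$. It is called the central measure corresponding to $(C_j)_{j=0}^n$. **The objects in the formula.** Let $\Gamma_0:=\operatorname{Re}C_0$ $(=C_0)$, $\Gamma_j:=2C_j$ for $1\le j\le n$, let $S_m:=[\Gamma_{j-k}]_{j,k=0}^m$ with $\Gamma_l:=0$ for $l<0$ (lower triangular block Toeplitz), $e_m(z):=[z^0I_q,z^1I_q,\dots,z^mI_q]$, and $$a_n(z):=\Gamma_0+z\,e_{n-1}(z)S_{n-1}^*T_{n-1}^\dagger Y_n,\qquad b_n(z):=I_q-z\,e_{n-1}(z)T_{n-1}^\dagger Y_n .$$ ($\det b_n$ does not vanish identically since $b_n(0)=I_q$.) Let $\mathcal{N}_n:=\{v\in\mathbb{T}:\det b_n(v)=0\}$, a finite set; for $v\in\mathcal{N}_n$ let $m_v$ be the multiplicity of $v$ as a zero of $\det b_n$ and $$X_{n,v}:=\frac{-m_v}{2v(\det b_n)^{(m_v)}(v)}\,(a_nb_n^\sharp)^{(m_v-1)}(v).$$ Let $\Delta_n(z):=\sum_{v\in\mathcal{N}_n}\frac{v+z}{v-z}X_{n,v}$ for $z\in\mathbb{C}\setminus\mathcal{N}_n$ and $\Lambda_n:=a_nb_n^{-1}-\Delta_n$, a rational matrix function (removable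 singularities removed). *)

theory Defs
  imports
    "HOL-Complex_Analysis.Complex_Analysis"
    "Jordan_Normal_Form.Schur_Decomposition"
    "Jordan_Normal_Form.Determinant"
    "Jordan_Normal_Form.Gauss_Jordan_Elimination"
begin

hide_const (open) Determinants.det Finite_Cartesian_Product.mat Finite_Cartesian_Product.vec
no_notation Finite_Cartesian_Product.vec_nth (infixl "$" 90)

text \<open>Matrices of size \<open>q \<times> q\<close> and block matrices are elements of \<^typ>\<open>complex mat\<close> with explicit
  dimensions, since the number of blocks varies with the index. Only the values \<open>C j\<close> with
  \<open>j \<le> n\<close> of the given family \<open>C\<close> are ever used.\<close>

section \<open>Matrices\<close>

definition mat_re :: "complex mat \<Rightarrow> complex mat" where
  "mat_re A = (1/2) \<cdot>\<^sub>m (A + mat_adjoint A)"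

definition nonneg_hermitian :: "nat \<Rightarrow> complex mat \<Rightarrow> bool" where
  "nonneg_hermitian d A \<longleftrightarrow> A \<in> carrier_mat d d \<and> mat_adjoint A = A \<and>
     (\<forall>x\<in>carrier_vec d. 0 \<le> Re ((A *\<^sub>v x) \<bullet> conjugate x))"

text \<open>The four Penrose equations, which have exactly one solution.\<close>

definition mp_inverse :: "complex mat \<Rightarrow> complex mat" where
  "mp_inverse A = (THE X. X \<in> carrier_mat (dim_col A) (dim_row A) \<and>
     A * X * A = A \<and> X * A * X = X \<and>
     mat_adjoint (A * X) = A * X \<and> mat_adjoint (X * A) = X * A)"

definition block_mat :: "nat \<Rightarrow> nat \<Rightarrow> nat \<Rightarrow> (nat \<Rightarrow> nat \<Rightarrow> complex mat) \<Rightarrow> complex mat" where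
  "block_mat q k l F = mat (k * q) (l * q) (\<lambda>(r, s). F (r div q) (s div q) $$ (r mod q, s mod q))"

definition mat_sum :: "nat \<Rightarrow> ('a \<Rightarrow> complex mat) \<Rightarrow> 'a set \<Rightarrow> complex mat" where
  "mat_sum q F A = mat q q (\<lambda>(i, j). \<Sum>a\<in>A. F a $$ (i, j))"

section \<open>Toeplitz non-negative definite sequences and their central continuation\<close>

definition toeplitz_T :: "nat \<Rightarrow> (nat \<Rightarrow> complex mat) \<Rightarrow> nat \<Rightarrow> complex mat" where
  "toeplitz_T q C m = block_mat q (m+1) (m+1)
     (\<lambda>j k. if k \<le> j then C (j - k) else mat_adjoint (C (k - j)))"

definition col_Y :: "nat \<Rightarrow> (nat \<Rightarrow> complex mat) \<Rightarrow> nat \<Rightarrow> complex mat" where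
  "col_Y q C m = block_mat q m 1 (\<lambda>j _. C (j + 1))"

definition row_Z :: "nat \<Rightarrow> (nat \<Rightarrow> complex mat) \<Rightarrow> nat \<Rightarrow> complex mat" where
  "row_Z q C m = block_mat q 1 m (\<lambda>_ k. C (m - k))"

definition toeplitz_nonneg :: "nat \<Rightarrow> nat \<Rightarrow> (nat \<Rightarrow> complex mat) \<Rightarrow> bool" where
  "toeplitz_nonneg q n C \<longleftrightarrow>
     (\<forall>j\<le>n. C j \<in> carrier_mat q q) \<and> nonneg_hermitian ((n+1) * q) (toeplitz_T q C n)"

text \<open>\<open>center_M q C (m+1)\<close> is \<open>Z\<^sub>m T\<^sub>m\<^sub>-\<^sub>1\<^sup>\<dagger> Y\<^sub>m\<close>, so it is meaningful from index 2 on.\<close>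

definition center_M :: "nat \<Rightarrow> (nat \<Rightarrow> complex mat) \<Rightarrow> nat \<Rightarrow> complex mat" where
  "center_M q C k =
     row_Z q C (k - 1) * mp_inverse (toeplitz_T q C (k - 2)) * col_Y q C (k - 1)"

text \<open>The guard \<open>i < j\<close> only serves termination: \<open>center_M q C j\<close> depends on \<open>C 0, \<dots>, C (j - 1)\<close>
  alone, see \<open>central_seq_gt\<close> below.\<close>

fun central_seq :: "nat \<Rightarrow> nat \<Rightarrow> (nat \<Rightarrow> complex mat) \<Rightarrow> nat \<Rightarrow> complex mat" where
  "central_seq q n C j = (if j \<le> n then C j
     else center_M q (\<lambda>i. if i < j then central_seq q n C i else 0\<^sub>m q q) j)"

declare central_seq.simps [simp del]

lemma block_mat_cong:
  assumes "\<And>j k. j < a \<Longrightarrow> k < b \<Longrightarrow> F j k = G j k"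
  shows "block_mat q a b F = block_mat q a b G"
proof (cases "q = 0")
  case False
  then show ?thesis
    unfolding block_mat_def
    by (intro eq_matI) (auto simp: assms less_mult_imp_div_less)
qed (auto simp: block_mat_def)

lemma center_M_cong:
  assumes "2 \<le> j" "\<And>i. i < j \<Longrightarrow> C i = D i"
  shows "center_M q C j = center_M q D j"
proof -
  have "row_Z q C (j - 1) = row_Z q D (j - 1)" "col_Y q C (j - 1) = col_Y q D (j - 1)"
    "toeplitz_T q C (j - 2) = toeplitz_T q D (j - 2)"
    unfolding row_Z_def col_Y_def toeplitz_T_def
    using assms by (auto intro!: block_mat_cong)
  then show ?thesis by (simp add: center_M_def)
qed

lemma central_seq_le: "j \<le> n \<Longrightarrow> central_seq q n C j = C j"
  by (simp add: central_seq.simps)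

lemma central_seq_gt:
  assumes "1 \<le> n" "n < j"
  shows "central_seq q n C j = center_M q (central_seq q n C) j"
proof -
  have "central_seq q n C j
      = center_M q (\<lambda>i. if i < j then central_seq q n C i else 0\<^sub>m q q) j"
    using assms by (subst central_seq.simps) simp
  also have "\<dots> = center_M q (central_seq q n C) j"
    using assms by (intro center_M_cong) auto
  finally show ?thesis .
qed

section \<open>Measures on the unit circle\<close>

definition circle_borel :: "complex measure" where
  "circle_borel = restrict_space borel (sphere 0 1)"

definition arc_length :: "complex measure" where
  "arc_length = distr (restrict_space lborel {0..<2*pi}) circle_borel cis"

definition nonneg_hermitian_measure :: "nat \<Rightarrow> (complex set \<Rightarrow> complex mat) \<Rightarrow> bool" where
  "nonneg_hermitian_measure q \<mu> \<longleftrightarrow>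
     (\<forall>B\<in>sets circle_borel. nonneg_hermitian q (\<mu> B)) \<and>
     (\<forall>A::nat \<Rightarrow> complex set. range A \<subseteq> sets circle_borel \<longrightarrow> disjoint_family A \<longrightarrow>
        (\<forall>i<q. \<forall>j<q. (\<lambda>k. \<mu> (A k) $$ (i, j)) sums (\<mu> (\<Union>k. A k) $$ (i, j))))"

text \<open>Integration with respect to a non-negative Hermitian measure \<open>\<mu>\<close> is entrywise integration
  with respect to the complex measures \<open>\<mu>\<^sub>i\<^sub>j\<close>. These are absolutely continuous with respect to
  the finite trace measure of \<open>\<mu>\<close>, so by Radon-Nikodym there is an (almost everywhere unique)
  trace density \<open>D\<close>, and \<open>\<integral>f d\<mu>\<^sub>i\<^sub>j\<close> is the integral of \<open>f D\<^sub>i\<^sub>j\<close> against the trace measure.\<close>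

definition trace_measure :: "nat \<Rightarrow> (complex set \<Rightarrow> complex mat) \<Rightarrow> complex measure" where
  "trace_measure q \<mu> = measure_of (space circle_borel) (sets circle_borel)
     (\<lambda>B. ennreal (Re (\<Sum>i<q. \<mu> B $$ (i, i))))"

definition is_trace_density ::
    "nat \<Rightarrow> (complex set \<Rightarrow> complex mat) \<Rightarrow> (complex \<Rightarrow> complex mat) \<Rightarrow> bool" where
  "is_trace_density q \<mu> D \<longleftrightarrow> (\<forall>i<q. \<forall>j<q.
     integrable (trace_measure q \<mu>) (\<lambda>\<zeta>. D \<zeta> $$ (i, j)) \<and>
     (\<forall>B\<in>sets circle_borel. \<mu> B $$ (i, j) = (LINT \<zeta>:B|trace_measure q \<mu>. D \<zeta> $$ (i, j))))"

definition mat_measure_integral ::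
    "nat \<Rightarrow> (complex set \<Rightarrow> complex mat) \<Rightarrow> (complex \<Rightarrow> complex) \<Rightarrow> complex mat" where
  "mat_measure_integral q \<mu> f = (let D = (SOME D. is_trace_density q \<mu> D) in
     mat q q (\<lambda>(i, j). LINT \<zeta>|trace_measure q \<mu>. f \<zeta> * D \<zeta> $$ (i, j)))"

definition central_measure ::
    "nat \<Rightarrow> nat \<Rightarrow> (nat \<Rightarrow> complex mat) \<Rightarrow> (complex set \<Rightarrow> complex mat) \<Rightarrow> bool" where
  "central_measure q n C \<mu> \<longleftrightarrow> nonneg_hermitian_measure q \<mu> \<and>
     (\<forall>j. mat_measure_integral q \<mu> (\<lambda>\<zeta>. \<zeta> powi (- int j)) = central_seq q n C j)"

definition mat_set_integrable ::
    "nat \<Rightarrow> 'a measure \<Rightarrow> 'a set \<Rightarrow> ('a \<Rightarrow> complex mat) \<Rightarrow> bool" where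
  "mat_set_integrable q M B F \<longleftrightarrow> (\<forall>i<q. \<forall>j<q. set_integrable M B (\<lambda>x. F x $$ (i, j)))"

definition mat_set_integral ::
    "nat \<Rightarrow> 'a measure \<Rightarrow> 'a set \<Rightarrow> ('a \<Rightarrow> complex mat) \<Rightarrow> complex mat" where
  "mat_set_integral q M B F = mat q q (\<lambda>(i, j). LINT x:B|M. F x $$ (i, j))"

section \<open>The rational matrix functions\<close>

definition Gamma_coeff :: "(nat \<Rightarrow> complex mat) \<Rightarrow> nat \<Rightarrow> complex mat" where
  "Gamma_coeff C j = (if j = 0 then mat_re (C 0) else 2 \<cdot>\<^sub>m C j)"

definition lower_S :: "nat \<Rightarrow> (nat \<Rightarrow> complex mat) \<Rightarrow> nat \<Rightarrow> complex mat" where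
  "lower_S q C m = block_mat q (m+1) (m+1)
     (\<lambda>j k. if k \<le> j then Gamma_coeff C (j - k) else 0\<^sub>m q q)"

definition row_e :: "nat \<Rightarrow> nat \<Rightarrow> complex \<Rightarrow> complex mat" where
  "row_e q m z = block_mat q 1 (m+1) (\<lambda>_ k. z ^ k \<cdot>\<^sub>m 1\<^sub>m q)"

definition fun_a :: "nat \<Rightarrow> nat \<Rightarrow> (nat \<Rightarrow> complex mat) \<Rightarrow> complex \<Rightarrow> complex mat" where
  "fun_a q n C z = Gamma_coeff C 0 +
     z \<cdot>\<^sub>m (row_e q (n-1) z * mat_adjoint (lower_S q C (n-1))
          * mp_inverse (toeplitz_T q C (n-1)) * col_Y q C n)"

definition fun_b :: "nat \<Rightarrow> nat \<Rightarrow> (nat \<Rightarrow> complex mat) \<Rightarrow> complex \<Rightarrow> complex mat" where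
  "fun_b q n C z = 1\<^sub>m q -
     z \<cdot>\<^sub>m (row_e q (n-1) z * mp_inverse (toeplitz_T q C (n-1)) * col_Y q C n)"

definition set_N :: "nat \<Rightarrow> nat \<Rightarrow> (nat \<Rightarrow> complex mat) \<Rightarrow> complex set" where
  "set_N q n C = {v \<in> sphere 0 1. det (fun_b q n C v) = 0}"

definition mult_b :: "nat \<Rightarrow> nat \<Rightarrow> (nat \<Rightarrow> complex mat) \<Rightarrow> complex \<Rightarrow> nat" where
  "mult_b q n C v = nat (zorder (\<lambda>z. det (fun_b q n C z)) v)"

definition mat_deriv :: "nat \<Rightarrow> nat \<Rightarrow> (complex \<Rightarrow> complex mat) \<Rightarrow> complex \<Rightarrow> complex mat" where
  "mat_deriv q k F v = mat q q (\<lambda>(i, j). (deriv ^^ k) (\<lambda>z. F z $$ (i, j)) v)"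

definition mass_X :: "nat \<Rightarrow> nat \<Rightarrow> (nat \<Rightarrow> complex mat) \<Rightarrow> complex \<Rightarrow> complex mat" where
  "mass_X q n C v = (let m = mult_b q n C v in
     (- of_nat m / (2 * v * (deriv ^^ m) (\<lambda>z. det (fun_b q n C z)) v))
       \<cdot>\<^sub>m mat_deriv q (m - 1) (\<lambda>z. fun_a q n C z * adj_mat (fun_b q n C z)) v)"

definition fun_Delta :: "nat \<Rightarrow> nat \<Rightarrow> (nat \<Rightarrow> complex mat) \<Rightarrow> complex \<Rightarrow> complex mat" where
  "fun_Delta q n C z =
     mat_sum q (\<lambda>v. ((v + z) / (v - z)) \<cdot>\<^sub>m mass_X q n C v) (set_N q n C)"

text \<open>\<^const>\<open>remove_sings\<close> replaces the value at a point by the limit there, and by 0 if there is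
  no limit. The finitely many zeros of \<open>det b\<^sub>n\<close>, where the inverse is not meaningful, do not
  influence these limits.\<close>

definition fun_Lambda :: "nat \<Rightarrow> nat \<Rightarrow> (nat \<Rightarrow> complex mat) \<Rightarrow> complex \<Rightarrow> complex mat" where
  "fun_Lambda q n C z = mat q q (\<lambda>(i, j). remove_sings
     (\<lambda>w. (fun_a q n C w * the (mat_inverse (fun_b q n C w)) - fun_Delta q n C w) $$ (i, j)) z)"

end

theory Submission
  imports Defs
begin

text \<open>Write \<open>F(z) = \<integral> (\<zeta> + z) / (\<zeta> - z) \<mu>(d\<zeta>) = C\<^sub>0 + 2 \<Sum> C\<^sub>j z\<^sup>j\<close> on the open disk. The central
  continuation satisfies the single linear recurrence with coefficients \<open>T\<^sub>n\<^sub>-\<^sub>1\<^sup>\<dagger> Y\<^sub>n\<close>, which says that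
  \<open>F b\<^sub>n = a\<^sub>n\<close>, so \<open>F\<close> is rational. Since \<open>F(z) = O(1 / (1 - |z|))\<close>, its poles on the circle are
  simple zeros of the denominator after cancellation; comparing the residue with the radial limit
  \<open>(1 - r) / 2 F(r v) \<rightarrow> \<mu>{v}\<close> gives \<open>X\<^sub>n\<^sub>,\<^sub>v = \<mu>{v}\<close>. Removing these atoms leaves a
  measure whose Herglotz transform \<open>\<Lambda>\<^sub>n\<close> is continuous on the closed disk; its Fourier coefficients are
  those of \<open>Re \<Lambda>\<^sub>n / 2\<pi>\<close> by Cauchy's formula, and Fourier coefficients determine a measure.\<close>

section \<open>Moore-Penrose inverses of Hermitian matrices\<close>

text \<open>The obstacle is that T_{n-1} may be singular. The coefficients beta = T_{n-1}^dagger Y_n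
  solve T_{n-1} beta = Y_n only because positivity of T_n puts Y_n into the range of T_{n-1}: a
  vector of zero energy is annihilated. The same fact, applied to every larger T_m, shows that the
  growing Moore-Penrose inverses in the continuation keep giving Z_m beta, with beta padded by
  zeros. Each step needs T_m to be nonnegative, so positivity and recurrence are proved by one
  induction. That F b_n equals this particular a_n comes from S + S^* = 2T: in 2T beta the part S
  beta cancels, and S^* beta remains. The adjugate gives F det b_n = a_n b_n^# on the whole disk,
  also where det b_n vanishes. On the circle a zero of multiplicity m_v meets a numerator vanishing
  to order at least m_v - 1, which is why derivatives of orders m_v and m_v - 1 form the mass.
  Entries of mu are complex measures, and the (i, j) entry of Re Lambda_n mixes entry (i, j) with
  the conjugate of entry (j, i). The boundary argument therefore runs with two scalar transforms at
  once.\<close>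

lemma dim_mat_adjoint [simp]:
  "dim_row (mat_adjoint A) = dim_col A" "dim_col (mat_adjoint A) = dim_row A"
  by (auto simp: mat_adjoint_def)

lemma mat_adjoint_carrier [simp]: "A \<in> carrier_mat m n \<Longrightarrow> mat_adjoint A \<in> carrier_mat n m"
  by (intro carrier_matI) auto

lemma index_mat_adjoint [simp]:
  fixes A :: "complex mat"
  assumes "i < dim_col A" "j < dim_row A"
  shows "mat_adjoint A $$ (i, j) = cnj (A $$ (j, i))"
  using assms by (simp add: mat_adjoint_def mat_of_rows_index conjugate_complex_def)

lemma mat_adjoint_adjoint [simp]: "mat_adjoint (mat_adjoint (A :: complex mat)) = A"
  by (intro eq_matI) auto

lemma mult_mat_assoc_dim:
  "dim_col A = dim_row B \<Longrightarrow> dim_col B = dim_row C \<Longrightarrow> A * B * C = A * (B * C)"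
  by (rule assoc_mult_mat[of A "dim_row A" "dim_col A" B "dim_col B" C "dim_col C"])
    (auto intro: carrier_matI)

lemma mat_adjoint_mult:
  fixes A B :: "complex mat"
  assumes "dim_col A = dim_row B"
  shows "mat_adjoint (A * B) = mat_adjoint B * mat_adjoint A"
  using assms by (intro eq_matI) (auto simp: scalar_prod_def mult.commute)

text \<open>Diagonal entries of A^* A are the squared Euclidean norms of the columns of A.\<close>

lemma vanishing_of_self_adjoint_mult:
  fixes A :: "complex mat"
  assumes A: "A \<in> carrier_mat m n" and 0: "mat_adjoint A * A = 0\<^sub>m n n"
  shows "A = 0\<^sub>m m n"
proof (intro eq_matI)
  fix i j assume ij: "i < dim_row (0\<^sub>m m n)" "j < dim_col (0\<^sub>m m n)"
  have "0 = (mat_adjoint A * A) $$ (j, j)" using ij 0 by simp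
  also have "\<dots> = (\<Sum>k<m. cnj (A $$ (k, j)) * A $$ (k, j))"
    using A ij by (auto simp: scalar_prod_def lessThan_atLeast0 intro!: sum.cong)
  also have "\<dots> = complex_of_real (\<Sum>k<m. (cmod (A $$ (k, j)))\<^sup>2)"
    unfolding of_real_sum by (intro sum.cong refl) (metis complex_norm_square mult.commute of_real_power)
  finally have "(\<Sum>k<m. (cmod (A $$ (k, j)))\<^sup>2) = 0" by (metis of_real_eq_0_iff)
  then show "A $$ (i, j) = 0\<^sub>m m n $$ (i, j)"
    using ij by (subst (asm) sum_nonneg_eq_0_iff) auto
qed (use A in auto)

text \<open>Since T is its own adjoint, (TM)^* (TM) = M^* T (TM) = 0. This replaces invertibility of
  T: one of two adjacent factors T can always be dropped.\<close>

lemma hermitian_cancel_left: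
  fixes T :: "complex mat"
  assumes T: "T \<in> carrier_mat N N" "mat_adjoint T = T" and M: "M \<in> carrier_mat N p"
    and 0: "T * (T * M) = 0\<^sub>m N p"
  shows "T * M = 0\<^sub>m N p"
proof (rule vanishing_of_self_adjoint_mult)
  have "mat_adjoint (T * M) * (T * M) = mat_adjoint M * (T * (T * M))"
    using T M by (simp add: mat_adjoint_mult mult_mat_assoc_dim)
  then show "mat_adjoint (T * M) * (T * M) = 0\<^sub>m p p" using 0 M by (simp add: right_mult_zero_mat[of _ p N])
qed (use T M in auto)

lemma hermitian_cancel_right:
  fixes T :: "complex mat"
  assumes T: "T \<in> carrier_mat N N" "mat_adjoint T = T" and M: "M \<in> carrier_mat p N"
    and 0: "M * T * T = 0\<^sub>m p N"
  shows "M * T = 0\<^sub>m p N"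
proof -
  have "mat_adjoint (M * T * T) = T * (T * mat_adjoint M)"
    using T M by (simp add: mat_adjoint_mult mult_mat_assoc_dim)
  moreover have "mat_adjoint (0\<^sub>m p N :: complex mat) = 0\<^sub>m N p" by (intro eq_matI) auto
  ultimately have "T * mat_adjoint M = 0\<^sub>m N p"
    using hermitian_cancel_left[OF T, of "mat_adjoint M" p] 0 M by simp
  then have "mat_adjoint (T * mat_adjoint M) = mat_adjoint (0\<^sub>m N p)" by simp
  then show ?thesis using T M
    by (auto simp add: mat_adjoint_mult intro!: eq_matI)
qed

text \<open>Compare coefficients in \<open>adj (x I - T) (x I - T) = char_poly T\<close> from below: the first nonzero
  coefficient \<open>k\<close> of the characteristic polynomial yields \<open>T\<^sup>k = G T\<^sup>k\<^sup>+\<^sup>1\<close> for a multiple \<open>G\<close> of a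
  coefficient of the adjugate, and for Hermitian \<open>T\<close> the powers cancel on the right.\<close>

lemma hermitian_factor_square:
  fixes T :: "complex mat"
  assumes T: "T \<in> carrier_mat N N" "mat_adjoint T = T"
  obtains G where "G \<in> carrier_mat N N" "G * T * T = T"
proof -
  define A where "A = adj_mat (char_poly_matrix T)"
  define cp where "cp = char_poly T"
  have A: "A \<in> carrier_mat N N" "A * char_poly_matrix T = cp \<cdot>\<^sub>m 1\<^sub>m N"
    using adj_mat(1,3)[OF char_poly_matrix_closed[OF T(1)]] by (simp_all add: A_def cp_def char_poly_def)
  define B where "B k = mat N N (\<lambda>(i, j). Polynomial.coeff (A $$ (i, j)) k)" for k
  have B [simp]: "B k \<in> carrier_mat N N" for k by (simp add: B_def)
  have B_dim [simp]: "dim_row (B k) = N" "dim_col (B k) = N" for k by (simp_all add: B_def)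
  \<comment> \<open>Coefficient of x^k in adj(xI - T) (xI - T) = p(x) I, that is B_{k-1} - B_k T =
    p_k I with B_{-1} = 0.\<close>
  have coeffs: "(if k = 0 then 0 else B (k - 1) $$ (i, j)) - (B k * T) $$ (i, j)
      = Polynomial.coeff cp k * 1\<^sub>m N $$ (i, j)" if ij: "i < N" "j < N" for i j k
  proof -
    have "cp * 1\<^sub>m N $$ (i, j) = (A * char_poly_matrix T) $$ (i, j)"
      using ij by (simp add: A)
    also have "\<dots> = (\<Sum>l<N. A $$ (i, l) * char_poly_matrix T $$ (l, j))"
      using ij A(1) char_poly_matrix_closed[OF T(1)]
      by (auto simp: scalar_prod_def lessThan_atLeast0 intro!: sum.cong)
    also have "\<dots> = (\<Sum>l<N. (if l = j then pCons 0 (A $$ (i, l)) else 0)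
        - Polynomial.smult (T $$ (l, j)) (A $$ (i, l)))"
    proof (intro sum.cong refl)
      fix l assume "l \<in> {..<N}"
      then have "char_poly_matrix T $$ (l, j) = (if l = j then [:0, 1:] else 0) - [:T $$ (l, j):]"
        using ij T(1) by (simp add: char_poly_matrix_def)
      then show "A $$ (i, l) * char_poly_matrix T $$ (l, j)
          = (if l = j then pCons 0 (A $$ (i, l)) else 0) - Polynomial.smult (T $$ (l, j)) (A $$ (i, l))"
        by (simp only: right_diff_distrib) simp
    qed
    finally have "cp * 1\<^sub>m N $$ (i, j)
        = pCons 0 (A $$ (i, j)) - (\<Sum>l<N. Polynomial.smult (T $$ (l, j)) (A $$ (i, l)))"
      using ij by (simp add: sum_subtractf)
    then have "Polynomial.coeff (cp * 1\<^sub>m N $$ (i, j)) k = Polynomial.coeff (pCons 0 (A $$ (i, j))) k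
        - (\<Sum>l<N. T $$ (l, j) * Polynomial.coeff (A $$ (i, l)) k)"
      by (simp add: coeff_sum)
    moreover have "Polynomial.coeff (cp * 1\<^sub>m N $$ (i, j)) k = Polynomial.coeff cp k * 1\<^sub>m N $$ (i, j)"
      using ij by simp
    moreover have "(B k * T) $$ (i, j) = (\<Sum>l<N. T $$ (l, j) * Polynomial.coeff (A $$ (i, l)) k)"
      using ij T(1) by (auto simp: B_def scalar_prod_def lessThan_atLeast0 intro!: sum.cong)
    moreover have "Polynomial.coeff (pCons 0 (A $$ (i, j))) k = (if k = 0 then 0 else B (k - 1) $$ (i, j))"
      using ij by (cases k) (simp_all add: B_def)
    ultimately show ?thesis by (simp only:)
  qed
  define k0 where "k0 = (LEAST k. Polynomial.coeff cp k \<noteq> 0)"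
  have "cp \<noteq> 0" using degree_monic_char_poly[OF T(1)] by (auto simp: cp_def)
  then have "\<exists>k. Polynomial.coeff cp k \<noteq> 0" by (auto simp: poly_eq_iff)
  then have k0: "Polynomial.coeff cp k0 \<noteq> 0" "\<And>k. k < k0 \<Longrightarrow> Polynomial.coeff cp k = 0"
    unfolding k0_def using LeastI_ex[of "\<lambda>k. Polynomial.coeff cp k \<noteq> 0"] not_less_Least by blast+
  \<comment> \<open>While the scalar coefficients vanish, B_k = B_{k+1} T. So B_k T = 0 reads
    B_{k+1} T T = 0, and one factor T cancels.\<close>
  have BT0: "B k * T = 0\<^sub>m N N" if "k < k0" for k
    using that
  proof (induction k)
    case 0
    show ?case using coeffs[of _ _ 0] k0(2)[OF 0] T(1) by (intro eq_matI) (auto simp del: index_mult_mat(1))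
  next
    case (Suc k)
    then have "B k = B (Suc k) * T"
      using coeffs[of _ _ "Suc k"] k0(2)[OF Suc.prems] T(1) by (intro eq_matI) (auto simp del: index_mult_mat(1))
    moreover have "B k * T = 0\<^sub>m N N" using Suc by simp
    ultimately show ?case using hermitian_cancel_right[OF T, of "B (Suc k)" N] by simp
  qed
  define G where "G = (- inverse (Polynomial.coeff cp k0)) \<cdot>\<^sub>m B k0"
  have G: "G \<in> carrier_mat N N" by (simp add: G_def)
  have "G * T * T = T"
  proof -
    \<comment> \<open>By the coefficient identity at k0 this is B_{k0-1}, or 0 if k0 = 0. Either way
      HT = 0, and solving that equation for T yields G.\<close>
    define H where "H = B k0 * T + Polynomial.coeff cp k0 \<cdot>\<^sub>m 1\<^sub>m N"
    have H: "H \<in> carrier_mat N N" using T by (simp add: H_def)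
    have HT: "H * T = 0\<^sub>m N N"
    proof (cases k0)
      case 0
      then have "H = 0\<^sub>m N N" using coeffs[of _ _ 0] T(1)
        by (intro eq_matI) (auto simp: H_def neg_eq_iff_add_eq_0 simp del: index_mult_mat(1))
      then show ?thesis using T by simp
    next
      case (Suc k)
      then have "H = B k" using coeffs[of _ _ k0] T(1)
        by (intro eq_matI) (auto simp: H_def diff_eq_eq add.commute simp del: index_mult_mat(1))
      then show ?thesis using BT0[of k] Suc by simp
    qed
    have HT2: "H * T = B k0 * T * T + Polynomial.coeff cp k0 \<cdot>\<^sub>m T"
      using T unfolding H_def by (subst add_mult_distrib_mat[of _ N N]) auto
    have e: "(B k0 * T * T) $$ (i, j) = - Polynomial.coeff cp k0 * T $$ (i, j)" if "i < N" "j < N" for i j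
    proof -
      have "0 = (B k0 * T * T + Polynomial.coeff cp k0 \<cdot>\<^sub>m T) $$ (i, j)"
        using that HT HT2 by (simp del: index_mult_mat(1))
      also have "\<dots> = (B k0 * T * T) $$ (i, j) + Polynomial.coeff cp k0 * T $$ (i, j)"
        using that T by (subst index_add_mat) auto
      finally show ?thesis by (simp add: eq_neg_iff_add_eq_0)
    qed
    have "G * T * T = (- inverse (Polynomial.coeff cp k0)) \<cdot>\<^sub>m (B k0 * T * T)"
      unfolding G_def using mult_smult_assoc_mat[of "B k0" N N T N] mult_smult_assoc_mat[of "B k0 * T" N N T N]
        mult_carrier_mat[of "B k0" N N T N] T(1) by simp
    then show ?thesis using e k0 T(1) by (intro eq_matI) (auto simp del: index_mult_mat(1))
  qed
  with G show ?thesis using that by blast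
qed

text \<open>AX and AY both project orthogonally onto the range of A, hence agree; likewise XA and
  YA. Then X = XAX = YAX = YAY = Y.\<close>

lemma penrose_unique:
  fixes A X Y :: "complex mat"
  assumes A: "A \<in> carrier_mat m n" and X: "X \<in> carrier_mat n m" and Y: "Y \<in> carrier_mat n m"
    and X1: "A * X * A = A" and X2: "X * A * X = X"
    and X3: "mat_adjoint (A * X) = A * X" and X4: "mat_adjoint (X * A) = X * A"
    and Y1: "A * Y * A = A" and Y2: "Y * A * Y = Y"
    and Y3: "mat_adjoint (A * Y) = A * Y" and Y4: "mat_adjoint (Y * A) = Y * A"
  shows "X = Y"
proof -
  have "A * X = A * Y * A * X" using Y1 by simp
  also have "\<dots> = (A * Y) * (A * X)"
    using carrier_matD[OF A] carrier_matD[OF X] carrier_matD[OF Y] by (simp add: mult_mat_assoc_dim)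
  also have "\<dots> = mat_adjoint ((A * X) * (A * Y))"
    using A X Y X3 Y3 by (subst mat_adjoint_mult) auto
  also have "(A * X) * (A * Y) = A * X * A * Y"
    using carrier_matD[OF A] carrier_matD[OF X] carrier_matD[OF Y] by (simp add: mult_mat_assoc_dim)
  also have "\<dots> = A * Y" using X1 by simp
  finally have AXY: "A * X = A * Y" using Y3 by simp
  have "X * A = X * (A * Y * A)" using Y1 by simp
  also have "\<dots> = (X * A) * (Y * A)"
    using carrier_matD[OF A] carrier_matD[OF X] carrier_matD[OF Y] by (simp add: mult_mat_assoc_dim)
  also have "\<dots> = mat_adjoint ((Y * A) * (X * A))"
    using A X Y X4 Y4 by (subst mat_adjoint_mult) auto
  also have "(Y * A) * (X * A) = Y * (A * X * A)"
    using carrier_matD[OF A] carrier_matD[OF X] carrier_matD[OF Y] by (simp add: mult_mat_assoc_dim)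
  also have "\<dots> = Y * A" using X1 by simp
  finally have XYA: "X * A = Y * A" using Y4 by simp
  have "X = X * A * X" using X2 by simp
  also have "\<dots> = Y * (A * X)" unfolding XYA using carrier_matD[OF A] carrier_matD[OF X] carrier_matD[OF Y] by (simp add: mult_mat_assoc_dim)
  also have "\<dots> = Y * A * Y" unfolding AXY using carrier_matD[OF A] carrier_matD[OF X] carrier_matD[OF Y] by (simp add: mult_mat_assoc_dim)
  finally show ?thesis using Y2 by simp
qed

text \<open>From G T T = T one gets the orthogonal projection P = GT onto the range of T, and G T
  G^* satisfies all four Penrose equations. Uniqueness then resolves the definite description in
  \<open>mp_inverse\<close>.\<close>

lemma mp_inverse_hermitian:
  fixes T :: "complex mat"
  assumes T: "T \<in> carrier_mat N N" "mat_adjoint T = T"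
  defines "X \<equiv> mp_inverse T"
  shows "X \<in> carrier_mat N N" "T * X * T = T" "mat_adjoint (T * X) = T * X"
    "mat_adjoint (X * T) = X * T"
proof -
  obtain G where G: "G \<in> carrier_mat N N" "G * T * T = T" using hermitian_factor_square[OF T] by blast
  define P where "P = G * T"
  define Y where "Y = G * P"
  define Q where "Q = mat_adjoint G"
  have Q: "Q \<in> carrier_mat N N" using G by (simp add: Q_def)
  have P: "P \<in> carrier_mat N N" and Y: "Y \<in> carrier_mat N N" using G T by (auto simp: P_def Y_def)
  note dims = carrier_matD[OF T(1)] carrier_matD[OF G(1)] carrier_matD[OF P] carrier_matD[OF Q]
    carrier_matD[OF Y]
  note assoc = mult_mat_assoc_dim dims
  have PT: "P * T = T" using G(2) by (simp add: P_def)
  have Padj: "mat_adjoint P = T * Q" using G T by (simp add: P_def Q_def mat_adjoint_mult)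
  have "T * (T * Q) = mat_adjoint (P * T)" using P T by (simp add: dims mat_adjoint_mult Padj)
  then have TTQ: "T * (T * Q) = T" using PT T by simp
  \<comment> \<open>Taking adjoints in PT = T gives T T G^* = T. Inserting this into P = GT turns P
    into T G^*, which is its adjoint.\<close>
  have PTQ: "P = T * Q"
  proof -
    have "P = G * (T * (T * Q))" by (simp add: P_def TTQ)
    also have "\<dots> = G * T * T * Q" by (simp add: assoc)
    finally show ?thesis using G(2) by simp
  qed
  have PH: "mat_adjoint P = P" using Padj PTQ by simp
  have PP: "P * P = P"
  proof -
    have "P * P = P * T * Q" unfolding PTQ by (simp add: assoc)
    then show ?thesis using PT PTQ by simp
  qed
  have YT: "Y * T = P" unfolding Y_def using PT by (simp add: assoc) (simp add: P_def)
  have YG: "Y = G * T * Q" by (simp add: Y_def assoc PTQ)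
  have YH: "mat_adjoint Y = Y"
    unfolding YG using T(2) by (simp add: dims mat_adjoint_mult Q_def mult_mat_assoc_dim)
  have TY: "T * Y = P"
    using arg_cong[OF YT, of mat_adjoint] Y T YH PH by (simp add: dims mat_adjoint_mult)
  have PY: "P * Y = Y"
  proof -
    have "Y = P * Q" using YG by (simp add: P_def)
    then have "P * Y = P * P * Q" by (simp add: assoc)
    then show ?thesis using PP \<open>Y = P * Q\<close> by simp
  qed
  have ex: "Y \<in> carrier_mat (dim_col T) (dim_row T) \<and> T * Y * T = T \<and> Y * T * Y = Y \<and>
      mat_adjoint (T * Y) = T * Y \<and> mat_adjoint (Y * T) = Y * T"
    using Y T by (simp add: TY YT PT PY PH)
  have "X = Y" unfolding X_def mp_inverse_def
  proof (rule the_equality)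
    show "Y \<in> carrier_mat (dim_col T) (dim_row T) \<and> T * Y * T = T \<and> Y * T * Y = Y \<and>
      mat_adjoint (T * Y) = T * Y \<and> mat_adjoint (Y * T) = Y * T" by (fact ex)
  next
    fix Z assume "Z \<in> carrier_mat (dim_col T) (dim_row T) \<and> T * Z * T = T \<and> Z * T * Z = Z \<and>
      mat_adjoint (T * Z) = T * Z \<and> mat_adjoint (Z * T) = Z * T"
    then show "Z = Y" using ex penrose_unique[of T N N Z Y] T by auto
  qed
  then show "X \<in> carrier_mat N N" "T * X * T = T" "mat_adjoint (T * X) = T * X"
    "mat_adjoint (X * T) = X * T" using ex T by auto
qed

section \<open>The central recurrence\<close>

text \<open>Vectors are functions on all indices, of which only the first \<open>N\<close> are read.
  Enlarging or shrinking the window is then a matter of support (\<open>sesq_form_support\<close>),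
  with no change of type or dimension.\<close>

definition sesq_form :: "(nat \<Rightarrow> nat \<Rightarrow> complex) \<Rightarrow> nat \<Rightarrow> (nat \<Rightarrow> complex) \<Rightarrow> (nat \<Rightarrow> complex) \<Rightarrow> complex" where
  "sesq_form t N x y = (\<Sum>r<N. \<Sum>s<N. cnj (x r) * t r s * y s)"

definition psd_on :: "(nat \<Rightarrow> nat \<Rightarrow> complex) \<Rightarrow> nat \<Rightarrow> bool" where
  "psd_on t N \<longleftrightarrow> (\<forall>x. 0 \<le> Re (sesq_form t N x x))"

lemma sesq_form_add:
  "sesq_form t N (\<lambda>r. x r + y r) (\<lambda>r. v r + w r)
    = sesq_form t N x v + sesq_form t N x w + sesq_form t N y v + sesq_form t N y w"
  by (simp add: sesq_form_def sum.distrib algebra_simps)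

lemma sesq_form_scale:
  "sesq_form t N (\<lambda>r. a * x r) (\<lambda>r. b * y r) = cnj a * b * sesq_form t N x y"
  by (simp add: sesq_form_def sum_distrib_left mult_ac)

lemma sesq_form_right: "sesq_form t N x y = (\<Sum>r<N. cnj (x r) * (\<Sum>s<N. t r s * y s))"
  by (simp add: sesq_form_def sum_distrib_left mult_ac)

lemma sesq_form_swap:
  assumes "\<And>r s. r < N \<Longrightarrow> s < N \<Longrightarrow> t s r = cnj (t r s)"
  shows "sesq_form t N y x = cnj (sesq_form t N x y)"
proof -
  have "sesq_form t N y x = (\<Sum>s<N. \<Sum>r<N. cnj (y r) * t r s * x s)"
    unfolding sesq_form_def by (rule sum.swap)
  also have "\<dots> = cnj (sesq_form t N x y)"
    unfolding sesq_form_def cnj_sum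
  proof (intro sum.cong refl)
    fix s r assume "s \<in> {..<N}" "r \<in> {..<N}"
    then show "cnj (y r) * t r s * x s = cnj (cnj (x s) * t s r * y r)"
      using assms[of r s] by (simp add: mult_ac)
  qed
  finally show ?thesis .
qed

lemma sesq_form_support:
  assumes "N \<le> N'" "\<And>r. N \<le> r \<Longrightarrow> x r = 0" "\<And>r. N \<le> r \<Longrightarrow> y r = 0"
  shows "sesq_form t N' x y = sesq_form t N x y"
proof -
  have "(\<Sum>s<N'. cnj (x r) * t r s * y s) = (\<Sum>s<N. cnj (x r) * t r s * y s)" for r
    using assms by (intro sum.mono_neutral_right) auto
  then show ?thesis unfolding sesq_form_def
    using assms by (subst sum.mono_neutral_right[of "{..<N'}" "{..<N}"]) auto
qed

text \<open>Perturb x in the direction y = tx. The form at x - e y is -2 e |y|^2 + e^2 K with K the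
  form at y, and it stays nonnegative for every e > 0 only if y = 0.\<close>

lemma psd_on_kernel:
  assumes psd: "psd_on t N" and herm: "\<And>r s. r < N \<Longrightarrow> s < N \<Longrightarrow> t s r = cnj (t r s)"
    and 0: "sesq_form t N x x = 0" and r: "r < N"
  shows "(\<Sum>s<N. t r s * x s) = 0"
proof -
  define y where "y r = (\<Sum>s<N. t r s * x s)" for r
  define S where "S = (\<Sum>r<N. (cmod (y r))\<^sup>2)"
  have yx: "sesq_form t N y x = complex_of_real S"
    unfolding sesq_form_right y_def[symmetric] S_def of_real_sum
    by (intro sum.cong refl) (metis complex_norm_square mult.commute of_real_power)
  have xy: "sesq_form t N x y = complex_of_real S"
    using sesq_form_swap[of N t x y, OF herm] yx by simp
  have ineq: "2 * S \<le> e * Re (sesq_form t N y y)" if "e > 0" for e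
  proof -
    let ?e = "complex_of_real (- e)"
    have "sesq_form t N (\<lambda>r. 1 * x r + ?e * y r) (\<lambda>r. 1 * x r + ?e * y r)
      = sesq_form t N x x + ?e * complex_of_real S + ?e * complex_of_real S + ?e * ?e * sesq_form t N y y"
      by (subst sesq_form_add, subst (1 2 3 4) sesq_form_scale) (simp add: xy yx)
    then have "0 \<le> Re (?e * complex_of_real S + ?e * complex_of_real S + ?e * ?e * sesq_form t N y y)"
      using psd[unfolded psd_on_def, rule_format, of "\<lambda>r. 1 * x r + ?e * y r"] 0
      by (simp only: add_0)
    then have "0 \<le> e * (e * Re (sesq_form t N y y) - 2 * S)" by (simp add: algebra_simps)
    then show ?thesis using that by (simp add: zero_le_mult_iff)
  qed
  have "2 * S \<le> 0"
  proof (rule field_le_epsilon)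
    fix d :: real assume d: "0 < d"
    \<comment> \<open>The choice e = d / (K + 1) also covers K = 0.\<close>
    let ?K = "Re (sesq_form t N y y)"
    have "0 \<le> ?K" using psd by (simp add: psd_on_def)
    have "2 * S \<le> d / (?K + 1) * ?K" using ineq[of "d / (?K + 1)"] d \<open>0 \<le> ?K\<close> by simp
    also have "\<dots> \<le> d" using d \<open>0 \<le> ?K\<close> by (simp add: field_simps)
    finally show "2 * S \<le> 0 + d" by simp
  qed
  moreover have "(cmod (y r))\<^sup>2 \<le> S" unfolding S_def using r by (intro member_le_sum) auto
  ultimately have "(cmod (y r))\<^sup>2 \<le> 0" by linarith
  then show ?thesis by (simp add: y_def)
qed

lemma nonneg_hermitian_psd_on:
  assumes "nonneg_hermitian N A"
  shows "psd_on (\<lambda>r s. A $$ (r, s)) N"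
  unfolding psd_on_def
proof
  fix x :: "nat \<Rightarrow> complex"
  have A: "A \<in> carrier_mat N N" using assms by (simp add: nonneg_hermitian_def)
  let ?x = "Matrix.vec N x"
  have "scalar_prod (A *\<^sub>v ?x) (conjugate ?x) = (\<Sum>r<N. (\<Sum>s<N. A $$ (r, s) * x s) * cnj (x r))"
    using A by (auto simp: scalar_prod_def lessThan_atLeast0 conjugate_complex_def intro!: sum.cong)
  also have "\<dots> = sesq_form (\<lambda>r s. A $$ (r, s)) N x x"
    by (simp add: sesq_form_right mult.commute)
  finally show "0 \<le> Re (sesq_form (\<lambda>r s. A $$ (r, s)) N x x)"
    using assms vec_carrier[of N x] unfolding nonneg_hermitian_def by (metis (no_types))
qed

lemma sum_lessThan_add: "(\<Sum>r<q + N. f r) = (\<Sum>k<q. f k) + (\<Sum>r<N. f (r + q))" for f :: "nat \<Rightarrow> complex"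
  by (induction N) (auto simp: add.commute add.assoc)

text \<open>With scalar row and column indices the block matrices \<open>T\<^sub>m\<close>, \<open>Y\<^sub>m\<close> and \<open>Z\<^sub>m\<close> are all
  windows of a single infinite matrix.\<close>

definition toep :: "nat \<Rightarrow> (nat \<Rightarrow> complex mat) \<Rightarrow> nat \<Rightarrow> nat \<Rightarrow> complex" where
  "toep q c r s = (if s div q \<le> r div q then c (r div q - s div q) $$ (r mod q, s mod q)
     else cnj (c (s div q - r div q) $$ (s mod q, r mod q)))"

lemma toep_shift: "0 < q \<Longrightarrow> toep q c (r + q) (s + q) = toep q c r s"
  by (simp add: toep_def)

lemma toeplitz_T_dim [simp]:
  "dim_row (toeplitz_T q c m) = (m + 1) * q" "dim_col (toeplitz_T q c m) = (m + 1) * q"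
  by (simp_all add: toeplitz_T_def block_mat_def)

lemma col_Y_dim [simp]: "dim_row (col_Y q c m) = m * q" "dim_col (col_Y q c m) = q"
  by (simp_all add: col_Y_def block_mat_def)

lemma row_Z_dim [simp]: "dim_row (row_Z q c m) = q" "dim_col (row_Z q c m) = m * q"
  by (simp_all add: row_Z_def block_mat_def)

lemma index_toeplitz_T:
  assumes "0 < q" "\<And>j. c j \<in> carrier_mat q q" "r < (m + 1) * q" "s < (m + 1) * q"
  shows "toeplitz_T q c m $$ (r, s) = toep q c r s"
  using assms carrier_matD[OF assms(2)] by (simp add: toeplitz_T_def block_mat_def toep_def)

lemma index_col_Y:
  assumes "0 < q" "r < m * q" "s < q"
  shows "col_Y q c m $$ (r, s) = toep q c (r + q) s"
  using assms by (simp add: col_Y_def block_mat_def toep_def)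

lemma index_row_Z:
  assumes "0 < q" "i < q" "s < m * q"
  shows "row_Z q c m $$ (i, s) = toep q c (m * q + i) s"
proof -
  have "s div q < m" using assms by (simp add: less_mult_imp_div_less)
  then show ?thesis using assms by (simp add: row_Z_def block_mat_def toep_def)
qed

section \<open>The central continuation in scalar coordinates\<close>

locale toeplitz_data =
  fixes n q :: nat and C :: "nat \<Rightarrow> complex mat"
  assumes n1: "1 \<le> n" and q1: "1 \<le> q" and nonneg: "toeplitz_nonneg q n C"
begin

definition c where "c = central_seq q n C"

abbreviation t where "t \<equiv> toep q c"

lemma q0 [simp]: "0 < q" using q1 by simp

lemma c_le: "j \<le> n \<Longrightarrow> c j = C j" by (simp add: c_def central_seq_le)

lemma c_carrier [simp]: "c j \<in> carrier_mat q q"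
proof (cases "j \<le> n")
  case True
  then show ?thesis using nonneg by (simp add: c_le toeplitz_nonneg_def)
next
  case False
  then show ?thesis using n1
    by (auto simp: c_def central_seq_gt center_M_def intro!: carrier_matI)
qed

lemma toeplitz_T_c: "m \<le> n \<Longrightarrow> toeplitz_T q C m = toeplitz_T q c m"
  unfolding toeplitz_T_def by (intro block_mat_cong) (auto simp: c_le)

lemma T_index [simp]: "r < (m + 1) * q \<Longrightarrow> s < (m + 1) * q \<Longrightarrow> toeplitz_T q c m $$ (r, s) = t r s"
  by (simp add: index_toeplitz_T)

lemma T_carrier [simp]: "toeplitz_T q c m \<in> carrier_mat ((m + 1) * q) ((m + 1) * q)"
  by (intro carrier_matI) auto

lemma T_n_nonneg: "nonneg_hermitian ((n + 1) * q) (toeplitz_T q c n)"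
  using nonneg toeplitz_T_c[of n] by (simp add: toeplitz_nonneg_def)

lemma psd_n: "psd_on t ((n + 1) * q)"
proof -
  have "sesq_form t ((n + 1) * q) x x
      = sesq_form (\<lambda>r s. toeplitz_T q c n $$ (r, s)) ((n + 1) * q) x x" for x
    unfolding sesq_form_def by (intro sum.cong refl) (simp add: index_toeplitz_T)
  then show ?thesis using nonneg_hermitian_psd_on[OF T_n_nonneg] by (simp add: psd_on_def)
qed

lemma c0_hermitian:
  assumes "i < q" "j < q"
  shows "c 0 $$ (j, i) = cnj (c 0 $$ (i, j))"
proof -
  have lt: "i < (n + 1) * q" "j < (n + 1) * q" using assms by auto
  have "mat_adjoint (toeplitz_T q c n) = toeplitz_T q c n"
    using T_n_nonneg by (simp add: nonneg_hermitian_def)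
  then have "toeplitz_T q c n $$ (j, i) = cnj (toeplitz_T q c n $$ (i, j))"
    using lt by (metis index_mat_adjoint toeplitz_T_dim)
  then show ?thesis using lt assms by (simp add: toep_def)
qed

lemma t_hermitian: "t s r = cnj (t r s)"
  using c0_hermitian[of "s mod q" "r mod q"] by (auto simp: toep_def)

lemma T_hermitian: "mat_adjoint (toeplitz_T q c m) = toeplitz_T q c m"
  by (intro eq_matI) (auto simp: index_toeplitz_T t_hermitian[symmetric])

definition W where "W = mp_inverse (toeplitz_T q c (n - 1)) * col_Y q c n"

text \<open>The zero padding lets one and the same coefficient column be multiplied by T_m for every
  m.\<close>

definition \<beta> where "\<beta> r k = (if r < n * q then W $$ (r, k) else 0)"

text \<open>In block form T_{m-1} beta = Y_m. From block row n - 1 on, no adjoint blocks meet the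
  support of beta, and the rows read C_{j+1} = C_j beta_0 + ... + C_{j-n+1} beta_{n-1}.\<close>

definition recurrence where
  "recurrence m \<longleftrightarrow> (\<forall>r<m * q. \<forall>k<q. (\<Sum>s<n * q. t r s * \<beta> s k) = t (r + q) k)"

lemma n_pred: "(n - 1 + 1) * q = n * q" using n1 by simp

lemma W_carrier: "W \<in> carrier_mat (n * q) q"
  using mp_inverse_hermitian(1)[OF T_carrier T_hermitian, of "n - 1"]
  unfolding W_def n_pred by (intro carrier_matI) auto

lemma sum_pad: "n \<le> m \<Longrightarrow> (\<Sum>s<m * q. t r s * \<beta> s k) = (\<Sum>s<n * q. t r s * \<beta> s k)"
  by (intro sum.mono_neutral_right) (auto simp: \<beta>_def)

text \<open>The claim is that Y lies in the range of T = T_{n-1}. Columns of E = I - TX lie in the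
  kernel of T; extended by a zero block they have zero energy under T_n, so T_n annihilates them,
  and its first block row then says Y^* E = 0.\<close>

lemma recurrence_n: "recurrence n"
proof -
  let ?N = "n * q"
  define T where "T = toeplitz_T q c (n - 1)"
  define X where "X = mp_inverse T"
  define Y where "Y = col_Y q c n"
  have T: "T \<in> carrier_mat ?N ?N" "mat_adjoint T = T"
    using T_carrier[of "n - 1"] T_hermitian unfolding T_def n_pred by auto
  note X = mp_inverse_hermitian[OF T, folded X_def]
  have Y: "Y \<in> carrier_mat ?N q" by (simp add: Y_def carrier_matI)
  note dims = carrier_matD[OF T(1)] carrier_matD[OF X(1)] carrier_matD[OF Y]
  define E where "E = 1\<^sub>m ?N - T * X"
  have E: "E \<in> carrier_mat ?N ?N" using dims by (auto simp: E_def intro!: carrier_matI)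
  have TXH: "cnj ((T * X) $$ (j, i)) = (T * X) $$ (i, j)" if "i < ?N" "j < ?N" for i j
  proof -
    have "mat_adjoint (T * X) $$ (i, j) = cnj ((T * X) $$ (j, i))"
      using that dims by (intro index_mat_adjoint) auto
    then show ?thesis using X(3) by simp
  qed
  have EH: "mat_adjoint E = E"
    unfolding E_def using dims TXH by (intro eq_matI) (auto simp del: index_mult_mat(1))
  have TTX: "T * (T * X) = T"
  proof -
    have "mat_adjoint (T * X * T) = T * (T * X)"
      using X(3) T(2) dims by (simp add: mat_adjoint_mult)
    then show ?thesis using X(2) T(2) by simp
  qed
  have TE: "T * E = 0\<^sub>m ?N ?N"
    using TTX T X(1) unfolding E_def by (simp add: mult_minus_distrib_mat[of T ?N ?N "1\<^sub>m ?N" ?N])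
  have EY: "E * Y = 0\<^sub>m ?N q"
  proof (intro eq_matI)
    fix a k assume ak: "a < dim_row (0\<^sub>m ?N q)" "k < dim_col (0\<^sub>m ?N q)"
    then have a: "a < ?N" and k: "k < q" by auto
    \<comment> \<open>Column a of E placed below a zero block: the lower right corner of T_n is
      again T_{n-1}, by shift invariance.\<close>
    define x where "x r = (if r < q then 0 else if r < q + ?N then E $$ (r - q, a) else 0)" for r
    have Tx: "(\<Sum>s<?N. t r s * x (s + q)) = 0" if "r < ?N" for r
    proof -
      have "(\<Sum>s<?N. t r s * x (s + q)) = (T * E) $$ (r, a)"
        using that a T E n1
        by (auto simp: T_def x_def scalar_prod_def lessThan_atLeast0 index_toeplitz_T intro!: sum.cong)
      then show ?thesis using TE that a by simp
    qed
    have xq: "x k = 0" if "k < q" for k using that by (simp add: x_def)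
    have inner: "(\<Sum>s<q + ?N. t (r + q) s * x s) = 0" if "r < ?N" for r
    proof -
      have "(\<Sum>s<q. t (r + q) s * x s) = 0" by (intro sum.neutral) (simp add: xq)
      moreover have "(\<Sum>s<?N. t (r + q) (s + q) * x (s + q)) = 0"
        using Tx[OF that] by (simp only: toep_shift[OF q0])
      ultimately show ?thesis by (simp only: sum_lessThan_add add_0)
    qed
    have "sesq_form t (q + ?N) x x = (\<Sum>k<q. cnj (x k) * (\<Sum>s<q + ?N. t k s * x s))
        + (\<Sum>r<?N. cnj (x (r + q)) * (\<Sum>s<q + ?N. t (r + q) s * x s))"
      unfolding sesq_form_right by (rule sum_lessThan_add)
    also have "(\<Sum>k<q. cnj (x k) * (\<Sum>s<q + ?N. t k s * x s)) = 0"
      by (intro sum.neutral) (simp add: xq)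
    also have "(\<Sum>r<?N. cnj (x (r + q)) * (\<Sum>s<q + ?N. t (r + q) s * x s)) = 0"
      by (intro sum.neutral) (simp add: inner)
    finally have "sesq_form t (q + ?N) x x = 0" by simp
    \<comment> \<open>Zero energy under the nonnegative T_n. The first block row of T_n, apart from
      its diagonal block, is Y^*.\<close>
    then have "(\<Sum>s<q + ?N. t k s * x s) = 0"
      using psd_n k by (intro psd_on_kernel) (auto simp: algebra_simps t_hermitian[symmetric])
    then have 0: "(\<Sum>s<?N. t k (s + q) * E $$ (s, a)) = 0"
      unfolding sum_lessThan_add by (simp add: x_def)
    have "(E * Y) $$ (a, k) = (\<Sum>s<?N. E $$ (a, s) * t (s + q) k)"
      using a k E Y by (auto simp: scalar_prod_def lessThan_atLeast0 Y_def index_col_Y intro!: sum.cong)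
    also have "\<dots> = cnj (\<Sum>s<?N. t k (s + q) * E $$ (s, a))"
      unfolding cnj_sum
    proof (intro sum.cong refl)
      fix s assume "s \<in> {..<?N}"
      then have "E $$ (a, s) = cnj (E $$ (s, a))" using EH E a
        by (metis carrier_matD index_mat_adjoint lessThan_iff)
      then show "E $$ (a, s) * t (s + q) k = cnj (t k (s + q) * E $$ (s, a))"
        by (simp add: t_hermitian[symmetric] mult.commute)
    qed
    finally show "(E * Y) $$ (a, k) = 0\<^sub>m ?N q $$ (a, k)" using 0 a k by simp
  qed (use E Y in auto)
  have "T * W = Y"
  proof -
    have TB: "T * W = T * X * Y"
      using dims unfolding W_def T_def[symmetric] X_def[symmetric] Y_def[symmetric]
      by (simp add: mult_mat_assoc_dim)
    have "E * Y = Y - T * X * Y"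
      using X(1) T(1) Y unfolding E_def
      by (subst minus_mult_distrib_mat[of _ ?N ?N _ _ q]) auto
    then have *: "(Y - T * X * Y) $$ (i, j) = 0" if "i < ?N" "j < q" for i j
      using EY that by (metis index_zero_mat(1))
    have "(T * X * Y) $$ (i, j) = Y $$ (i, j)" if "i < ?N" "j < q" for i j
      using *[OF that] that dims by (subst (asm) index_minus_mat) (auto simp del: index_mult_mat(1))
    then show ?thesis unfolding TB using dims by (intro eq_matI) (auto simp del: index_mult_mat(1))
  qed
  then have TB: "(T * W) $$ (r, k) = t (r + q) k" if "r < ?N" "k < q" for r k
    using that by (simp add: Y_def index_col_Y)
  have "(T * W) $$ (r, k) = (\<Sum>s<?N. t r s * \<beta> s k)" if "r < ?N" "k < q" for r k
    using that T W_carrier n1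
    by (auto simp: T_def \<beta>_def scalar_prod_def lessThan_atLeast0 index_toeplitz_T intro!: sum.cong)
  then show ?thesis unfolding recurrence_def using TB by auto
qed

text \<open>Schur complement: the block column \<open>Y\<close> of \<open>T\<^sub>m\<close> equals \<open>T\<^sub>m\<^sub>-\<^sub>1 \<beta>\<close>, and the complement
  \<open>C\<^sub>0 - \<beta>\<^sup>* T\<^sub>n\<^sub>-\<^sub>1 \<beta>\<close> does not depend on \<open>m\<close> because \<open>\<beta>\<close> is padded with zeros.\<close>

lemma psd_identity:
  fixes x :: "nat \<Rightarrow> complex"
  assumes rec: "recurrence m" and m: "n \<le> m"
  defines "u \<equiv> \<lambda>r. \<Sum>l<q. \<beta> r l * x l"
  defines "v \<equiv> \<lambda>r. x (r + q) + u r"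
  shows "sesq_form t ((m + 1) * q) x x
    = sesq_form t (m * q) v v + (sesq_form t q x x - sesq_form t (n * q) u u)"
proof -
  let ?N = "m * q" and ?x = "\<lambda>r. x (r + q)"
  \<comment> \<open>The first block column of T_m below the diagonal is T_{m-1} beta, so the mixed
    terms complete the square in the tail of x plus u.\<close>
  have tu: "(\<Sum>l<q. t (r + q) l * x l) = (\<Sum>s<?N. t r s * u s)" if "r < ?N" for r
  proof -
    have "(\<Sum>l<q. t (r + q) l * x l) = (\<Sum>l<q. (\<Sum>s<?N. t r s * \<beta> s l) * x l)"
      using rec that m unfolding recurrence_def sum_pad[OF m] by simp
    also have "\<dots> = (\<Sum>s<?N. t r s * u s)"
      unfolding u_def sum_distrib_left sum_distrib_right by (subst sum.swap) (simp add: mult_ac)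
    finally show ?thesis .
  qed
  have W: "(\<Sum>r<?N. cnj (?x r) * (\<Sum>l<q. t (r + q) l * x l)) = sesq_form t ?N ?x u"
    unfolding sesq_form_right by (intro sum.cong refl) (simp add: tu)
  have "(\<Sum>k<q. cnj (x k) * (\<Sum>s<?N. t k (s + q) * ?x s))
      = (\<Sum>s<?N. \<Sum>k<q. cnj (x k) * (t k (s + q) * ?x s))"
    unfolding sum_distrib_left by (rule sum.swap)
  also have "\<dots> = (\<Sum>s<?N. cnj (cnj (?x s) * (\<Sum>l<q. t (s + q) l * x l)))"
    unfolding cnj_sum sum_distrib_left
    by (intro sum.cong refl) (simp add: t_hermitian[symmetric] mult_ac)
  also have "\<dots> = cnj (sesq_form t ?N ?x u)" unfolding W[symmetric] by simp
  also have "\<dots> = sesq_form t ?N u ?x"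
    by (rule sesq_form_swap[symmetric]) (rule t_hermitian)
  finally have C: "(\<Sum>k<q. cnj (x k) * (\<Sum>s<?N. t k (s + q) * ?x s)) = sesq_form t ?N u ?x" .
  have D: "(\<Sum>r<?N. cnj (?x r) * (\<Sum>s<?N. t (r + q) (s + q) * ?x s)) = sesq_form t ?N ?x ?x"
    by (simp add: sesq_form_right toep_shift)
  have "sesq_form t (q + ?N) x x = sesq_form t q x x + sesq_form t ?N u ?x
      + sesq_form t ?N ?x u + sesq_form t ?N ?x ?x"
    unfolding sesq_form_right[of t "q + ?N"] sum_lessThan_add
    by (simp only: distrib_left sum.distrib W C D sesq_form_right[of t q, symmetric]) (simp add: add_ac)
  moreover have "sesq_form t ?N u u = sesq_form t (n * q) u u"
    using m by (intro sesq_form_support) (auto simp: u_def \<beta>_def)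
  ultimately show ?thesis unfolding v_def sesq_form_add by (simp add: algebra_simps)
qed

text \<open>The Schur complement is read off from T_n: for the vector \<open>y\<close> with tail -u
  the completed square vanishes, and the form of T_n at \<open>y\<close> is exactly the complement
  at the first block of x. So its sign, known for size n, carries over to size m.\<close>

lemma psd_step:
  assumes "psd_on t (m * q)" "recurrence m" "n \<le> m"
  shows "psd_on t ((m + 1) * q)"
  unfolding psd_on_def
proof
  fix x :: "nat \<Rightarrow> complex"
  define u where "u = (\<lambda>r. \<Sum>l<q. \<beta> r l * x l)"
  define y where "y r = (if r < q then x r else - u (r - q))" for r
  have u: "(\<Sum>l<q. \<beta> r l * y l) = u r" for r by (simp add: u_def y_def)
  have "sesq_form t ((n + 1) * q) y y = sesq_form t q y y - sesq_form t (n * q) u u"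
    unfolding psd_identity[OF recurrence_n order_refl] u by (simp add: y_def sesq_form_def)
  also have "sesq_form t q y y = sesq_form t q x x" by (simp add: sesq_form_def y_def)
  finally have "0 \<le> Re (sesq_form t q x x - sesq_form t (n * q) u u)"
    using psd_n[unfolded psd_on_def, rule_format, of y] by (simp only:)
  then show "0 \<le> Re (sesq_form t ((m + 1) * q) x x)"
    using assms(1) unfolding psd_identity[OF assms(2,3)] u_def[symmetric] psd_on_def by simp
qed

text \<open>Only the last block row is new. With Y = T B' the definition gives C_{m+1} = Z X T B',
  and Z X T = Z because Z annihilates the kernel of T, once more by positivity. Hence C_{m+1} = Z
  B', which is that row.\<close>

lemma recurrence_step:
  assumes psd: "psd_on t ((m + 1) * q)" and rec: "recurrence m" and m: "n \<le> m"
  shows "recurrence (m + 1)"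
proof -
  let ?N = "m * q"
  have m1: "1 \<le> m" using m n1 by simp
  have mp: "(m - 1 + 1) * q = ?N" using m1 by simp
  define T where "T = toeplitz_T q c (m - 1)"
  define X where "X = mp_inverse T"
  define Y where "Y = col_Y q c m"
  define Z where "Z = row_Z q c m"
  have T: "T \<in> carrier_mat ?N ?N" "mat_adjoint T = T"
    using T_carrier[of "m - 1"] T_hermitian unfolding T_def mp by auto
  note X = mp_inverse_hermitian[OF T, folded X_def]
  define B' where "B' = mat ?N q (\<lambda>(r, k). \<beta> r k)"
  have dims [simp]: "dim_row T = ?N" "dim_col T = ?N" "dim_row X = ?N" "dim_col X = ?N"
    "dim_row Y = ?N" "dim_col Y = q" "dim_row Z = q" "dim_col Z = ?N"
    "dim_row B' = ?N" "dim_col B' = q"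
    using carrier_matD[OF T(1)] carrier_matD[OF X(1)] by (simp_all add: Y_def Z_def B'_def)
  have TB: "T * B' = Y"
  proof (intro eq_matI)
    fix r k assume "r < dim_row Y" "k < dim_col Y"
    then have rk: "r < ?N" "k < q" by auto
    have "(T * B') $$ (r, k) = (\<Sum>s<?N. t r s * \<beta> s k)"
      using rk m1 by (auto simp: scalar_prod_def lessThan_atLeast0 T_def B'_def index_toeplitz_T intro!: sum.cong)
    also have "\<dots> = Y $$ (r, k)"
      using rec rk unfolding sum_pad[OF m] recurrence_def by (simp add: Y_def index_col_Y)
    finally show "(T * B') $$ (r, k) = Y $$ (r, k)" .
  qed auto
  define E where "E = 1\<^sub>m ?N - X * T"
  have dimE [simp]: "dim_row E = ?N" "dim_col E = ?N" by (simp_all add: E_def)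
  have TE: "T * E = 0\<^sub>m ?N ?N"
    using X(2) T X(1) unfolding E_def
    by (subst mult_minus_distrib_mat[of T ?N ?N "1\<^sub>m ?N" ?N]) (auto simp: mult_mat_assoc_dim)
  have ZE: "Z * E = 0\<^sub>m q ?N"
  proof (intro eq_matI)
    fix i a assume "i < dim_row (0\<^sub>m q ?N)" "a < dim_col (0\<^sub>m q ?N)"
    then have i: "i < q" and a: "a < ?N" by auto
    \<comment> \<open>This time the zero block is appended at the bottom: T_{m-1} is also the upper
      left corner of T_m, whose last block row starts with Z.\<close>
    define x where "x r = (if r < ?N then E $$ (r, a) else 0)" for r
    have "(\<Sum>s<?N. t r s * x s) = (T * E) $$ (r, a)" if "r < ?N" for r
      using that a m1
      by (auto simp: scalar_prod_def lessThan_atLeast0 T_def x_def index_toeplitz_T intro!: sum.cong)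
    then have "sesq_form t ?N x x = 0" unfolding sesq_form_right using TE a by simp
    moreover have "sesq_form t ((m + 1) * q) x x = sesq_form t ?N x x"
      by (intro sesq_form_support) (auto simp: x_def)
    ultimately have "(\<Sum>s<(m + 1) * q. t (m * q + i) s * x s) = 0"
      using psd i by (intro psd_on_kernel) (auto simp: t_hermitian[symmetric])
    moreover have "(\<Sum>s<(m + 1) * q. t (m * q + i) s * x s) = (\<Sum>s<?N. t (m * q + i) s * x s)"
      by (intro sum.mono_neutral_right) (auto simp: x_def)
    moreover have "(Z * E) $$ (i, a) = (\<Sum>s<?N. t (m * q + i) s * x s)"
      using i a by (auto simp: scalar_prod_def lessThan_atLeast0 Z_def x_def index_row_Z intro!: sum.cong)
    ultimately show "(Z * E) $$ (i, a) = 0\<^sub>m q ?N $$ (i, a)" using i a by simp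
  qed auto
  have "c (m + 1) = Z * B'"
  proof -
    have "c (m + 1) = Z * X * Y"
      using m n1 m1 unfolding c_def
      by (subst central_seq_gt) (auto simp: center_M_def Z_def X_def Y_def T_def c_def)
    also have "\<dots> = Z * (X * T) * B'" unfolding TB[symmetric] by (simp add: mult_mat_assoc_dim)
    also have "Z * (X * T) = Z"
    proof -
      have "Z * E = Z - Z * (X * T)" unfolding E_def
        by (subst mult_minus_distrib_mat[of Z q ?N "1\<^sub>m ?N" ?N]) (auto intro!: carrier_matI)
      then have *: "(Z - Z * (X * T)) $$ (i, j) = 0" if "i < q" "j < ?N" for i j
        using ZE that by (metis index_zero_mat(1))
      have "(Z * (X * T)) $$ (i, j) = Z $$ (i, j)" if "i < q" "j < ?N" for i j
        using *[OF that] that by (subst (asm) index_minus_mat) (auto simp del: index_mult_mat(1))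
      then show ?thesis by (intro eq_matI) (auto simp del: index_mult_mat(1))
    qed
    finally show ?thesis .
  qed
  moreover have "(Z * B') $$ (i, k) = (\<Sum>s<?N. t (m * q + i) s * \<beta> s k)" if "i < q" "k < q" for i k
    using that by (auto simp: scalar_prod_def lessThan_atLeast0 Z_def B'_def index_row_Z intro!: sum.cong)
  ultimately have last: "(\<Sum>s<n * q. t (m * q + i) s * \<beta> s k) = c (m + 1) $$ (i, k)"
    if "i < q" "k < q" for i k using that by (simp add: sum_pad[OF m])
  show ?thesis unfolding recurrence_def
  proof (intro allI impI)
    fix r k assume r: "r < (m + 1) * q" and k: "k < q"
    show "(\<Sum>s<n * q. t r s * \<beta> s k) = t (r + q) k"
    proof (cases "r < ?N")
      case True
      then show ?thesis using rec k by (simp add: recurrence_def)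
    next
      case False
      then obtain i where i: "r = ?N + i" by (metis le_add_diff_inverse not_less)
      then have iq: "i < q" using r by simp
      have "t (r + q) k = c (m + 1) $$ (i, k)"
        using iq k by (simp add: i toep_def div_add1_eq)
      then show ?thesis using last[OF iq k] i by simp
    qed
  qed
qed

lemma recurrence: "k < q \<Longrightarrow> (\<Sum>s<n * q. t r s * \<beta> s k) = t (r + q) k"
proof -
  \<comment> \<open>The window of the positivity claim is one block ahead of the recurrence, since
    continuing the recurrence from m to m + 1 uses T_m.\<close>
  have "psd_on t ((m + 1) * q) \<and> recurrence m" if "n \<le> m" for m
    using that
  proof (induction m rule: dec_induct)
    case base
    show ?case using psd_n recurrence_n by blast
  next
    case (step m)
    then have "recurrence (Suc m)" using recurrence_step[of m] by simp
    then show ?case using psd_step[of "Suc m"] step by simp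
  qed
  \<comment> \<open>The index is large enough both for the induction, which starts at n, and for row
    r to lie in the window, as q is at least 1.\<close>
  then have "recurrence (max n (r + 1))" by simp
  moreover have "r < max n (r + 1) * q"
  proof -
    have "r < (r + 1) * 1" by simp
    also have "\<dots> \<le> max n (r + 1) * q" using q1 by (intro mult_le_mono) auto
    finally show ?thesis .
  qed
  ultimately show "k < q \<Longrightarrow> ?thesis" unfolding recurrence_def by blast
qed

end

section \<open>The matrix polynomials\<close>

lemma sum_blocks: "(\<Sum>r<n * q. f r) = (\<Sum>k<n. \<Sum>i<q. f (k * q + i))"
  for f :: "nat \<Rightarrow> complex"
proof (induction n)
  case (Suc n)
  have "(\<Sum>r<Suc n * q. f r) = (\<Sum>k<n * q. f k) + (\<Sum>r<q. f (r + n * q))"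
    using sum_lessThan_add[of f "n * q" q] by (simp add: add.commute)
  then show ?case using Suc by (simp add: add.commute)
qed simp

lemma index_row_e:
  assumes "0 < q" "i < q" "r < (m + 1) * q"
  shows "row_e q m z $$ (i, r) = (if r mod q = i then z ^ (r div q) else 0)"
  using assms by (auto simp: row_e_def block_mat_def)

lemma row_e_dim [simp]: "dim_row (row_e q m z) = q" "dim_col (row_e q m z) = (m + 1) * q"
  by (simp_all add: row_e_def block_mat_def)

lemma lower_S_dim [simp]:
  "dim_row (lower_S q C m) = (m + 1) * q" "dim_col (lower_S q C m) = (m + 1) * q"
  by (simp_all add: lower_S_def block_mat_def)

lemma index_row_e_mult:
  assumes "0 < q" "i < q" "k < dim_col A" "dim_row A = (m + 1) * q"
  shows "(row_e q m z * A) $$ (i, k) = (\<Sum>b<m + 1. z ^ b * A $$ (b * q + i, k))"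
proof -
  have "(row_e q m z * A) $$ (i, k) = (\<Sum>r<(m + 1) * q. row_e q m z $$ (i, r) * A $$ (r, k))"
    using assms by (auto simp: scalar_prod_def lessThan_atLeast0 intro!: sum.cong)
  also have "\<dots> = (\<Sum>b<m + 1. \<Sum>a<q. row_e q m z $$ (i, b * q + a) * A $$ (b * q + a, k))"
    by (rule sum_blocks)
  also have "\<dots> = (\<Sum>b<m + 1. \<Sum>a<q. if a = i then z ^ b * A $$ (b * q + i, k) else 0)"
  proof (intro sum.cong refl)
    fix b a assume ba: "b \<in> {..<m + 1}" "a \<in> {..<q}"
    have "b * q + a < b * q + q" using ba by simp
    also have "\<dots> = (b + 1) * q" by simp
    also have "\<dots> \<le> (m + 1) * q" using ba by (intro mult_le_mono1) auto
    finally show "row_e q m z $$ (i, b * q + a) * A $$ (b * q + a, k)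
        = (if a = i then z ^ b * A $$ (b * q + i, k) else 0)"
      using ba assms(1,2) by (auto simp: index_row_e)
  qed
  finally show ?thesis using assms(2) by simp
qed

context toeplitz_data
begin

text \<open>The matrices S_m continued to one infinite lower triangular block Toeplitz matrix in
  scalar indices. Its block diagonals are the Taylor coefficients C_0, 2 C_1, 2 C_2, ... of
  F.\<close>

definition gam where
  "gam r s = (if s div q \<le> r div q then
     (if r div q = s div q then 1 else 2) * c (r div q - s div q) $$ (r mod q, s mod q) else 0)"

text \<open>S + S^* = 2T. On the diagonal blocks this is where C_0 being Hermitian enters. The
  identity is the source of S^* in a_n.\<close>

lemma gam_add_cnj: "gam r s + cnj (gam s r) = 2 * t r s"
  using c0_hermitian[of "r mod q" "s mod q"] by (auto simp: gam_def toep_def)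

lemma Gamma_coeff_eq:
  assumes "j \<le> n" "i < q" "k < q"
  shows "Gamma_coeff C j $$ (i, k) = (if j = 0 then 1 else 2) * c j $$ (i, k)"
proof -
  have d: "dim_row (C j) = q" "dim_col (C j) = q" using c_carrier[of j] c_le[OF assms(1)] by auto
  show ?thesis
    using assms(2,3) d c0_hermitian[of k i] c_le[OF assms(1)]
    by (auto simp: Gamma_coeff_def mat_re_def)
qed

lemma index_lower_S:
  assumes "r < n * q" "s < n * q"
  shows "lower_S q C (n - 1) $$ (r, s) = gam r s"
proof -
  have "r div q < n" "s div q < n" using assms by (simp_all add: less_mult_imp_div_less)
  then show ?thesis using assms n1
    by (simp add: lower_S_def block_mat_def Gamma_coeff_eq gam_def)
qed

lemma W_eq: "mp_inverse (toeplitz_T q C (n - 1)) * col_Y q C n = W"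
proof -
  have "toeplitz_T q C (n - 1) = toeplitz_T q c (n - 1)" by (rule toeplitz_T_c) simp
  moreover have "col_Y q C n = col_Y q c n"
    unfolding col_Y_def by (intro block_mat_cong) (auto simp: c_le)
  ultimately show ?thesis by (simp add: W_def)
qed

lemma mp_dims [simp]:
  "dim_row (mp_inverse (toeplitz_T q C (n - 1))) = n * q"
  "dim_col (mp_inverse (toeplitz_T q C (n - 1))) = n * q"
  using mp_inverse_hermitian(1)[OF T_carrier T_hermitian, of "n - 1"] toeplitz_T_c[of "n - 1"]
  unfolding n_pred by auto

lemma index_fun_b:
  assumes "i < q" "k < q"
  shows "fun_b q n C z $$ (i, k)
    = (if i = k then 1 else 0) - (\<Sum>b<n. z ^ (b + 1) * \<beta> (b * q + i) k)"
proof -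
  have 1: "row_e q (n - 1) z * mp_inverse (toeplitz_T q C (n - 1)) * col_Y q C n
      = row_e q (n - 1) z * W"
    unfolding W_eq[symmetric] by (intro mult_mat_assoc_dim) (simp_all only: mp_dims row_e_dim col_Y_dim n_pred)
  have 2: "(row_e q (n - 1) z * W) $$ (i, k) = (\<Sum>b<n. z ^ b * W $$ (b * q + i, k))"
    using index_row_e_mult[of q i k W "n - 1" z] assms W_carrier n1 by simp
  have "W $$ (b * q + i, k) = \<beta> (b * q + i) k" if "b < n" for b
  proof -
    have "b * q + i < (b + 1) * q" using assms by simp
    also have "\<dots> \<le> n * q" using that by (intro mult_le_mono1) auto
    finally show ?thesis by (simp add: \<beta>_def)
  qed
  then show ?thesis unfolding fun_b_def 1 using assms 2 W_carrier
    by (simp add: sum_distrib_left mult_ac del: index_mult_mat(1))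
qed

lemma index_fun_a:
  assumes "i < q" "k < q"
  shows "fun_a q n C z $$ (i, k) = c 0 $$ (i, k)
    + (\<Sum>b<n. z ^ (b + 1) * (\<Sum>r<n * q. cnj (gam r (b * q + i)) * \<beta> r k))"
proof -
  define S where "S = mat_adjoint (lower_S q C (n - 1))"
  have S [simp]: "dim_row S = n * q" "dim_col S = n * q"
    unfolding S_def dim_mat_adjoint lower_S_dim n_pred by auto
  have Wd: "dim_row W = n * q" "dim_col W = q" using W_carrier by auto
  have 1: "row_e q (n - 1) z * S * mp_inverse (toeplitz_T q C (n - 1)) * col_Y q C n
      = row_e q (n - 1) z * (S * W)"
    unfolding W_eq[symmetric]
    using row_e_dim(2)[of q "n - 1" z, unfolded n_pred]
    by (simp only: mult_mat_assoc_dim S mp_dims col_Y_dim index_mult_mat(2,3))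
  have 2: "(row_e q (n - 1) z * (S * W)) $$ (i, k) = (\<Sum>b<n. z ^ b * (S * W) $$ (b * q + i, k))"
    using index_row_e_mult[of q i k "S * W" "n - 1" z] assms Wd n1 by (simp del: index_mult_mat(1))
  have 3: "(S * W) $$ (b * q + i, k) = (\<Sum>r<n * q. cnj (gam r (b * q + i)) * \<beta> r k)" if "b < n" for b
  proof -
    have "b * q + i < (b + 1) * q" using assms by simp
    also have "\<dots> \<le> n * q" using that by (intro mult_le_mono1) auto
    finally have lt: "b * q + i < n * q" .
    have Sidx: "S $$ (b * q + i, r) = cnj (gam r (b * q + i))" if "r < n * q" for r
      unfolding S_def using that lt n_pred
      by (subst index_mat_adjoint) (simp_all only: lower_S_dim n_pred index_lower_S)
    have "(S * W) $$ (b * q + i, k) = (\<Sum>r<n * q. S $$ (b * q + i, r) * W $$ (r, k))"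
      using lt assms Wd by (auto simp: scalar_prod_def lessThan_atLeast0 intro!: sum.cong)
    then show ?thesis by (simp add: Sidx \<beta>_def)
  qed
  have d: "dim_row (C 0) = q" "dim_col (C 0) = q" using c_carrier[of 0] c_le[of 0] by auto
  have "fun_a q n C z $$ (i, k) = Gamma_coeff C 0 $$ (i, k)
      + z * (row_e q (n - 1) z * (S * W)) $$ (i, k)"
    unfolding fun_a_def S_def[symmetric] 1 using assms Wd
    by (subst index_add_mat) (simp_all del: index_mult_mat(1))
  then show ?thesis using 2 3 assms Gamma_coeff_eq[of 0 i k]
    by (simp add: sum_distrib_left mult_ac del: index_mult_mat(1))
qed

lemma fun_a_dim [simp]: "dim_row (fun_a q n C z) = q" "dim_col (fun_a q n C z) = q"
  by (simp_all add: fun_a_def)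

lemma fun_b_dim [simp]: "dim_row (fun_b q n C z) = q" "dim_col (fun_b q n C z) = q"
  by (simp_all add: fun_b_def)

text \<open>For p at least 0, the coefficient of z^{p+1} on the left is 2 C_{p+1} minus block row p
  of S beta. By the recurrence 2 C_{p+1} is row p of 2T beta = S beta + S^* beta, so S^* beta
  remains, and its rows vanish from p = n on. Everything is done for the fixed matrix row
  \<open>i\<close>.\<close>

lemma gen_fun_mult_b:
  assumes i: "i < q" and k: "k < q"
    and F: "\<And>l. l < q \<Longrightarrow> (\<lambda>j. (if j = 0 then 1 else 2) * c j $$ (i, l) * z ^ j) sums F l"
  shows "(\<Sum>l<q. F l * fun_b q n C z $$ (l, k)) = fun_a q n C z $$ (i, k)"
proof -
  define f where "f l j = (if j = 0 then 1 else 2) * c j $$ (i, l)" for l j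
  have lt: "b * q + l < n * q" if "b < n" "l < q" for b l
  proof -
    have "b * q + l < (b + 1) * q" using that by simp
    also have "\<dots> \<le> n * q" using that by (intro mult_le_mono1) auto
    finally show ?thesis .
  qed
  have shift: "(\<lambda>j. (if b < j then f l (j - 1 - b) else 0) * z ^ j) sums (z ^ (b + 1) * F l)"
    if "l < q" for b l
  proof -
    have "(\<lambda>j. z ^ (b + 1) * (f l j * z ^ j)) sums (z ^ (b + 1) * F l)"
      using F[OF that] by (intro sums_mult) (simp add: f_def)
    then have "(\<lambda>j. (if b < j + (b + 1) then f l (j + (b + 1) - 1 - b) else 0) * z ^ (j + (b + 1)))
        sums (z ^ (b + 1) * F l)"
      by (simp add: power_add mult_ac)
    then show ?thesis
      by (subst (asm) sums_zero_iff_shift) auto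
  qed
  have "(\<lambda>j. f k j * z ^ j - (\<Sum>b<n. \<Sum>l<q.
      (if b < j then f l (j - 1 - b) else 0) * z ^ j * \<beta> (b * q + l) k))
      sums (F k - (\<Sum>b<n. \<Sum>l<q. z ^ (b + 1) * F l * \<beta> (b * q + l) k))"
    using F[OF k] by (intro sums_diff sums_sum sums_mult2 shift) (auto simp: f_def)
  also have "(F k - (\<Sum>b<n. \<Sum>l<q. z ^ (b + 1) * F l * \<beta> (b * q + l) k))
      = (\<Sum>l<q. F l * fun_b q n C z $$ (l, k))"
  proof -
    have "(\<Sum>l<q. F l * fun_b q n C z $$ (l, k))
        = (\<Sum>l<q. (if l = k then F l else 0) - (\<Sum>b<n. z ^ (b + 1) * F l * \<beta> (b * q + l) k))"
      using k by (intro sum.cong refl) (auto simp: index_fun_b algebra_simps sum_distrib_left)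
    also have "\<dots> = F k - (\<Sum>l<q. \<Sum>b<n. z ^ (b + 1) * F l * \<beta> (b * q + l) k)"
      using k by (simp add: sum_subtractf)
    finally show ?thesis by (subst sum.swap) simp
  qed
  finally have lhs: "(\<lambda>j. f k j * z ^ j - (\<Sum>b<n. \<Sum>l<q.
      (if b < j then f l (j - 1 - b) else 0) * z ^ j * \<beta> (b * q + l) k))
      sums (\<Sum>l<q. F l * fun_b q n C z $$ (l, k))" .
  define A where "A b = (\<Sum>r<n * q. cnj (gam r (b * q + i)) * \<beta> r k)" for b
  \<comment> \<open>The Taylor coefficients of a_n, each with its power of z; a finite sequence
    padded by zeros so that both sides become series.\<close>
  define G where "G j = (if j = 0 then c 0 $$ (i, k) else if j \<le> n then z ^ j * A (j - 1) else 0)" for j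
  have "G sums (\<Sum>j<Suc n. G j)" by (rule sums_finite) (auto simp: G_def)
  moreover have "(\<Sum>j<Suc n. G j) = fun_a q n C z $$ (i, k)"
    unfolding sum.lessThan_Suc_shift index_fun_a[OF i k] A_def[symmetric]
    by (simp add: G_def)
  ultimately have rhs: "G sums (fun_a q n C z $$ (i, k))" by simp
  have "f k j * z ^ j - (\<Sum>b<n. \<Sum>l<q. (if b < j then f l (j - 1 - b) else 0) * z ^ j * \<beta> (b * q + l) k)
      = G j" for j
  proof (cases j)
    case 0
    then show ?thesis by (simp add: f_def G_def)
  next
    case (Suc p)
    \<comment> \<open>The scalar row index of matrix row i inside block row p = j - 1.\<close>
    define R where "R = p * q + i"
    have R: "R div q = p" "R mod q = i" using i by (simp_all add: R_def)
    have g: "(if b < j then f l (j - 1 - b) else 0) = gam R (b * q + l)" if "l < q" for b l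
      using that by (auto simp: gam_def R Suc f_def)
    have "(\<Sum>b<n. \<Sum>l<q. (if b < j then f l (j - 1 - b) else 0) * z ^ j * \<beta> (b * q + l) k)
        = z ^ j * (\<Sum>b<n. \<Sum>l<q. gam R (b * q + l) * \<beta> (b * q + l) k)"
      unfolding sum_distrib_left by (intro sum.cong refl) (simp add: g)
    also have "\<dots> = z ^ j * (\<Sum>s<n * q. gam R s * \<beta> s k)" by (simp only: sum_blocks)
    finally have 1: "(\<Sum>b<n. \<Sum>l<q. (if b < j then f l (j - 1 - b) else 0) * z ^ j * \<beta> (b * q + l) k)
        = z ^ j * (\<Sum>s<n * q. gam R s * \<beta> s k)" .
    have fk: "f k j = 2 * t (R + q) k" using k by (simp add: f_def Suc toep_def R)
    also have "\<dots> = (\<Sum>s<n * q. 2 * t R s * \<beta> s k)"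
      by (simp add: recurrence[OF k, symmetric] sum_distrib_left mult.assoc)
    also have "\<dots> = (\<Sum>s<n * q. gam R s * \<beta> s k) + (\<Sum>s<n * q. cnj (gam s R) * \<beta> s k)"
      by (simp add: gam_add_cnj[symmetric] sum.distrib algebra_simps)
    finally have 2: "f k j = (\<Sum>s<n * q. gam R s * \<beta> s k) + (\<Sum>s<n * q. cnj (gam s R) * \<beta> s k)" .
    have 3: "(\<Sum>s<n * q. cnj (gam s R) * \<beta> s k) = (if j \<le> n then A p else 0)"
    proof (cases "j \<le> n")
      case True
      then show ?thesis by (simp add: A_def R_def)
    next
      case False
      \<comment> \<open>Here R lies in a block row p at least n, strictly beyond every s < n q, so
        the entry is above the diagonal of S.\<close>
      then have "gam s R = 0" if "s < n * q" for s
        using less_mult_imp_div_less[OF that] by (simp add: gam_def R Suc)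
      then show ?thesis using False by simp
    qed
    show ?thesis unfolding 1 2 3 by (simp add: Suc G_def algebra_simps)
  qed
  then have "G sums (\<Sum>l<q. F l * fun_b q n C z $$ (l, k))" using lhs by simp
  then show ?thesis using rhs by (rule sums_unique2)
qed

text \<open>Multiplying F b_n = a_n by the adjugate rather than the inverse keeps the identity valid
  at zeros of det b_n, which may also lie inside the disk.\<close>

lemma gen_fun_mult_det:
  assumes i: "i < q" and k: "k < q"
    and F: "\<And>l. l < q \<Longrightarrow> (\<lambda>j. (if j = 0 then 1 else 2) * c j $$ (i, l) * z ^ j) sums F l"
  shows "F k * det (fun_b q n C z) = (fun_a q n C z * adj_mat (fun_b q n C z)) $$ (i, k)"
proof -
  let ?b = "fun_b q n C z"
  have b: "?b \<in> carrier_mat q q" by (simp add: carrier_matI)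
  note adj = adj_mat[OF b]
  have "(fun_a q n C z * adj_mat ?b) $$ (i, k) = (\<Sum>l<q. fun_a q n C z $$ (i, l) * adj_mat ?b $$ (l, k))"
    using i k adj(1) by (auto simp: scalar_prod_def lessThan_atLeast0 intro!: sum.cong)
  also have "\<dots> = (\<Sum>l<q. \<Sum>m<q. F m * (?b $$ (m, l) * adj_mat ?b $$ (l, k)))"
    by (intro sum.cong refl) (simp add: gen_fun_mult_b[OF i _ F, symmetric] sum_distrib_right mult.assoc)
  also have "\<dots> = (\<Sum>m<q. F m * (\<Sum>l<q. ?b $$ (m, l) * adj_mat ?b $$ (l, k)))"
    by (subst sum.swap) (simp add: sum_distrib_left)
  also have "\<dots> = (\<Sum>m<q. F m * (?b * adj_mat ?b) $$ (m, k))"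
    using k adj(1) by (intro sum.cong refl) (auto simp: scalar_prod_def lessThan_atLeast0 intro!: sum.cong)
  also have "\<dots> = (\<Sum>m<q. if m = k then F m * det ?b else 0)"
    using k unfolding adj(2) by (intro sum.cong refl) auto
  finally show ?thesis using k by simp
qed

end

section \<open>Determinants, adjugates and the quotient of the matrix polynomials\<close>

lemma det_holomorphic:
  assumes "\<And>z. A z \<in> carrier_mat d d"
    "\<And>i j. i < d \<Longrightarrow> j < d \<Longrightarrow> (\<lambda>z. A z $$ (i, j)) holomorphic_on S"
  shows "(\<lambda>z. det (A z)) holomorphic_on S"
proof -
  have "det (A z) = (\<Sum>p\<in>{p. p permutes {0..<d}}. signof p * (\<Prod>i = 0..<d. A z $$ (i, p i)))" for z
    using det_def'[OF assms(1)] .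
  moreover have "(\<lambda>z. \<Sum>p\<in>{p. p permutes {0..<d}}. signof p * (\<Prod>i = 0..<d. A z $$ (i, p i)))
      holomorphic_on S"
    by (intro holomorphic_intros assms(2)) auto
  ultimately show ?thesis by simp
qed

lemma adj_mat_holomorphic:
  assumes A: "\<And>z. A z \<in> carrier_mat d d"
    and h: "\<And>i j. i < d \<Longrightarrow> j < d \<Longrightarrow> (\<lambda>z. A z $$ (i, j)) holomorphic_on S"
    and ij: "i < d" "j < d"
  shows "(\<lambda>z. adj_mat (A z) $$ (i, j)) holomorphic_on S"
proof -
  have dims: "dim_row (A z) = d" "dim_col (A z) = d" for z using A[of z] by auto
  have "(\<lambda>z. det (mat_delete (A z) j i)) holomorphic_on S"
  proof (rule det_holomorphic[of _ "d - 1"])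
    show "mat_delete (A z) j i \<in> carrier_mat (d - 1) (d - 1)" for z
      using mat_delete_carrier[OF A] .
    fix a b assume "a < d - 1" "b < d - 1"
    then show "(\<lambda>z. mat_delete (A z) j i $$ (a, b)) holomorphic_on S"
      using ij by (simp add: mat_delete_def dims h)
  qed
  then have "(\<lambda>z. (- 1) ^ (j + i) * det (mat_delete (A z) j i)) holomorphic_on S"
    by (intro holomorphic_intros)
  then show ?thesis using ij by (simp add: adj_mat_def dims cofactor_def)
qed

context toeplitz_data
begin

lemma fun_b_holomorphic: "i < q \<Longrightarrow> j < q \<Longrightarrow> (\<lambda>z. fun_b q n C z $$ (i, j)) holomorphic_on S"
  unfolding index_fun_b by (intro holomorphic_intros)

lemma fun_a_holomorphic: "i < q \<Longrightarrow> j < q \<Longrightarrow> (\<lambda>z. fun_a q n C z $$ (i, j)) holomorphic_on S"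
  unfolding index_fun_a by (intro holomorphic_intros)

lemma fun_b_carrier: "fun_b q n C z \<in> carrier_mat q q"
  by (simp add: carrier_matI)

lemma det_b_holomorphic: "(\<lambda>z. det (fun_b q n C z)) holomorphic_on S"
  by (rule det_holomorphic[OF fun_b_carrier fun_b_holomorphic])

lemma a_adj_b_holomorphic:
  assumes "i < q" "j < q"
  shows "(\<lambda>z. (fun_a q n C z * adj_mat (fun_b q n C z)) $$ (i, j)) holomorphic_on S"
proof -
  have "(fun_a q n C z * adj_mat (fun_b q n C z)) $$ (i, j)
      = (\<Sum>l<q. fun_a q n C z $$ (i, l) * adj_mat (fun_b q n C z) $$ (l, j))" for z
    using assms adj_mat(1)[OF fun_b_carrier, of z]
    by (auto simp: scalar_prod_def lessThan_atLeast0 intro!: sum.cong)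
  then show ?thesis using assms
    by (auto intro!: holomorphic_intros fun_a_holomorphic adj_mat_holomorphic[OF fun_b_carrier fun_b_holomorphic])
qed

lemma det_b_0: "det (fun_b q n C 0) = 1"
proof -
  have "fun_b q n C 0 = 1\<^sub>m q" by (intro eq_matI) (auto simp: index_fun_b)
  then show ?thesis by simp
qed

text \<open>Where the determinant is nonzero, adjugate over determinant is a two-sided inverse. This
  rules out \<open>None\<close> as the value of \<open>mat_inverse\<close> and identifies the matrix
  under \<open>Some\<close>.\<close>

lemma a_b_inverse:
  assumes "det (fun_b q n C z) \<noteq> 0" "i < q" "j < q"
  shows "(fun_a q n C z * the (mat_inverse (fun_b q n C z))) $$ (i, j)
    = (fun_a q n C z * adj_mat (fun_b q n C z)) $$ (i, j) / det (fun_b q n C z)"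
proof -
  let ?b = "fun_b q n C z" and ?d = "det (fun_b q n C z)"
  define X where "X = (1 / ?d) \<cdot>\<^sub>m adj_mat ?b"
  note adj = adj_mat[OF fun_b_carrier, of z]
  have X: "X \<in> carrier_mat q q" using adj(1) by (simp add: X_def)
  have Xb: "X * ?b = 1\<^sub>m q" "?b * X = 1\<^sub>m q"
    unfolding X_def mult_smult_assoc_mat[OF adj(1) fun_b_carrier]
      mult_smult_distrib[OF fun_b_carrier adj(1)] adj(2,3)
    using assms(1) by (intro eq_matI; simp)+
  have "mat_inverse ?b \<noteq> None"
  proof
    assume "mat_inverse ?b = None"
    from mat_inverse(1)[OF fun_b_carrier this] show False
      using X Xb fun_b_carrier[of z] by (auto simp: Units_def ring_mat_simps)
  qed
  then obtain Y where Y: "mat_inverse ?b = Some Y" by auto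
  have Y': "?b * Y = 1\<^sub>m q" "Y \<in> carrier_mat q q" using mat_inverse(2)[OF fun_b_carrier Y] by auto
  have "Y = X * ?b * Y" using Xb Y' by simp
  also have "\<dots> = X * (?b * Y)" using X Y' fun_b_carrier[of z] by (simp add: assoc_mult_mat[of _ q q _ q _ q])
  finally have "Y = X" using X Y' by simp
  moreover have "fun_a q n C z * X = (1 / ?d) \<cdot>\<^sub>m (fun_a q n C z * adj_mat ?b)"
    unfolding X_def by (rule mult_smult_distrib[of _ q q _ q]) (use adj(1) in \<open>auto intro: carrier_matI\<close>)
  ultimately show ?thesis using Y assms adj(1) by (simp del: index_mult_mat(1))
qed

end

section \<open>Fourier coefficients on the unit circle\<close>

lemma space_circle_borel [simp]: "space circle_borel = sphere 0 1"
  by (simp add: circle_borel_def space_restrict_space)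

lemma sets_circle_borel: "B \<in> sets circle_borel \<longleftrightarrow> B \<in> sets borel \<and> B \<subseteq> sphere 0 1"
  by (auto simp: circle_borel_def sets_restrict_space_iff)

text \<open>A complex measure on the circle, represented as an integrable density against a positive
  one. This covers the entries of mu, densities against arc length, and mu with its atoms
  removed.\<close>

locale circle_density =
  fixes M :: "complex measure" and D :: "complex \<Rightarrow> complex"
  assumes sets_M: "sets M = sets circle_borel" and D: "integrable M D"
begin

lemma space_M: "space M = sphere 0 1"
  using sets_eq_imp_space_eq[OF sets_M] by simp

lemma measurable_continuous:
  assumes "continuous_on (sphere 0 1) (f :: complex \<Rightarrow> complex)"
  shows "f \<in> borel_measurable M"
proof -
  have "f \<in> borel_measurable circle_borel"
    unfolding circle_borel_def by (rule borel_measurable_continuous_on_restrict[OF assms])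
  then show ?thesis using sets_M by (simp cong: measurable_cong_sets)
qed

lemma integrable_bounded:
  fixes f :: "complex \<Rightarrow> complex"
  assumes "f \<in> borel_measurable M" "\<And>\<zeta>. \<zeta> \<in> sphere 0 1 \<Longrightarrow> norm (f \<zeta>) \<le> K"
  shows "integrable M (\<lambda>\<zeta>. f \<zeta> * D \<zeta>)"
proof (rule Bochner_Integration.integrable_bound[of _ "\<lambda>\<zeta>. of_real K * D \<zeta>"])
  show "integrable M (\<lambda>\<zeta>. of_real K * D \<zeta>)" using D by simp
  show "(\<lambda>\<zeta>. f \<zeta> * D \<zeta>) \<in> borel_measurable M" using assms(1) D by measurable
  have "norm (f \<zeta> * D \<zeta>) \<le> norm (of_real K * D \<zeta>)" if "\<zeta> \<in> space M" for \<zeta>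
  proof -
    have "norm (f \<zeta>) \<le> \<bar>K\<bar>" using assms(2)[of \<zeta>] that by (simp add: space_M)
    then show ?thesis by (simp add: norm_mult mult_right_mono)
  qed
  then show "AE \<zeta> in M. norm (f \<zeta> * D \<zeta>) \<le> norm (of_real K * D \<zeta>)" by (intro AE_I2)
qed

lemma integrable_continuous:
  fixes f :: "complex \<Rightarrow> complex"
  assumes "continuous_on (sphere 0 1) f"
  shows "integrable M (\<lambda>\<zeta>. f \<zeta> * D \<zeta>)"
proof -
  have "bounded (f ` sphere 0 1)"
    by (intro compact_imp_bounded compact_continuous_image assms compact_sphere)
  then obtain K where "\<And>\<zeta>. \<zeta> \<in> sphere 0 1 \<Longrightarrow> norm (f \<zeta>) \<le> K"
    unfolding bounded_iff by blast
  then show ?thesis by (intro integrable_bounded measurable_continuous assms)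
qed

lemma integral_bound:
  fixes f g :: "complex \<Rightarrow> complex"
  assumes f: "continuous_on (sphere 0 1) f" and g: "continuous_on (sphere 0 1) g"
    and e: "\<And>\<zeta>. \<zeta> \<in> sphere 0 1 \<Longrightarrow> norm (f \<zeta> - g \<zeta>) \<le> e"
  shows "norm ((LINT \<zeta>|M. f \<zeta> * D \<zeta>) - (LINT \<zeta>|M. g \<zeta> * D \<zeta>)) \<le> e * (LINT \<zeta>|M. norm (D \<zeta>))"
proof -
  have "(LINT \<zeta>|M. f \<zeta> * D \<zeta>) - (LINT \<zeta>|M. g \<zeta> * D \<zeta>) = (LINT \<zeta>|M. f \<zeta> * D \<zeta> - g \<zeta> * D \<zeta>)"
    using integrable_continuous[OF f] integrable_continuous[OF g] by simp
  also have "norm \<dots> \<le> (LINT \<zeta>|M. e * norm (D \<zeta>))"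
  proof (rule Bochner_Integration.integral_norm_bound_integral)
    show "integrable M (\<lambda>\<zeta>. f \<zeta> * D \<zeta> - g \<zeta> * D \<zeta>)"
      using integrable_continuous[OF f] integrable_continuous[OF g] by simp
    show "integrable M (\<lambda>\<zeta>. e * norm (D \<zeta>))" using D by simp
    fix \<zeta> assume "\<zeta> \<in> space M"
    then show "norm (f \<zeta> * D \<zeta> - g \<zeta> * D \<zeta>) \<le> e * norm (D \<zeta>)"
      using e[of \<zeta>] by (simp add: left_diff_distrib[symmetric] norm_mult mult_right_mono space_M)
  qed
  also have "\<dots> = e * (LINT \<zeta>|M. norm (D \<zeta>))" by simp
  finally show ?thesis .
qed

lemma continuous_powi: "continuous_on (sphere 0 1) (\<lambda>\<zeta> :: complex. \<zeta> powi k)"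
  by (intro continuous_intros) auto

lemma integral_indicator:
  assumes "A \<in> sets borel"
  shows "integrable M (\<lambda>\<zeta>. indicator A \<zeta> * D \<zeta>)"
proof (rule integrable_bounded[of _ 1])
  have "A \<inter> sphere 0 1 \<in> sets M" using assms by (auto simp: sets_M sets_circle_borel)
  then have "(indicator (A \<inter> sphere 0 1) :: complex \<Rightarrow> complex) \<in> borel_measurable M" by simp
  then show "(indicator A :: complex \<Rightarrow> complex) \<in> borel_measurable M"
    by (rule measurable_cong[THEN iffD1, rotated]) (auto simp: space_M indicator_def)
qed (auto simp: indicator_def)

end

section \<open>Complex measures with equal Fourier coefficients coincide\<close>

locale circle_density_pair = D1: circle_density M1 D1 + D2: circle_density M2 D2
  for M1 D1 M2 D2 +
  assumes fourier: "(LINT \<zeta>|M1. \<zeta> powi k * D1 \<zeta>) = (LINT \<zeta>|M2. \<zeta> powi k * D2 \<zeta>)"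
begin

text \<open>Quantifying over all shifts makes the class of good functions closed under multiplication by
  \<open>\<zeta>\<close> and \<open>1 / \<zeta>\<close>, hence by real polynomial functions.\<close>

definition good :: "(complex \<Rightarrow> complex) \<Rightarrow> bool" where
  "good h \<longleftrightarrow> continuous_on (sphere 0 1) h \<and>
     (\<forall>k. (LINT \<zeta>|M1. (\<zeta> powi k * h \<zeta>) * D1 \<zeta>) = (LINT \<zeta>|M2. (\<zeta> powi k * h \<zeta>) * D2 \<zeta>))"

lemma good_add:
  assumes "good f" "good g"
  shows "good (\<lambda>\<zeta>. f \<zeta> + g \<zeta>)"
proof -
  have c: "continuous_on (sphere 0 1) (\<lambda>\<zeta>. \<zeta> powi k * f \<zeta>)"
    "continuous_on (sphere 0 1) (\<lambda>\<zeta>. \<zeta> powi k * g \<zeta>)" for k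
    using assms by (auto simp: good_def intro!: continuous_on_mult D1.continuous_powi)
  then show ?thesis using assms
    by (simp add: good_def continuous_on_add distrib_left distrib_right
        D1.integrable_continuous D2.integrable_continuous)
qed

lemma good_cong:
  assumes "good f" "\<And>\<zeta>. \<zeta> \<in> sphere 0 1 \<Longrightarrow> f \<zeta> = g \<zeta>"
  shows "good g"
proof -
  have "(LINT \<zeta>|M1. (\<zeta> powi k * g \<zeta>) * D1 \<zeta>) = (LINT \<zeta>|M1. (\<zeta> powi k * f \<zeta>) * D1 \<zeta>)" for k
    using assms(2) by (intro Bochner_Integration.integral_cong refl) (simp add: D1.space_M)
  moreover have "(LINT \<zeta>|M2. (\<zeta> powi k * g \<zeta>) * D2 \<zeta>) = (LINT \<zeta>|M2. (\<zeta> powi k * f \<zeta>) * D2 \<zeta>)" for k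
    using assms(2) by (intro Bochner_Integration.integral_cong refl) (simp add: D2.space_M)
  moreover have "continuous_on (sphere 0 1) g"
    using assms unfolding good_def by (metis (no_types, lifting) continuous_on_cong)
  ultimately show ?thesis using assms(1) by (simp add: good_def)
qed

lemma good_scale: "good f \<Longrightarrow> good (\<lambda>\<zeta>. a * f \<zeta>)"
  unfolding good_def by (auto intro!: continuous_on_mult_left simp: mult.left_commute[of _ a] mult.assoc)

lemma good_powi:
  assumes "good f"
  shows "good (\<lambda>\<zeta>. \<zeta> powi j * f \<zeta>)"
proof -
  have e: "\<zeta> powi k * (\<zeta> powi j * f \<zeta>) = \<zeta> powi (k + j) * f \<zeta>" if "\<zeta> \<in> sphere 0 1" for k and \<zeta> :: complex
    using that by (subst power_int_add) (auto simp: mult.assoc)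
  have "(LINT \<zeta>|M1. (\<zeta> powi k * (\<zeta> powi j * f \<zeta>)) * D1 \<zeta>) = (LINT \<zeta>|M1. (\<zeta> powi (k + j) * f \<zeta>) * D1 \<zeta>)" for k
    by (intro Bochner_Integration.integral_cong refl) (simp add: D1.space_M e)
  moreover have "(LINT \<zeta>|M2. (\<zeta> powi k * (\<zeta> powi j * f \<zeta>)) * D2 \<zeta>) = (LINT \<zeta>|M2. (\<zeta> powi (k + j) * f \<zeta>) * D2 \<zeta>)" for k
    by (intro Bochner_Integration.integral_cong refl) (simp add: D2.space_M e)
  ultimately show ?thesis using assms
    by (auto simp: good_def intro!: continuous_on_mult D1.continuous_powi)
qed

lemma good_1: "good (\<lambda>_. 1)"
  using fourier by (simp add: good_def)

text \<open>On the circle 1 / zeta is the conjugate of zeta, so the real part is a Laurent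
  polynomial.\<close>

lemma good_Re:
  assumes "good f"
  shows "good (\<lambda>\<zeta>. complex_of_real (Re \<zeta>) * f \<zeta>)"
proof -
  have "good (\<lambda>\<zeta>. 1 / 2 * (\<zeta> powi 1 * f \<zeta>) + 1 / 2 * (\<zeta> powi (- 1) * f \<zeta>))"
    by (intro good_add good_scale good_powi assms)
  then show ?thesis
  proof (rule good_cong)
    fix \<zeta> :: complex assume z: "\<zeta> \<in> sphere 0 1"
    then have "\<zeta> * cnj \<zeta> = 1" by (simp add: complex_norm_square[symmetric])
    then have "inverse \<zeta> = cnj \<zeta>" by (metis inverse_unique)
    then have eq: "complex_of_real (Re \<zeta>) = 1 / 2 * \<zeta> + 1 / 2 * inverse \<zeta>"
      by (simp add: complex_eq_iff)
    show "1 / 2 * (\<zeta> powi 1 * f \<zeta>) + 1 / 2 * (\<zeta> powi (- 1) * f \<zeta>) = complex_of_real (Re \<zeta>) * f \<zeta>"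
      unfolding eq by (simp add: power_int_minus distrib_right left_diff_distrib mult.assoc)
  qed
qed

lemma good_Im:
  assumes "good f"
  shows "good (\<lambda>\<zeta>. complex_of_real (Im \<zeta>) * f \<zeta>)"
proof -
  have "good (\<lambda>\<zeta>. (- \<i> / 2) * (\<zeta> powi 1 * f \<zeta>) + (\<i> / 2) * (\<zeta> powi (- 1) * f \<zeta>))"
    by (intro good_add good_scale good_powi assms)
  then show ?thesis
  proof (rule good_cong)
    fix \<zeta> :: complex assume z: "\<zeta> \<in> sphere 0 1"
    then have "\<zeta> * cnj \<zeta> = 1" by (simp add: complex_norm_square[symmetric])
    then have "inverse \<zeta> = cnj \<zeta>" by (metis inverse_unique)
    then have eq: "complex_of_real (Im \<zeta>) = (- \<i> / 2) * \<zeta> + (\<i> / 2) * inverse \<zeta>"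
      by (simp add: complex_eq_iff)
    show "(- \<i> / 2) * (\<zeta> powi 1 * f \<zeta>) + (\<i> / 2) * (\<zeta> powi (- 1) * f \<zeta>) = complex_of_real (Im \<zeta>) * f \<zeta>"
      unfolding eq by (simp add: power_int_minus distrib_right left_diff_distrib mult.assoc)
  qed
qed

text \<open>The arbitrary good factor \<open>f\<close> makes the product case two successive uses of
  the induction hypothesis.\<close>

lemma good_polynomial:
  assumes "real_polynomial_function g" "good f"
  shows "good (\<lambda>\<zeta>. complex_of_real (g \<zeta>) * f \<zeta>)"
  using assms
proof (induction arbitrary: f)
  case (linear g)
  then interpret bounded_linear g by simp
  \<comment> \<open>A real-linear functional on the plane is a combination of real and imaginary
    part.\<close>
  have g: "g \<zeta> = g 1 * Re \<zeta> + g \<i> * Im \<zeta>" for \<zeta>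
  proof -
    have "g \<zeta> = g (Re \<zeta> *\<^sub>R 1 + Im \<zeta> *\<^sub>R \<i>)"
      by (rule arg_cong[of _ _ g]) (simp add: complex_eq_iff)
    then show ?thesis by (simp only: add scaleR) simp
  qed
  have "good (\<lambda>\<zeta>. g 1 * (complex_of_real (Re \<zeta>) * f \<zeta>) + g \<i> * (complex_of_real (Im \<zeta>) * f \<zeta>))"
    by (intro good_add good_scale good_Re good_Im linear.prems)
  then show ?case
  proof (rule good_cong)
    fix \<zeta> :: complex
    show "g 1 * (complex_of_real (Re \<zeta>) * f \<zeta>) + g \<i> * (complex_of_real (Im \<zeta>) * f \<zeta>)
        = complex_of_real (g \<zeta>) * f \<zeta>"
      unfolding g[of \<zeta>] by (simp add: distrib_right mult.assoc)
  qed
next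
  case (const a)
  then show ?case by (intro good_scale)
next
  case (add g h)
  then show ?case using good_add[of "\<lambda>\<zeta>. g \<zeta> * f \<zeta>" "\<lambda>\<zeta>. h \<zeta> * f \<zeta>"] by (simp add: distrib_right)
next
  case (mult g h)
  then show ?case by (simp add: mult.assoc)
qed

text \<open>Stone-Weierstrass approximates f uniformly by real polynomials in real and imaginary
  part. The error is at most e times the combined total variation \<open>K\<close>.\<close>

lemma integral_continuous_eq:
  fixes f :: "complex \<Rightarrow> real"
  assumes f: "continuous_on (sphere 0 1) f"
  shows "(LINT \<zeta>|M1. complex_of_real (f \<zeta>) * D1 \<zeta>) = (LINT \<zeta>|M2. complex_of_real (f \<zeta>) * D2 \<zeta>)"
    (is "?I1 = ?I2")
proof -
  define K where "K = (LINT \<zeta>|M1. norm (D1 \<zeta>)) + (LINT \<zeta>|M2. norm (D2 \<zeta>))"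
  have K: "0 \<le> K" by (auto simp: K_def intro!: add_nonneg_nonneg)
  have cf: "continuous_on (sphere 0 1) (\<lambda>\<zeta>. complex_of_real (f \<zeta>))"
    using f by (intro continuous_intros)
  have bound: "norm (?I1 - ?I2) \<le> e * K" if e: "e > 0" for e
  proof -
    obtain g where g: "real_polynomial_function g" "\<And>\<zeta>. \<zeta> \<in> sphere 0 1 \<Longrightarrow> \<bar>f \<zeta> - g \<zeta>\<bar> < e"
      using Stone_Weierstrass_real_polynomial_function[OF compact_sphere f e] by blast
    have "good (\<lambda>\<zeta>. complex_of_real (g \<zeta>))" using good_polynomial[OF g(1) good_1] by simp
    then have cg: "continuous_on (sphere 0 1) (\<lambda>\<zeta>. complex_of_real (g \<zeta>))"
      and eq: "(LINT \<zeta>|M1. complex_of_real (g \<zeta>) * D1 \<zeta>) = (LINT \<zeta>|M2. complex_of_real (g \<zeta>) * D2 \<zeta>)"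
      unfolding good_def by (auto dest: spec[of _ 0])
    have le: "norm (complex_of_real (f \<zeta>) - complex_of_real (g \<zeta>)) \<le> e" if "\<zeta> \<in> sphere 0 1" for \<zeta>
      using less_imp_le[OF g(2)[OF that]] by (simp only: of_real_diff[symmetric] norm_of_real)
    have "norm (?I1 - ?I2) \<le> norm (?I1 - (LINT \<zeta>|M1. complex_of_real (g \<zeta>) * D1 \<zeta>))
        + norm (?I2 - (LINT \<zeta>|M2. complex_of_real (g \<zeta>) * D2 \<zeta>))"
      unfolding eq
      using norm_triangle_ineq4[of "?I1 - (LINT \<zeta>|M2. complex_of_real (g \<zeta>) * D2 \<zeta>)"
          "?I2 - (LINT \<zeta>|M2. complex_of_real (g \<zeta>) * D2 \<zeta>)"] by simp
    also have "\<dots> \<le> e * K" unfolding K_def distrib_left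
      by (intro add_mono D1.integral_bound D2.integral_bound cf cg le)
    finally show ?thesis .
  qed
  have "norm (?I1 - ?I2) \<le> 0"
  proof (rule field_le_epsilon)
    fix d :: real assume d: "0 < d"
    have "norm (?I1 - ?I2) \<le> d / (K + 1) * K" using bound[of "d / (K + 1)"] d K by simp
    also have "\<dots> \<le> d" using d K by (simp add: field_simps)
    finally show "norm (?I1 - ?I2) \<le> 0 + d" by simp
  qed
  then show ?thesis by simp
qed

lemma integral_closed_eq:
  assumes S: "closed S"
  shows "(LINT \<zeta>|M1. indicator S \<zeta> * D1 \<zeta>) = (LINT \<zeta>|M2. indicator S \<zeta> * D2 \<zeta>)"
\<comment> \<open>The distance to the empty set is 0 by convention, so the approximating functions
  below would be constantly 1 there.\<close>
proof (cases "S = {}")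
  case False
  \<comment> \<open>Tents equal to 1 on S and supported within distance 1/n of it; they converge
    pointwise to the indicator because S is closed.\<close>
  define f where "f n \<zeta> = max 0 (1 - real n * infdist \<zeta> S)" for n :: nat and \<zeta> :: complex
  have cf: "continuous_on A (f n)" for n A
    unfolding f_def by (intro continuous_intros)
  have lim: "(\<lambda>n. complex_of_real (f n \<zeta>)) \<longlonglongrightarrow> indicator S \<zeta>" for \<zeta>
  proof (cases "\<zeta> \<in> S")
    case True
    then show ?thesis by (simp add: f_def)
  next
    case out: False
    then have "infdist \<zeta> S \<noteq> 0" using in_closed_iff_infdist_zero[OF S False] by simp
    then have pos: "0 < infdist \<zeta> S" using infdist_nonneg[of \<zeta> S] by simp
    obtain N where N: "1 < real N * infdist \<zeta> S" using reals_Archimedean3[OF pos] by blast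
    have "f n \<zeta> = 0" if "n \<ge> N" for n
    proof -
      have "real N * infdist \<zeta> S \<le> real n * infdist \<zeta> S" using that pos by simp
      then show ?thesis using N by (simp add: f_def)
    qed
    then have "\<forall>\<^sub>F n in sequentially. complex_of_real (f n \<zeta>) = indicator S \<zeta>"
      using out by (intro eventually_sequentiallyI[of N]) simp
    then show ?thesis by (rule tendsto_eventually)
  qed
  have bd: "norm (complex_of_real (f n \<zeta>)) \<le> 1" for n \<zeta>
    by (simp add: f_def infdist_nonneg)
  have tend: "(\<lambda>n. LINT \<zeta>|M. complex_of_real (f n \<zeta>) * D \<zeta>) \<longlonglongrightarrow> (LINT \<zeta>|M. indicator S \<zeta> * D \<zeta>)"
    if "circle_density M D" for M D
  proof -
    interpret circle_density M D by fact
    show ?thesis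
    proof (rule integral_dominated_convergence[where w = "\<lambda>\<zeta>. norm (D \<zeta>)"])
      show "(\<lambda>\<zeta>. indicator S \<zeta> * D \<zeta>) \<in> borel_measurable M"
        using integral_indicator[of S] S by (simp add: borel_closed)
      show "(\<lambda>\<zeta>. complex_of_real (f n \<zeta>) * D \<zeta>) \<in> borel_measurable M" for n
        using integrable_continuous[of "\<lambda>\<zeta>. complex_of_real (f n \<zeta>)"] cf
        by (auto intro!: continuous_intros)
      show "integrable M (\<lambda>\<zeta>. norm (D \<zeta>))" using D by simp
      show "AE \<zeta> in M. (\<lambda>n. complex_of_real (f n \<zeta>) * D \<zeta>) \<longlonglongrightarrow> indicator S \<zeta> * D \<zeta>"
        by (intro AE_I2 tendsto_mult lim tendsto_const)
      show "AE \<zeta> in M. norm (complex_of_real (f n \<zeta>) * D \<zeta>) \<le> norm (D \<zeta>)" for n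
        using bd[of n] by (intro AE_I2) (simp add: norm_mult mult_left_le_one_le)
    qed
  qed
  have "(LINT \<zeta>|M1. complex_of_real (f n \<zeta>) * D1 \<zeta>) = (LINT \<zeta>|M2. complex_of_real (f n \<zeta>) * D2 \<zeta>)" for n
    by (rule integral_continuous_eq) (rule cf)
  then show ?thesis
    using tend[OF D1.circle_density_axioms] tend[OF D2.circle_density_axioms]
    by (simp add: LIMSEQ_unique)
qed simp

text \<open>Closed sets are stable under intersection and generate the Borel sets, so a Dynkin
  system argument extends the equality. The induction runs over Borel sets of the plane, with sets
  meeting the circle only through their trace.\<close>

lemma integral_borel_eq:
  assumes "A \<in> sets borel"
  shows "(LINT \<zeta>|M1. indicator A \<zeta> * D1 \<zeta>) = (LINT \<zeta>|M2. indicator A \<zeta> * D2 \<zeta>)"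
proof -
  have eq: "sets (borel :: complex measure) = sigma_sets UNIV (Collect closed)"
    by (simp add: borel_eq_closed)
  have un: "(LINT \<zeta>|M. indicator (\<Union>i. A i) \<zeta> * D \<zeta>) = (\<Sum>i. LINT \<zeta>|M. indicator (A i) \<zeta> * D \<zeta>)"
    if M: "circle_density M D" and A: "disjoint_family A" "\<And>i :: nat. A i \<in> sets borel" for M D A
  proof -
    interpret circle_density M D by fact
    let ?A = "\<lambda>i. A i \<inter> sphere 0 1"
    have ind: "(LINT \<zeta>:B \<inter> sphere 0 1|M. D \<zeta>) = (LINT \<zeta>|M. indicator B \<zeta> * D \<zeta>)" for B
      unfolding set_lebesgue_integral_def
      by (intro Bochner_Integration.integral_cong refl) (auto simp: space_M indicator_def)
    have sets: "?A i \<in> sets M" for i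
      using A(2)[of i] by (auto simp: sets_M sets_circle_borel)
    have "(LINT \<zeta>:(\<Union>i. ?A i)|M. D \<zeta>) = (\<Sum>i. LINT \<zeta>:?A i|M. D \<zeta>)"
    proof (rule lebesgue_integral_countable_add)
      have "(\<Union>i. ?A i) \<in> sets M" using sets by blast
      then show "set_integrable M (\<Union>i. ?A i) D" unfolding set_integrable_def
        by (intro integrable_mult_indicator D)
      show "?A i \<inter> ?A j = {}" if "i \<noteq> j" for i j
        using A(1) that by (auto simp: disjoint_family_on_def)
    qed (rule sets)
    moreover have "(\<Union>i. ?A i) = (\<Union>i. A i) \<inter> sphere 0 1" by auto
    ultimately show ?thesis by (simp only: ind)
  qed
  have stable: "Int_stable (Collect closed :: complex set set)" by (auto simp: Int_stable_def)
  have pow: "Collect closed \<subseteq> Pow (UNIV :: complex set)" by simp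
  from stable pow assms[unfolded eq] show ?thesis
  proof (induction rule: sigma_sets_induct_disjoint)
    case (compl A)
    then have A: "A \<in> sets borel" by (simp add: eq)
    have *: "(LINT \<zeta>|M. indicator (UNIV - A) \<zeta> * D \<zeta>) = (LINT \<zeta>|M. D \<zeta>) - (LINT \<zeta>|M. indicator A \<zeta> * D \<zeta>)"
      if "circle_density M D" for M D
    proof -
      interpret circle_density M D by fact
      have "(LINT \<zeta>|M. indicator (UNIV - A) \<zeta> * D \<zeta>) = (LINT \<zeta>|M. D \<zeta> - indicator A \<zeta> * D \<zeta>)"
        by (intro Bochner_Integration.integral_cong refl) (auto simp: indicator_def)
      also have "\<dots> = (LINT \<zeta>|M. D \<zeta>) - (LINT \<zeta>|M. indicator A \<zeta> * D \<zeta>)"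
        using D integral_indicator[OF A] by (rule Bochner_Integration.integral_diff)
      finally show ?thesis .
    qed
    \<comment> \<open>The total masses agree: this is the Fourier coefficient of index 0.\<close>
    have "(LINT \<zeta>|M1. D1 \<zeta>) = (LINT \<zeta>|M2. D2 \<zeta>)" using fourier[of 0] by simp
    then show ?case
      using *[OF D1.circle_density_axioms] *[OF D2.circle_density_axioms] compl by simp
  next
    case (union A)
    then have "A i \<in> sets borel" for i by (auto simp: eq)
    then show ?case
      using un[OF D1.circle_density_axioms union(1)] un[OF D2.circle_density_axioms union(1)] union(3)
      by simp
  qed (auto simp: integral_closed_eq)
qed

end

section \<open>Poles on the unit circle\<close>

text \<open>In the Leibniz formula every derivative of (w - v)^k of order other than k vanishes at
  v.\<close>

lemma higher_deriv_factor:
  assumes g: "g holomorphic_on ball v r" and r: "0 < r"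
    and f: "\<And>w. w \<in> ball v r \<Longrightarrow> f w = (w - v) ^ k * g w"
  shows "(deriv ^^ k) f v = fact k * g v"
proof -
  have "eventually (\<lambda>w. w \<in> ball v r) (nhds v)"
    using r by (intro eventually_nhds_in_open) auto
  then have "eventually (\<lambda>w. f w = (w - v) ^ k * g w) (nhds v)"
    by (rule eventually_mono) (rule f)
  then have "(deriv ^^ k) f v = (deriv ^^ k) (\<lambda>w. (w - v) ^ k * g w) v"
    by (intro higher_deriv_cong_ev) auto
  also have "\<dots> = (\<Sum>j=0..k. of_nat (k choose j) *
      (deriv ^^ j) (\<lambda>w. (w - v) ^ k) v * (deriv ^^ (k - j)) g v)"
    using g r by (intro higher_deriv_mult[of _ "ball v r"]) (auto intro!: holomorphic_intros)
  also have "\<dots> = (\<Sum>j=0..k. if j = k then fact k * g v else 0)"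
  proof (intro sum.cong refl)
    fix j assume j: "j \<in> {0..k}"
    have "(deriv ^^ j) (\<lambda>w. (w - v) ^ k) v = pochhammer (of_nat (Suc k - j)) j * 0 ^ (k - j)"
      by (subst higher_deriv_power) auto
    also have "\<dots> = (if j = k then fact k else 0)"
      using j by (auto simp: pochhammer_fact)
    finally show "of_nat (k choose j) * (deriv ^^ j) (\<lambda>w. (w - v) ^ k) v * (deriv ^^ (k - j)) g v
        = (if j = k then fact k * g v else 0)" by simp
  qed
  finally show ?thesis by simp
qed

lemma radius_point:
  fixes v :: complex
  assumes "norm v = 1" "0 \<le> x" "x < 1"
  shows "of_real x * v \<in> ball 0 1" "norm (of_real x * v - v) = 1 - x" "of_real x * v \<noteq> v"
proof -
  have "of_real x * v - v = of_real (x - 1) * v" by (simp add: algebra_simps)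
  then have "norm (of_real x * v - v) = norm (of_real (x - 1) * v)" by (simp only:)
  then show d: "norm (of_real x * v - v) = 1 - x" using assms by (simp add: norm_mult del: of_real_diff)
  show "of_real x * v \<in> ball 0 1" using assms by (simp add: norm_mult)
  show "of_real x * v \<noteq> v" using d assms by auto
qed

text \<open>Along the radius to v the bound says that h is O((1 - x)^{m-1}). For a holomorphic
  function with an exact order p at v this already forces p to be at least m - 1, so one radial
  estimate controls the full two-dimensional vanishing.\<close>

lemma boundary_zero_order:
  assumes h: "h holomorphic_on UNIV" and v: "norm v = 1" and r: "0 < r"
    and g: "g holomorphic_on ball v r"
    and bound: "\<And>x. 0 \<le> x \<Longrightarrow> x < 1 \<Longrightarrow> of_real x * v \<in> ball v r \<Longrightarrow>
      norm (h (of_real x * v)) * (1 - x) \<le> (1 - x) ^ m * norm (g (of_real x * v)) * K"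
    and m: "0 < m"
  obtains h1 s where "0 < s" "s \<le> r" "h1 holomorphic_on ball v s"
    "\<And>w. w \<in> ball v s \<Longrightarrow> h w = (w - v) ^ (m - 1) * h1 w"
proof (cases "\<forall>w. h w = 0")
  case True
  then show ?thesis using r by (intro that[of r "\<lambda>_. 0"]) auto
next
  case False
  obtain g1 s p where s: "0 < s" and g1: "g1 holomorphic_on ball v s"
    and hp: "\<And>w. w \<in> ball v s \<Longrightarrow> h w = (w - v) ^ p * g1 w" and g1v: "g1 v \<noteq> 0"
  proof (cases "h v = 0")
    case True
    have nc: "\<not> h constant_on UNIV" 
    proof
      assume "h constant_on UNIV"
      then obtain y where "\<And>x. h x = y" by (auto simp: constant_on_def)
      then show False using True \<open>\<not> (\<forall>w. h w = 0)\<close> by simp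
    qed
    obtain g1 s p where "0 < p" "0 < s" "ball v s \<subseteq> UNIV" "g1 holomorphic_on ball v s"
      "\<And>w. w \<in> ball v s \<Longrightarrow> h w = (w - v) ^ p * g1 w" "\<And>w. w \<in> ball v s \<Longrightarrow> g1 w \<noteq> 0"
      by (rule holomorphic_factor_zero_nonconstant[OF h open_UNIV connected_UNIV UNIV_I True nc]) (rule that)
    then show ?thesis using that[of s g1 p] by simp
  next
    case False
    then show ?thesis using that[of 1 h 0] h holomorphic_on_subset by auto
  qed
  have pm: "m - 1 \<le> p"
  proof (rule ccontr)
    assume "\<not> m - 1 \<le> p"
    \<comment> \<open>If p < m - 1 then m = (p + 1) + (k + 1). Dividing the bound by (1 - x)^{p+1}
      leaves a positive power of 1 - x on the right, so g1(v) would be 0.\<close>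
    define k where "k = m - Suc (Suc p)"
    have k: "m = Suc (Suc p + k)" using \<open>\<not> m - 1 \<le> p\<close> by (simp add: k_def)
    define x where "x j = 1 - inverse (real (Suc j))" for j
    have x: "0 \<le> x j" "x j < 1" for j by (auto simp: x_def divide_simps)
    have xlim: "x \<longlonglongrightarrow> 1" unfolding x_def
      using tendsto_diff[OF tendsto_const LIMSEQ_inverse_real_of_nat, of 1] by simp
    define z where "z j = of_real (x j) * v" for j
    have zlim: "z \<longlonglongrightarrow> v" unfolding z_def
      using tendsto_mult[OF tendsto_of_real[OF xlim] tendsto_const, of v] by simp
    have ev: "\<forall>\<^sub>F j in sequentially. z j \<in> ball v (min r s)"
      using zlim r s by (intro topological_tendstoD) auto
    have "isCont g1 v" "isCont g v"
      using g1 g r s by (metis centre_in_ball continuous_on_eq_continuous_at holomorphic_on_imp_continuous_on open_ball)+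
    then have lim: "(\<lambda>j. norm (g1 (z j))) \<longlonglongrightarrow> norm (g1 v)" "(\<lambda>j. norm (g (z j))) \<longlonglongrightarrow> norm (g v)"
      using zlim by (auto intro!: tendsto_norm intro: isCont_tendsto_compose)
    have "(\<lambda>j. (1 - x j) ^ Suc k * norm (g (z j)) * K) \<longlonglongrightarrow> (1 - 1) ^ Suc k * norm (g v) * K"
      by (intro tendsto_intros xlim lim)
    moreover have "\<forall>\<^sub>F j in sequentially. norm (g1 (z j)) \<le> (1 - x j) ^ Suc k * norm (g (z j)) * K"
      using ev
    proof eventually_elim
      case (elim j)
      let ?d = "1 - x j"
      have d: "0 < ?d" using x(2)[of j] by simp
      have "norm (h (z j)) = ?d ^ p * norm (g1 (z j))"
        using elim hp[of "z j"] radius_point(2)[OF v x, of j] by (simp add: norm_mult norm_power z_def)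
      then have "(?d ^ p * norm (g1 (z j))) * ?d \<le> ?d ^ m * norm (g (z j)) * K"
        using bound[OF x, of j] elim by (simp add: z_def)
      then have "?d ^ Suc p * norm (g1 (z j)) \<le> ?d ^ Suc p * (?d ^ Suc k * norm (g (z j)) * K)"
        by (simp add: k power_add mult_ac)
      then show ?case using d by (subst (asm) mult_le_cancel_left_pos) auto
    qed
    ultimately have "norm (g1 v) \<le> (1 - 1) ^ Suc k * norm (g v) * K"
      using lim(1) by (intro tendsto_le[OF sequentially_bot]) auto
    then show False using g1v by simp
  qed
  show ?thesis
  proof (rule that)
    show "(\<lambda>w. (w - v) ^ (p - (m - 1)) * g1 w) holomorphic_on ball v (min r s)"
      by (intro holomorphic_intros holomorphic_on_subset[OF g1]) auto
    fix w assume "w \<in> ball v (min r s)"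
    then show "h w = (w - v) ^ (m - 1) * ((w - v) ^ (p - (m - 1)) * g1 w)"
      using hp[of w] pm by (simp add: mult.assoc[symmetric] power_add[symmetric])
  qed (use r s in auto)
qed

text \<open>Write d = (w - v)^k d1 and h = (w - v)^{k-1} h1. The quotient has residue h1(v) / d1(v),
  while (v + w) / (v - w) has residue -2v, so the right coefficient is -h1(v) / (2 v d1(v)). The
  derivatives in \<open>X\<close> are k! d1(v) and (k - 1)! h1(v); the factor m repairs the ratio of
  the factorials.\<close>

lemma simple_pole_on_circle:
  fixes h d H :: "complex \<Rightarrow> complex"
  assumes h: "h holomorphic_on UNIV" and d: "d holomorphic_on UNIV"
    and v: "norm v = 1" and dv: "d v = 0" and d0: "d 0 \<noteq> 0"
    and H: "\<And>z. z \<in> ball 0 1 \<Longrightarrow> H z * d z = h z"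
    and bound: "\<And>z. z \<in> ball 0 1 \<Longrightarrow> norm (H z) * (1 - norm z) \<le> K"
  defines "m \<equiv> nat (zorder d v)"
  defines "X \<equiv> (- of_nat m / (2 * v * (deriv ^^ m) d v)) * (deriv ^^ (m - 1)) h v"
  obtains s g where "0 < s" "g holomorphic_on ball v s"
    "\<And>w. w \<in> ball v s \<Longrightarrow> w \<noteq> v \<Longrightarrow> d w \<noteq> 0 \<and> h w / d w = g w + (v + w) / (v - w) * X"
proof -
  have v0: "v \<noteq> 0" using v by auto
  have nc: "\<not> d constant_on UNIV" 
  proof
    assume "d constant_on UNIV"
    then obtain y where "\<And>x. d x = y" by (auto simp: constant_on_def)
    then show False using dv d0 by simp
  qed
  obtain d1 r k where k: "0 < k" and r: "0 < r" and "ball v r \<subseteq> UNIV" and d1: "d1 holomorphic_on ball v r"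
      and dk: "\<And>w. w \<in> ball v r \<Longrightarrow> d w = (w - v) ^ k * d1 w"
      and d1n: "\<And>w. w \<in> ball v r \<Longrightarrow> d1 w \<noteq> 0"
    by (rule holomorphic_factor_zero_nonconstant[OF d open_UNIV connected_UNIV UNIV_I dv nc]) (rule that)
  have "zorder d v = int k"
    using r d1 d1n dk by (intro zorder_eqI[of "ball v r" v d1]) (auto simp: mult.commute)
  then have mk: "m = k" by (simp add: m_def)
  obtain h1 s where s: "0 < s" "s \<le> r" and h1: "h1 holomorphic_on ball v s"
      and hm: "\<And>w. w \<in> ball v s \<Longrightarrow> h w = (w - v) ^ (k - 1) * h1 w"
  proof (rule boundary_zero_order[OF h v r d1 _ k, of K])
    fix x :: real assume x: "0 \<le> x" "x < 1" and z: "of_real x * v \<in> ball v r"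
    let ?z = "of_real x * v"
    have "norm (h ?z) = norm (H ?z) * norm (d ?z)"
      using H[OF radius_point(1)[OF v x]] by (metis norm_mult)
    also have "norm (d ?z) = (1 - x) ^ k * norm (d1 ?z)"
      using dk[OF z] radius_point(2)[OF v x] by (simp add: norm_mult norm_power)
    finally have "norm (h ?z) * (1 - x) = (norm (H ?z) * (1 - norm ?z)) * ((1 - x) ^ k * norm (d1 ?z))"
      using v x by (simp add: norm_mult)
    also have "\<dots> \<le> K * ((1 - x) ^ k * norm (d1 ?z))"
      using bound[OF radius_point(1)[OF v x]] x by (intro mult_right_mono) auto
    finally show "norm (h ?z) * (1 - x) \<le> (1 - x) ^ k * norm (d1 ?z) * K" by (simp add: mult_ac)
  qed auto
  have d1s: "d1 holomorphic_on ball v s" using d1 s by (auto intro: holomorphic_on_subset)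
  have "(deriv ^^ k) d v = fact k * d1 v"
    using d1s s dk by (intro higher_deriv_factor[of _ v s]) auto
  moreover have "(deriv ^^ (k - 1)) h v = fact (k - 1) * h1 v"
    using h1 s hm by (intro higher_deriv_factor[of _ v s]) auto
  moreover have "(fact k :: complex) = of_nat k * fact (k - 1)" using k by (simp add: fact_reduce)
  ultimately have X: "X = - h1 v / (2 * v * d1 v)"
    using k v0 d1n[of v] r by (simp add: X_def mk field_simps)
  \<comment> \<open>(w - v) times the quotient with the kernel term removed. \<open>X\<close> is
    chosen so that u vanishes at v, and then its difference quotient \<open>g\<close> is
    holomorphic.\<close>
  define u where "u w = h1 w / d1 w + (v + w) * X" for w
  have u: "u holomorphic_on ball v s"
    unfolding u_def using s d1n by (intro holomorphic_intros h1 d1s) auto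
  have uv: "u v = 0"
    using X v0 d1n[of v] r by (simp add: u_def field_simps)
  define g where "g w = (if w = v then deriv u v else (u w - u v) / (w - v))" for w
  show ?thesis
  proof (rule that)
    show "0 < s" by (rule s)
    show "g holomorphic_on ball v s"
      unfolding g_def by (rule pole_lemma_open[OF u open_ball])
    fix w assume w: "w \<in> ball v s" "w \<noteq> v"
    have wr: "w \<in> ball v r" using w s by auto
    have pk: "(w - v) ^ k = (w - v) ^ (k - 1) * (w - v)" using k by (metis power_minus_mult)
    have "h w / d w = h1 w / ((w - v) * d1 w)"
      using w k by (simp add: hm[OF w(1)] dk[OF wr] pk)
    also have "\<dots> = g w + (v + w) / (v - w) * X"
      using w d1n[OF wr] uv by (simp add: g_def u_def divide_simps) (simp add: algebra_simps)
    finally show "d w \<noteq> 0 \<and> h w / d w = g w + (v + w) / (v - w) * X"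
      using w d1n[OF wr] by (simp add: dk[OF wr])
  qed
qed

section \<open>Herglotz transforms\<close>

context circle_density
begin

definition herglotz :: "complex \<Rightarrow> complex" where
  "herglotz z = (LINT \<zeta>|M. (\<zeta> + z) / (\<zeta> - z) * D \<zeta>)"

definition fourier_coeff :: "nat \<Rightarrow> complex" where
  "fourier_coeff j = (LINT \<zeta>|M. \<zeta> powi (- int j) * D \<zeta>)"

lemma continuous_herglotz_kernel:
  "norm z < 1 \<Longrightarrow> continuous_on (sphere 0 1) (\<lambda>\<zeta> :: complex. (\<zeta> + z) / (\<zeta> - z))"
  by (rule continuous_on_divide) (auto intro!: continuous_intros)

lemma herglotz_kernel_sums:
  fixes z \<zeta> :: complex
  assumes z: "norm z < 1" and \<zeta>: "norm \<zeta> = 1"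
  shows "(\<lambda>j. (if j = 0 then 1 else 2) * z ^ j * \<zeta> powi (- int j)) sums ((\<zeta> + z) / (\<zeta> - z))"
proof -
  have \<zeta>0: "\<zeta> \<noteq> 0" and ne: "\<zeta> \<noteq> z" using z \<zeta> by auto
  have "(\<lambda>j. 2 * (z / \<zeta>) ^ j - (if j = 0 then 1 else 0)) sums (2 * (1 / (1 - z / \<zeta>)) - 1)"
    using z \<zeta> by (intro sums_diff sums_mult geometric_sums sums_single) (simp_all add: norm_divide)
  moreover have "2 * (1 / (1 - z / \<zeta>)) - 1 = (\<zeta> + z) / (\<zeta> - z)"
    using \<zeta>0 ne by (simp add: field_simps)
  moreover have "2 * (z / \<zeta>) ^ j - (if j = 0 then 1 else 0)
      = (if j = 0 then 1 else 2) * z ^ j * \<zeta> powi (- int j)" for j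
    by (simp add: power_int_minus power_mult_distrib power_inverse divide_inverse)
  ultimately show ?thesis by simp
qed

text \<open>Sum and integral may be exchanged because of the geometric majorant 2 |D| |z|^j.\<close>

lemma herglotz_sums:
  assumes z: "norm z < 1"
  shows "(\<lambda>j. (if j = 0 then 1 else 2) * fourier_coeff j * z ^ j) sums herglotz z"
proof -
  define f where "f j \<zeta> = ((if j = 0 then 1 else 2) * z ^ j * \<zeta> powi (- int j)) * D \<zeta>" for j \<zeta>
  have int: "integrable M (f j)" for j
    unfolding f_def by (intro integrable_continuous continuous_on_mult continuous_on_const continuous_powi)
  have norm_f: "norm (f j \<zeta>) \<le> 2 * norm (D \<zeta>) * norm z ^ j" if "\<zeta> \<in> space M" for j \<zeta>
  proof -
    have "norm \<zeta> = 1" using that by (simp add: space_M)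
    then have "norm (f j \<zeta>) = (if j = 0 then 1 else 2) * (norm (D \<zeta>) * norm z ^ j)"
      by (simp add: f_def norm_mult norm_power norm_power_int)
    also have "\<dots> \<le> 2 * (norm (D \<zeta>) * norm z ^ j)" by (intro mult_right_mono) auto
    finally show ?thesis by simp
  qed
  have sum_z: "summable (\<lambda>j. a * norm z ^ j)" for a :: real
    using z by (intro summable_mult summable_geometric) auto
  have "(\<lambda>j. integral\<^sup>L M (f j)) sums (LINT \<zeta>|M. (\<Sum>j. f j \<zeta>))"
  proof (rule sums_integral)
    show "AE \<zeta> in M. summable (\<lambda>j. norm (f j \<zeta>))"
      using norm_f by (intro AE_I2 summable_comparison_test'[OF sum_z]) auto
    show "summable (\<lambda>j. LINT \<zeta>|M. norm (f j \<zeta>))"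
    proof (rule summable_comparison_test'[OF sum_z])
      fix j
      have "norm (LINT \<zeta>|M. norm (f j \<zeta>)) \<le> (LINT \<zeta>|M. 2 * norm (D \<zeta>) * norm z ^ j)"
        using int D norm_f by (intro Bochner_Integration.integral_norm_bound_integral) auto
      then show "norm (LINT \<zeta>|M. norm (f j \<zeta>)) \<le> (2 * (LINT \<zeta>|M. norm (D \<zeta>))) * norm z ^ j"
        by simp
    qed
  qed (rule int)
  also have "(LINT \<zeta>|M. (\<Sum>j. f j \<zeta>)) = herglotz z"
    unfolding herglotz_def
  proof (intro Bochner_Integration.integral_cong refl)
    fix \<zeta> assume "\<zeta> \<in> space M"
    then have "norm \<zeta> = 1" by (simp add: space_M)
    then show "(\<Sum>j. f j \<zeta>) = (\<zeta> + z) / (\<zeta> - z) * D \<zeta>"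
      unfolding f_def by (intro sums_unique[symmetric] sums_mult2 herglotz_kernel_sums z)
  qed
  also have "(\<lambda>j. integral\<^sup>L M (f j)) = (\<lambda>j. (if j = 0 then 1 else 2) * fourier_coeff j * z ^ j)"
  proof
    fix j
    have "integral\<^sup>L M (f j) = (LINT \<zeta>|M. ((if j = 0 then 1 else 2) * z ^ j) * (\<zeta> powi (- int j) * D \<zeta>))"
      unfolding f_def by (simp only: mult.assoc)
    also have "\<dots> = ((if j = 0 then 1 else 2) * z ^ j) * fourier_coeff j"
      unfolding fourier_coeff_def by (rule integral_mult_right_zero)
    finally show "integral\<^sup>L M (f j) = (if j = 0 then 1 else 2) * fourier_coeff j * z ^ j"
      by (simp add: mult_ac)
  qed
  finally show ?thesis .
qed

text \<open>On the circle |zeta + z| is at most 2 and |zeta - z| at least 1 - |z|. This growth rate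
  is what limits poles on the circle to order one.\<close>

lemma herglotz_bound:
  assumes z: "norm z < 1"
  shows "norm (herglotz z) * (1 - norm z) \<le> 2 * (LINT \<zeta>|M. norm (D \<zeta>))"
proof -
  have "norm (LINT \<zeta>|M. (\<zeta> + z) / (\<zeta> - z) * D \<zeta>) \<le> (LINT \<zeta>|M. 2 / (1 - norm z) * norm (D \<zeta>))"
  proof (rule Bochner_Integration.integral_norm_bound_integral)
    fix \<zeta> assume "\<zeta> \<in> space M"
    then have \<zeta>: "norm \<zeta> = 1" by (simp add: space_M)
    have "norm (\<zeta> + z) \<le> 2" using norm_triangle_ineq[of \<zeta> z] \<zeta> z by simp
    moreover have "1 - norm z \<le> norm (\<zeta> - z)" using norm_triangle_ineq2[of \<zeta> z] \<zeta> by simp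
    ultimately have "norm ((\<zeta> + z) / (\<zeta> - z)) \<le> 2 / (1 - norm z)"
      unfolding norm_divide using z by (intro frac_le) auto
    then show "norm ((\<zeta> + z) / (\<zeta> - z) * D \<zeta>) \<le> 2 / (1 - norm z) * norm (D \<zeta>)"
      unfolding norm_mult by (intro mult_right_mono) auto
  next
    show "integrable M (\<lambda>\<zeta>. (\<zeta> + z) / (\<zeta> - z) * D \<zeta>)"
      by (intro integrable_continuous continuous_herglotz_kernel z)
    show "integrable M (\<lambda>\<zeta>. 2 / (1 - norm z) * norm (D \<zeta>))" using D by simp
  qed
  then have "norm (herglotz z) \<le> 2 / (1 - norm z) * (LINT \<zeta>|M. norm (D \<zeta>))"
    by (simp add: herglotz_def)
  then show ?thesis using z by (simp add: field_simps)
qed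

text \<open>Scaled by (1 - x) / 2 the kernel is bounded by 1. At zeta = v it equals (1 + x) / 2,
  which tends to 1; elsewhere it tends to 0. Dominated convergence thus isolates the atom at
  v.\<close>

lemma herglotz_radial_limit:
  assumes v: "norm v = 1" and x: "x \<longlonglongrightarrow> 1" "\<And>n. 0 \<le> x n" "\<And>n. x n < 1"
  shows "(\<lambda>n. of_real ((1 - x n) / 2) * herglotz (of_real (x n) * v))
    \<longlonglongrightarrow> (LINT \<zeta>|M. indicator {v} \<zeta> * D \<zeta>)"
proof -
  define z where "z n = of_real (x n) * v" for n
  have z1: "norm (z n) < 1" for n using v x(2,3)[of n] by (simp add: z_def norm_mult)
  have nz: "1 - norm (z n) = 1 - x n" for n using v x(2)[of n] by (simp add: z_def norm_mult)
  have zlim: "z \<longlonglongrightarrow> v" unfolding z_def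
    using tendsto_mult[OF tendsto_of_real[OF x(1)] tendsto_const, of v] by simp
  have xlim: "(\<lambda>n. complex_of_real ((1 - x n) / 2)) \<longlonglongrightarrow> of_real ((1 - 1) / 2)"
    by (intro tendsto_intros x(1)) auto
  define f where "f n \<zeta> = of_real ((1 - x n) / 2) * ((\<zeta> + z n) / (\<zeta> - z n))" for n \<zeta>
  have eq: "of_real ((1 - x n) / 2) * herglotz (z n) = (LINT \<zeta>|M. f n \<zeta> * D \<zeta>)" for n
    unfolding herglotz_def f_def mult.assoc by (rule integral_mult_right_zero[symmetric])
  have "(\<lambda>n. LINT \<zeta>|M. f n \<zeta> * D \<zeta>) \<longlonglongrightarrow> (LINT \<zeta>|M. indicator {v} \<zeta> * D \<zeta>)"
  proof (rule integral_dominated_convergence[where w = "\<lambda>\<zeta>. norm (D \<zeta>)"])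
    show "(\<lambda>\<zeta>. indicator {v} \<zeta> * D \<zeta>) \<in> borel_measurable M"
      using integral_indicator[of "{v}"] by simp
    show "(\<lambda>\<zeta>. f n \<zeta> * D \<zeta>) \<in> borel_measurable M" for n
      unfolding f_def using integrable_continuous[OF continuous_on_mult_left[OF continuous_herglotz_kernel[OF z1]]]
      by (rule borel_measurable_integrable)
    show "integrable M (\<lambda>\<zeta>. norm (D \<zeta>))" using D by simp
    show "AE \<zeta> in M. (\<lambda>n. f n \<zeta> * D \<zeta>) \<longlonglongrightarrow> indicator {v} \<zeta> * D \<zeta>"
    proof (intro AE_I2 tendsto_mult tendsto_const)
      fix \<zeta> assume "\<zeta> \<in> space M"
      show "(\<lambda>n. f n \<zeta>) \<longlonglongrightarrow> indicator {v} \<zeta>"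
      proof (cases "\<zeta> = v")
        case True
        have "f n \<zeta> = of_real ((1 + x n) / 2)" for n
        proof -
          have "v + z n = of_real (1 + x n) * v" "v - z n = of_real (1 - x n) * v"
            by (simp_all add: z_def algebra_simps)
          moreover have "v \<noteq> 0" "1 - x n \<noteq> 0" using v x(3)[of n] by auto
          moreover have "complex_of_real (1 - x n) \<noteq> 0" using \<open>1 - x n \<noteq> 0\<close> by (simp only: of_real_eq_0_iff) simp
          ultimately show ?thesis unfolding f_def True
            by (simp only: of_real_divide) (simp add: field_simps del: of_real_diff of_real_add)
        qed
        moreover have "(\<lambda>n. complex_of_real ((1 + x n) / 2)) \<longlonglongrightarrow> of_real ((1 + 1) / 2)"
          by (intro tendsto_intros x(1)) auto
        ultimately show ?thesis using True by (simp del: of_real_divide of_real_add)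
      next
        case False
        then have "(\<lambda>n. f n \<zeta>) \<longlonglongrightarrow> of_real ((1 - 1) / 2) * ((\<zeta> + v) / (\<zeta> - v))"
          unfolding f_def by (intro tendsto_mult xlim tendsto_divide tendsto_add tendsto_diff tendsto_const zlim) auto
        then show ?thesis using False by simp
      qed
    qed
    show "AE \<zeta> in M. norm (f n \<zeta> * D \<zeta>) \<le> norm (D \<zeta>)" for n
    proof (intro AE_I2)
      fix \<zeta> assume "\<zeta> \<in> space M"
      then have \<zeta>: "norm \<zeta> = 1" by (simp add: space_M)
      have "norm (\<zeta> + z n) \<le> 2" using norm_triangle_ineq[of \<zeta> "z n"] \<zeta> z1[of n] by simp
      moreover have "1 - norm (z n) \<le> norm (\<zeta> - z n)" using norm_triangle_ineq2[of \<zeta> "z n"] \<zeta> by simp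
      ultimately have "norm ((\<zeta> + z n) / (\<zeta> - z n)) \<le> 2 / (1 - x n)"
        unfolding norm_divide nz using x(3)[of n] by (intro frac_le) auto
      then have "(1 - x n) / 2 * norm ((\<zeta> + z n) / (\<zeta> - z n)) \<le> (1 - x n) / 2 * (2 / (1 - x n))"
        using x(3)[of n] by (intro mult_left_mono) auto
      also have "\<dots> = 1" using x(3)[of n] by simp
      finally have "norm (f n \<zeta>) \<le> 1" using x(3)[of n]
        unfolding f_def norm_mult norm_of_real by simp
      then show "norm (f n \<zeta> * D \<zeta>) \<le> norm (D \<zeta>)" by (simp add: norm_mult mult_left_le_one_le)
    qed
  qed
  then show ?thesis unfolding eq[symmetric] by (simp add: z_def)
qed

end

section \<open>Arc length and Fourier coefficients of boundary values\<close>

lemma cis_measurable: "cis \<in> measurable (restrict_space lborel {0..<2 * pi}) circle_borel"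
  unfolding circle_borel_def
proof (rule measurable_restrict_space2)
  show "cis \<in> borel_measurable (restrict_space lborel {0..<2 * pi})"
    by (rule measurable_restrict_space1)
      (auto intro!: borel_measurable_continuous_onI continuous_intros)
qed auto

lemma sets_arc_length [simp]: "sets arc_length = sets circle_borel"
  by (simp add: arc_length_def)

lemma space_arc_length [simp]: "space arc_length = sphere 0 1"
  by (simp add: arc_length_def)

lemma finite_arc_length: "finite_measure arc_length"
proof -
  have "finite_measure (restrict_space lborel {0..<2 * pi})"
    by (rule finite_measureI) (simp add: emeasure_restrict_space space_restrict_space)
  then show ?thesis unfolding arc_length_def
    by (rule finite_measure.finite_measure_distr[OF _ cis_measurable])
qed

lemma circle_density_arc_length:
  assumes "continuous_on (sphere 0 1) f"
  shows "circle_density arc_length f"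
proof -
  interpret finite_measure arc_length by (rule finite_arc_length)
  interpret one: circle_density arc_length "\<lambda>_. 1"
    by unfold_locales auto
  show ?thesis using one.integrable_continuous[OF assms] by unfold_locales auto
qed

text \<open>Arc length comes from the half-open interval, so that every point is covered once;
  contour integrals live on the closed one. The two differ by a null set.\<close>

lemma arc_length_integral:
  fixes f :: "complex \<Rightarrow> complex"
  assumes f: "continuous_on (sphere 0 1) f"
  shows "((\<lambda>t. f (cis t)) has_integral (LINT \<zeta>|arc_length. f \<zeta>)) {0..2 * pi}"
proof -
  have cont: "continuous_on {0..2 * pi} (\<lambda>t. f (cis t))"
    by (rule continuous_on_compose2[OF f]) (auto intro!: continuous_intros)
  have fm: "f \<in> borel_measurable circle_borel"
    unfolding circle_borel_def by (rule borel_measurable_continuous_on_restrict[OF f])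
  have abs: "set_integrable lborel {0..2 * pi} (\<lambda>t. f (cis t))"
    by (rule borel_integrable_atLeastAtMost') (rule cont)
  have "(LINT \<zeta>|arc_length. f \<zeta>) = (LINT t|restrict_space lborel {0..<2 * pi}. f (cis t))"
    unfolding arc_length_def by (rule integral_distr[OF cis_measurable fm])
  also have "\<dots> = (LINT t:{0..<2 * pi}|lborel. f (cis t))"
    by (subst integral_restrict_space) (auto simp: set_lebesgue_integral_def)
  also have "\<dots> = (LINT t:{0..2 * pi}|lborel. f (cis t))"
    unfolding set_lebesgue_integral_def
  proof (rule integral_cong_AE)
    have "set_integrable lborel {0..<2 * pi} (\<lambda>t. f (cis t))"
      by (rule set_integrable_subset[OF abs]) auto
    then show "(\<lambda>t. indicator {0..<2 * pi} t *\<^sub>R f (cis t)) \<in> borel_measurable lborel"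
      unfolding set_integrable_def by (rule borel_measurable_integrable)
    show "(\<lambda>t. indicator {0..2 * pi} t *\<^sub>R f (cis t)) \<in> borel_measurable lborel"
      using abs unfolding set_integrable_def by (rule borel_measurable_integrable)
    show "AE t in lborel. indicator {0..<2 * pi} t *\<^sub>R f (cis t) = indicator {0..2 * pi} t *\<^sub>R f (cis t)"
      using AE_lborel_singleton[of "2 * pi"] by eventually_elim (auto simp: indicator_def)
  qed
  also have "\<dots> = integral {0..2 * pi} (\<lambda>t. f (cis t))"
    using set_borel_integral_eq_integral(2)[OF abs] .
  finally have eq: "(LINT \<zeta>|arc_length. f \<zeta>) = integral {0..2 * pi} (\<lambda>t. f (cis t))" .
  show ?thesis unfolding eq
    by (rule integrable_integral) (rule set_borel_integral_eq_integral(1)[OF abs])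
qed

lemma holomorphic_fourier_nonneg:
  fixes f :: "complex \<Rightarrow> complex"
  assumes f: "continuous_on (cball 0 1) f" "f holomorphic_on ball 0 1"
  shows "(LINT \<zeta>|arc_length. \<zeta> powi (- int k) * f \<zeta>) = 2 * pi * ((deriv ^^ k) f 0 / fact k)"
proof -
  \<comment> \<open>Viewing the circle as an arc over 0..2 pi makes the angle the parameter; there d
    zeta = i zeta dt.\<close>
  have 1: "((\<lambda>u. f u / u ^ Suc k) has_contour_integral ((2 * pi * \<i>) / fact k * (deriv ^^ k) f 0))
      (part_circlepath 0 1 0 (2 * pi))"
    using Cauchy_has_contour_integral_higher_derivative_circlepath[OF f, of 0 k]
    by (simp add: circlepath_def)
  have 2: "((\<lambda>t. f (cis t) / cis t ^ Suc k * \<i> * cis t) has_integral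
      ((2 * pi * \<i>) / fact k * (deriv ^^ k) f 0)) {0..2 * pi}"
    using 1 by (subst (asm) has_contour_integral_part_circlepath_iff) auto
  have alg: "a / z ^ Suc k * \<i> * z = \<i> * (z powi (- int k) * a)" if "z \<noteq> 0" for a z :: complex
    using that by (simp add: power_int_minus field_simps)
  have "(f (cis t) / cis t ^ Suc k * \<i> * cis t) = \<i> * (cis t powi (- int k) * f (cis t))" for t
    by (rule alg) simp
  then have 3: "((\<lambda>t. \<i> * (cis t powi (- int k) * f (cis t))) has_integral
      ((2 * pi * \<i>) / fact k * (deriv ^^ k) f 0)) {0..2 * pi}"
    using 2 by (simp only:)
  have "continuous_on (sphere 0 1) f" by (rule continuous_on_subset[OF f(1)]) auto
  then have "continuous_on (sphere 0 1) (\<lambda>\<zeta>. \<zeta> powi (- int k) * f \<zeta>)"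
    by (intro continuous_on_mult) (auto intro!: continuous_intros)
  from has_integral_mult_right[OF arc_length_integral[OF this], of \<i>]
  have "\<i> * (LINT \<zeta>|arc_length. \<zeta> powi (- int k) * f \<zeta>) = (2 * pi * \<i>) / fact k * (deriv ^^ k) f 0"
    using 3 by (rule has_integral_unique)
  then have "\<i> * (LINT \<zeta>|arc_length. \<zeta> powi (- int k) * f \<zeta>)
      = \<i> * (2 * pi * ((deriv ^^ k) f 0 / fact k))" by simp
  then show ?thesis by (simp only: mult_cancel_left complex_i_not_zero simp_thms)
qed

text \<open>The function zeta^k f is holomorphic and vanishes at 0, so its mean over the circle is
  0.\<close>

lemma holomorphic_fourier_pos:
  fixes f :: "complex \<Rightarrow> complex"
  assumes f: "continuous_on (cball 0 1) f" "f holomorphic_on ball 0 1" and k: "0 < k"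
  shows "(LINT \<zeta>|arc_length. \<zeta> powi (int k) * f \<zeta>) = 0"
proof -
  have "(LINT \<zeta>|arc_length. \<zeta> powi (- int 0) * (\<zeta> ^ k * f \<zeta>)) = 0"
    using k f by (subst holomorphic_fourier_nonneg) (auto intro!: continuous_intros holomorphic_intros)
  then show ?thesis by simp
qed

text \<open>All Fourier coefficients are compared. L1 carries only the indices of one sign and the
  conjugate of L2 only those of the other, each with 2 pi times twice the coefficient of the
  measure. At index 0 the coefficient is not doubled but both functions contribute. Either way the
  factor is 4 pi.\<close>

lemma herglotz_density:
  assumes E1: "circle_density M E1" and E2: "circle_density M E2"
    and conj: "AE \<zeta> in M. E1 \<zeta> = cnj (E2 \<zeta>)"
    and L1: "continuous_on (cball 0 1) L1" "L1 holomorphic_on ball 0 1"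
    and L2: "continuous_on (cball 0 1) L2" "L2 holomorphic_on ball 0 1"
    and H1: "\<And>z. norm z < 1 \<Longrightarrow> L1 z = circle_density.herglotz M E1 z"
    and H2: "\<And>z. norm z < 1 \<Longrightarrow> L2 z = circle_density.herglotz M E2 z"
    and A: "A \<in> sets borel"
  shows "(LINT \<zeta>|M. indicator A \<zeta> * E1 \<zeta>)
    = (LINT \<zeta>|arc_length. indicator A \<zeta> * ((L1 \<zeta> + cnj (L2 \<zeta>)) / (4 * pi)))"
proof -
  interpret E1: circle_density M E1 by (rule E1)
  interpret E2: circle_density M E2 by (rule E2)
  have sub: "sphere 0 1 \<subseteq> cball (0 :: complex) 1" by auto
  have cL1: "continuous_on (sphere 0 1) L1" and cL2: "continuous_on (sphere 0 1) L2"
    using L1(1) L2(1) sub continuous_on_subset by blast+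
  \<comment> \<open>Uniqueness of the power series at 0 turns the Herglotz expansion into Taylor
    coefficients of L.\<close>
  have coeff: "(deriv ^^ j) L 0 / fact j = (if j = 0 then 1 else 2) * circle_density.fourier_coeff M E j"
    if "circle_density M E" and L: "\<And>z. norm z < 1 \<Longrightarrow> L z = circle_density.herglotz M E z" for E j and L :: "complex \<Rightarrow> complex"
  proof -
    interpret E: circle_density M E by fact
    define F where "F = Abs_fps (\<lambda>j. (if j = 0 then 1 else 2) * E.fourier_coeff j)"
    have "eventually (\<lambda>z. z \<in> ball 0 1) (nhds (0 :: complex))"
      by (intro eventually_nhds_in_open) auto
    then have "eventually (\<lambda>z. (\<lambda>n. fps_nth F n * z ^ n) sums L z) (nhds 0)"
    proof eventually_elim
      case (elim z)
      then show ?case using E.herglotz_sums[of z] L[of z] by (simp add: F_def)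
    qed
    from fps_nth_fps_expansion[OF has_fps_expansionI[OF this], of j] show ?thesis by (simp add: F_def)
  qed
  have neg: "(LINT \<zeta>|arc_length. \<zeta> powi (- int k) * L \<zeta>)
      = 2 * pi * ((if k = 0 then 1 else 2) * circle_density.fourier_coeff M E k)"
    if "circle_density M E" "\<And>z. norm z < 1 \<Longrightarrow> L z = circle_density.herglotz M E z"
      "continuous_on (cball 0 1) L" "L holomorphic_on ball 0 1" for E k and L :: "complex \<Rightarrow> complex"
    by (simp only: holomorphic_fourier_nonneg[OF that(3,4)] coeff[OF that(1,2)])
  have cnj_powi: "cnj (\<zeta> powi k) = \<zeta> powi (- k)" if "norm \<zeta> = 1" for \<zeta> :: complex and k
  proof -
    have "\<zeta> * cnj \<zeta> = 1" using that by (simp add: complex_norm_square[symmetric])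
    then have "inverse \<zeta> = cnj \<zeta>" by (rule inverse_unique)
    then show ?thesis by (simp add: power_int_minus power_int_inverse flip: \<open>inverse \<zeta> = cnj \<zeta>\<close>)
  qed
  have cnjE: "cnj (LINT \<zeta>|M. \<zeta> powi k * E2 \<zeta>) = (LINT \<zeta>|M. \<zeta> powi (- k) * E1 \<zeta>)" for k
  proof -
    have "cnj (LINT \<zeta>|M. \<zeta> powi k * E2 \<zeta>) = (LINT \<zeta>|M. cnj (\<zeta> powi k * E2 \<zeta>))"
      by (rule Bochner_Integration.integral_cnj[symmetric])
    also have "\<dots> = (LINT \<zeta>|M. \<zeta> powi (- k) * E1 \<zeta>)"
    proof (rule integral_cong_AE)
      show "(\<lambda>\<zeta>. cnj (\<zeta> powi k * E2 \<zeta>)) \<in> borel_measurable M"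
        using E2.integrable_continuous[OF E2.continuous_powi[of k]]
        by (intro borel_measurable_integrable) (simp del: complex_cnj_mult)
      show "(\<lambda>\<zeta>. \<zeta> powi (- k) * E1 \<zeta>) \<in> borel_measurable M"
        by (intro borel_measurable_integrable E1.integrable_continuous E1.continuous_powi)
      show "AE \<zeta> in M. cnj (\<zeta> powi k * E2 \<zeta>) = \<zeta> powi (- k) * E1 \<zeta>"
        using conj AE_space
      proof eventually_elim
        case (elim \<zeta>)
        then show ?case using cnj_powi[of \<zeta> k] by (simp add: E1.space_M)
      qed
    qed
    finally show ?thesis .
  qed
  have cnjL: "(LINT \<zeta>|arc_length. \<zeta> powi k * cnj (L2 \<zeta>)) = cnj (LINT \<zeta>|arc_length. \<zeta> powi (- k) * L2 \<zeta>)" for k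
  proof -
    have "cnj (LINT \<zeta>|arc_length. \<zeta> powi (- k) * L2 \<zeta>) = (LINT \<zeta>|arc_length. cnj (\<zeta> powi (- k) * L2 \<zeta>))"
      by (rule Bochner_Integration.integral_cnj[symmetric])
    also have "\<dots> = (LINT \<zeta>|arc_length. \<zeta> powi k * cnj (L2 \<zeta>))"
      by (intro Bochner_Integration.integral_cong refl) (simp add: cnj_powi del: complex_cnj_power_int)
    finally show ?thesis by simp
  qed
  define R where "R \<zeta> = (L1 \<zeta> + cnj (L2 \<zeta>)) / (4 * pi)" for \<zeta>
  have cR: "continuous_on (sphere 0 1) R" unfolding R_def by (intro continuous_intros cL1 cL2) auto
  interpret R: circle_density arc_length R by (rule circle_density_arc_length[OF cR])
  have intc: "integrable arc_length f" if "continuous_on (sphere 0 1) f" for f :: "complex \<Rightarrow> complex"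
    using circle_density.D[OF circle_density_arc_length[OF that]] .
  have split: "(LINT \<zeta>|arc_length. \<zeta> powi k * R \<zeta>)
      = ((LINT \<zeta>|arc_length. \<zeta> powi k * L1 \<zeta>) + cnj (LINT \<zeta>|arc_length. \<zeta> powi (- k) * L2 \<zeta>)) / (4 * pi)" for k
  proof -
    have "(LINT \<zeta>|arc_length. \<zeta> powi k * R \<zeta>)
        = (LINT \<zeta>|arc_length. (\<zeta> powi k * L1 \<zeta> + \<zeta> powi k * cnj (L2 \<zeta>)) / (4 * pi))"
      by (simp add: R_def distrib_left)
    also have "\<dots> = ((LINT \<zeta>|arc_length. \<zeta> powi k * L1 \<zeta>) + (LINT \<zeta>|arc_length. \<zeta> powi k * cnj (L2 \<zeta>))) / (4 * pi)"
      by (subst integral_divide_zero, subst Bochner_Integration.integral_add)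
        (auto intro!: intc continuous_on_mult R.continuous_powi cL1 cL2 continuous_on_cnj)
    finally show ?thesis by (simp only: cnjL)
  qed
  interpret circle_density_pair M E1 arc_length R
  proof
    fix k :: int
    show "(LINT \<zeta>|M. \<zeta> powi k * E1 \<zeta>) = (LINT \<zeta>|arc_length. \<zeta> powi k * R \<zeta>)"
    proof (cases k "0 :: int" rule: linorder_cases)
      case less
      then obtain j where j: "k = - int j" "0 < j" by (metis neg_int_cases of_nat_0_less_iff)
      show ?thesis unfolding split j
        using neg[OF E1 H1 L1, of j] holomorphic_fourier_pos[OF L2 j(2)] j(2)
        by (simp add: E1.fourier_coeff_def)
    next
      case equal
      \<comment> \<open>At index 0 the contributions of L1 and of the conjugate of L2 are equal,
        which makes up for the missing factor 2.\<close>
      have "cnj (E2.fourier_coeff 0) = E1.fourier_coeff 0"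
        using cnjE[of 0] by (simp add: E1.fourier_coeff_def E2.fourier_coeff_def)
      then show ?thesis unfolding split
        using neg[OF E1 H1 L1, of 0] neg[OF E2 H2 L2, of 0] equal
        by (simp add: E1.fourier_coeff_def distrib_left[symmetric])
    next
      case greater
      then obtain j where j: "k = int j" "0 < j" by (metis pos_int_cases)
      have "cnj (E2.fourier_coeff j) = (LINT \<zeta>|M. \<zeta> powi (int j) * E1 \<zeta>)"
        using cnjE[of "- int j"] by (simp add: E2.fourier_coeff_def)
      then show ?thesis unfolding split j
        using neg[OF E2 H2 L2, of j] holomorphic_fourier_pos[OF L1 j(2)] j(2) by simp
    qed
  qed
  show ?thesis using integral_borel_eq[OF A] by (simp add: R_def)
qed

section \<open>Trace densities\<close>

text \<open>The common shape of \<open>trace_measure\<close> and of the scalar measures B -> x^*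
  mu(B) x used for Radon-Nikodym.\<close>

definition set_fun_measure :: "(complex set \<Rightarrow> real) \<Rightarrow> complex measure" where
  "set_fun_measure \<phi> = measure_of (space circle_borel) (sets circle_borel) (\<lambda>B. ennreal (\<phi> B))"

lemma sets_set_fun_measure [simp]: "sets (set_fun_measure \<phi>) = sets circle_borel"
  unfolding set_fun_measure_def by (simp only: sets_measure_of[OF sets.space_closed] sets.sigma_sets_eq)

lemma set_fun_measure:
  assumes nn: "\<And>B. B \<in> sets circle_borel \<Longrightarrow> 0 \<le> \<phi> B"
    and add: "\<And>A :: nat \<Rightarrow> complex set. range A \<subseteq> sets circle_borel \<Longrightarrow> disjoint_family A \<Longrightarrow>
      (\<lambda>k. \<phi> (A k)) sums \<phi> (\<Union>k. A k)"
  shows "B \<in> sets circle_borel \<Longrightarrow> emeasure (set_fun_measure \<phi>) B = ennreal (\<phi> B)"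
    and "finite_measure (set_fun_measure \<phi>)"
proof -
  \<comment> \<open>The constant sequence of empty sets is disjoint, so a constant series converges
    and its term must vanish.\<close>
  have 0: "\<phi> {} = 0"
  proof -
    have "(\<lambda>k :: nat. \<phi> {}) sums \<phi> {}"
      using add[of "\<lambda>_. {}"] by (simp add: disjoint_family_on_def)
    then show ?thesis by (metis sums_summable summable_const_iff)
  qed
  have em: "emeasure (set_fun_measure \<phi>) B = ennreal (\<phi> B)" if "B \<in> sets circle_borel" for B
    unfolding set_fun_measure_def
  proof (rule emeasure_measure_of_sigma[OF sets.sigma_algebra_axioms _ _ that])
    show "positive (sets circle_borel) (\<lambda>B. ennreal (\<phi> B))" using 0 by (simp add: positive_def)
    show "countably_additive (sets circle_borel) (\<lambda>B. ennreal (\<phi> B))"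
    proof (rule countably_additiveI)
      fix A :: "nat \<Rightarrow> complex set"
      assume A: "range A \<subseteq> sets circle_borel" "disjoint_family A"
      show "(\<Sum>i. ennreal (\<phi> (A i))) = ennreal (\<phi> (\<Union>i. A i))"
        using A by (intro suminf_ennreal_eq add nn) auto
    qed
  qed
  then show "B \<in> sets circle_borel \<Longrightarrow> emeasure (set_fun_measure \<phi>) B = ennreal (\<phi> B)" .
  have "space (set_fun_measure \<phi>) = space circle_borel"
    by (rule sets_eq_imp_space_eq) simp
  then show "finite_measure (set_fun_measure \<phi>)"
    by (intro finite_measureI) (simp add: em del: space_circle_borel)
qed

text \<open>Complex off-diagonal entries are recovered from values on the diagonal of the form. For
  a measure these values are nonnegative, so they are within reach of Radon-Nikodym.\<close>

lemma sesq_form_polarization: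
  fixes t :: "nat \<Rightarrow> nat \<Rightarrow> complex" and N i j :: nat
  assumes "i < N" "j < N"
  defines "e \<equiv> \<lambda>k r. if r = k then 1 else 0 :: complex"
  defines "f \<equiv> \<lambda>a. sesq_form t N (\<lambda>r. e i r + a * e j r) (\<lambda>r. e i r + a * e j r)"
  shows "t i j = ((f 1 - f (- 1)) - \<i> * (f \<i> - f (- \<i>))) / 4"
proof -
  have unit: "sesq_form t N (e k) (e l) = t k l" if "k < N" "l < N" for k l
  proof -
    have "sesq_form t N (e k) (e l) = (\<Sum>r<N. if r = k then (\<Sum>s<N. if s = l then t r s else 0) else 0)"
      unfolding sesq_form_right e_def by (intro sum.cong refl) (auto simp: if_distrib cong: if_cong)
    then show ?thesis using that by simp
  qed
  have "f a = t i i + a * t i j + cnj a * t j i + cnj a * a * t j j" for a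
    unfolding f_def sesq_form_add
    using sesq_form_scale[of t N 1 "e i" a "e j"] sesq_form_scale[of t N a "e j" 1 "e i"]
      sesq_form_scale[of t N a "e j" a "e j"] unit assms(1,2) by simp
  then show ?thesis by (simp add: algebra_simps)
qed

section \<open>Non-negative Hermitian measures and their scalar forms\<close>

locale hermitian_measure =
  fixes q :: nat and \<mu> :: "complex set \<Rightarrow> complex mat"
  assumes \<mu>: "nonneg_hermitian_measure q \<mu>"
begin

lemma \<mu>_nonneg: "B \<in> sets circle_borel \<Longrightarrow> nonneg_hermitian q (\<mu> B)"
  using \<mu> by (simp add: nonneg_hermitian_measure_def)

lemma \<mu>_sums:
  "range A \<subseteq> sets circle_borel \<Longrightarrow> disjoint_family A \<Longrightarrow> i < q \<Longrightarrow> j < q \<Longrightarrow>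
    (\<lambda>k :: nat. \<mu> (A k) $$ (i, j)) sums (\<mu> (\<Union>k. A k) $$ (i, j))"
  using \<mu> by (simp add: nonneg_hermitian_measure_def)

lemma \<mu>_carrier: "B \<in> sets circle_borel \<Longrightarrow> \<mu> B \<in> carrier_mat q q"
  using \<mu>_nonneg by (simp add: nonneg_hermitian_def)

lemma \<mu>_hermitian:
  assumes "B \<in> sets circle_borel" "i < q" "j < q"
  shows "\<mu> B $$ (j, i) = cnj (\<mu> B $$ (i, j))"
proof -
  have "mat_adjoint (\<mu> B) = \<mu> B" using \<mu>_nonneg[OF assms(1)] by (simp add: nonneg_hermitian_def)
  moreover have "mat_adjoint (\<mu> B) $$ (j, i) = cnj (\<mu> B $$ (i, j))"
    using \<mu>_carrier[OF assms(1)] assms by (intro index_mat_adjoint) auto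
  ultimately show ?thesis by simp
qed

definition form :: "(nat \<Rightarrow> complex) \<Rightarrow> complex set \<Rightarrow> complex" where
  "form x B = sesq_form (\<lambda>r s. \<mu> B $$ (r, s)) q x x"

lemma form_nonneg: "B \<in> sets circle_borel \<Longrightarrow> 0 \<le> Re (form x B)"
  using nonneg_hermitian_psd_on[OF \<mu>_nonneg] by (simp add: form_def psd_on_def)

lemma form_real: "B \<in> sets circle_borel \<Longrightarrow> form x B = complex_of_real (Re (form x B))"
proof -
  assume B: "B \<in> sets circle_borel"
  have "form x B = cnj (form x B)"
    unfolding form_def by (rule sesq_form_swap) (rule \<mu>_hermitian[OF B])
  from arg_cong[OF this, of Im] show ?thesis by (simp add: complex_eq_iff)
qed

lemma form_sums:
  assumes "range A \<subseteq> sets circle_borel" "disjoint_family A"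
  shows "(\<lambda>k :: nat. Re (form x (A k))) sums Re (form x (\<Union>k. A k))"
  unfolding form_def sesq_form_def
  by (intro sums_Re sums_sum sums_mult sums_mult2 \<mu>_sums assms) auto

definition \<tau> where "\<tau> = trace_measure q \<mu>"

lemma \<tau>_eq: "\<tau> = set_fun_measure (\<lambda>B. Re (\<Sum>i<q. \<mu> B $$ (i, i)))"
  by (simp add: \<tau>_def trace_measure_def set_fun_measure_def)

lemma sets_\<tau> [simp]: "sets \<tau> = sets circle_borel"
  by (simp add: \<tau>_eq)

lemma diag_eq_form:
  assumes "i < q"
  shows "\<mu> B $$ (i, i) = form (\<lambda>r. if r = i then 1 else 0) B"
proof -
  have "form (\<lambda>r. if r = i then 1 else 0) B
      = (\<Sum>r<q. if r = i then (\<Sum>s<q. if s = i then \<mu> B $$ (r, s) else 0) else 0)"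
    unfolding form_def sesq_form_right by (intro sum.cong refl) (auto simp: if_distrib cong: if_cong)
  then show ?thesis using assms by simp
qed

lemma diag_nonneg: "B \<in> sets circle_borel \<Longrightarrow> i < q \<Longrightarrow> 0 \<le> Re (\<mu> B $$ (i, i))"
  by (simp add: diag_eq_form form_nonneg)

lemma emeasure_\<tau>: "B \<in> sets circle_borel \<Longrightarrow> emeasure \<tau> B = ennreal (Re (\<Sum>i<q. \<mu> B $$ (i, i)))"
  and finite_\<tau>: "finite_measure \<tau>"
proof -
  have nn: "0 \<le> Re (\<Sum>i<q. \<mu> B $$ (i, i))" if "B \<in> sets circle_borel" for B
    using diag_nonneg[OF that] by (auto intro: sum_nonneg)
  have add: "(\<lambda>k. Re (\<Sum>i<q. \<mu> (A k) $$ (i, i))) sums Re (\<Sum>i<q. \<mu> (\<Union>k. A k) $$ (i, i))"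
    if "range A \<subseteq> sets circle_borel" "disjoint_family A" for A :: "nat \<Rightarrow> complex set"
    by (intro sums_Re sums_sum \<mu>_sums that) auto
  show "B \<in> sets circle_borel \<Longrightarrow> emeasure \<tau> B = ennreal (Re (\<Sum>i<q. \<mu> B $$ (i, i)))"
    unfolding \<tau>_eq by (rule set_fun_measure(1)[OF nn add])
  show "finite_measure \<tau>"
    unfolding \<tau>_eq by (rule set_fun_measure(2)[OF nn add])
qed

text \<open>A nonnegative matrix of trace zero is zero: its diagonal vanishes, so each basis vector
  has zero energy and lies in the kernel. This is the absolute continuity of every x^* mu x with
  respect to the trace measure.\<close>

lemma null_imp_form_0:
  assumes B: "B \<in> sets circle_borel" and 0: "emeasure \<tau> B = 0"
  shows "form x B = 0"
proof -
  have "(\<Sum>i<q. Re (\<mu> B $$ (i, i))) \<le> 0"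
    using 0 by (simp add: emeasure_\<tau>[OF B] ennreal_eq_0_iff)
  then have "(\<Sum>i<q. Re (\<mu> B $$ (i, i))) = 0"
    using diag_nonneg[OF B] by (intro antisym sum_nonneg) auto
  then have d: "Re (\<mu> B $$ (i, i)) = 0" if "i < q" for i
    using that diag_nonneg[OF B] by (subst (asm) sum_nonneg_eq_0_iff) auto
  have "\<mu> B $$ (r, i) = 0" if "r < q" "i < q" for r i
  proof -
    let ?e = "\<lambda>r. if r = i then 1 else 0 :: complex"
    have "form ?e B = 0" using d[OF that(2)] form_real[OF B, of ?e] diag_eq_form[OF that(2), of B] by simp
    then have "(\<Sum>s<q. \<mu> B $$ (r, s) * ?e s) = 0"
      using that unfolding form_def
      by (intro psd_on_kernel[OF nonneg_hermitian_psd_on[OF \<mu>_nonneg[OF B]] \<mu>_hermitian[OF B]])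
    then show ?thesis using that by (simp add: if_distrib cong: if_cong)
  qed
  then show ?thesis by (simp add: form_def sesq_form_def)
qed

lemma form_density:
  obtains d :: "complex \<Rightarrow> real" where "integrable \<tau> d"
    "\<And>B. B \<in> sets circle_borel \<Longrightarrow> form x B = (LINT \<zeta>:B|\<tau>. complex_of_real (d \<zeta>))"
proof -
  interpret T: finite_measure \<tau> by (rule finite_\<tau>)
  define N where "N = set_fun_measure (\<lambda>B. Re (form x B))"
  have emN: "emeasure N B = ennreal (Re (form x B))" if "B \<in> sets circle_borel" for B
    unfolding N_def by (rule set_fun_measure(1)[OF form_nonneg form_sums that])
  have finN: "finite_measure N"
    unfolding N_def by (rule set_fun_measure(2)[OF form_nonneg form_sums])
  have setsN: "sets N = sets circle_borel" by (simp add: N_def)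
  have ac: "absolutely_continuous \<tau> N"
    unfolding absolutely_continuous_def
  proof
    fix B assume "B \<in> null_sets \<tau>"
    then have "B \<in> sets circle_borel" "emeasure \<tau> B = 0" by (auto simp: null_sets_def)
    then show "B \<in> null_sets N" using null_imp_form_0[of B x] by (simp add: null_sets_def setsN emN)
  qed
  have sN: "sets N = sets \<tau>" by (simp add: setsN)
  obtain d where d: "d \<in> borel_measurable \<tau>" "AE \<zeta> in \<tau>. RN_deriv \<tau> N \<zeta> = ennreal (d \<zeta>)"
      "AE \<zeta> in N. 0 < d \<zeta>" "\<And>\<zeta>. 0 \<le> d \<zeta>"
    by (rule T.real_RN_deriv[OF finN ac sN]) (rule that)
  have "density \<tau> (\<lambda>\<zeta>. ennreal (d \<zeta>)) = density \<tau> (RN_deriv \<tau> N)"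
    using d(1,2) by (intro density_cong) auto
  also have "\<dots> = N" using T.density_RN_deriv[OF ac] setsN by simp
  finally have N: "density \<tau> (\<lambda>\<zeta>. ennreal (d \<zeta>)) = N" .
  have nn: "(\<integral>\<^sup>+ \<zeta>. ennreal (indicator B \<zeta> * d \<zeta>) \<partial>\<tau>) = ennreal (Re (form x B))" if B: "B \<in> sets circle_borel" for B
  proof -
    have "ennreal (Re (form x B)) = emeasure (density \<tau> (\<lambda>\<zeta>. ennreal (d \<zeta>))) B"
      using emN[OF B] N by simp
    also have "\<dots> = (\<integral>\<^sup>+ \<zeta>. ennreal (d \<zeta>) * indicator B \<zeta> \<partial>\<tau>)"
      using d(1) B by (intro emeasure_density) auto
    also have "\<dots> = (\<integral>\<^sup>+ \<zeta>. ennreal (indicator B \<zeta> * d \<zeta>) \<partial>\<tau>)"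
      by (intro nn_integral_cong) (auto simp: indicator_def)
    finally show ?thesis by simp
  qed
  have int: "has_bochner_integral \<tau> (\<lambda>\<zeta>. indicator B \<zeta> * d \<zeta>) (Re (form x B))" if B: "B \<in> sets circle_borel" for B
  proof (rule has_bochner_integral_nn_integral[OF _ _ _ nn[OF B]])
    show "(\<lambda>\<zeta>. indicator B \<zeta> * d \<zeta>) \<in> borel_measurable \<tau>"
      using B d(1) by (intro borel_measurable_times borel_measurable_indicator) auto
  qed (use d(4) form_nonneg[OF B] in auto)
  show ?thesis
  proof (rule that)
    have "space \<tau> \<in> sets circle_borel" using sets.top[of \<tau>] by simp
    from int[OF this] have "integrable \<tau> (\<lambda>\<zeta>. indicator (space \<tau>) \<zeta> * d \<zeta>)"
      by (simp add: has_bochner_integral_iff)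
    then show "integrable \<tau> d"
      by (rule Bochner_Integration.integrable_cong[THEN iffD1, rotated 2]) auto
    fix B assume B: "B \<in> sets circle_borel"
    have "form x B = complex_of_real (LINT \<zeta>|\<tau>. indicator B \<zeta> * d \<zeta>)"
      using form_real[OF B] has_bochner_integral_integral_eq[OF int[OF B]] by simp
    also have "\<dots> = (LINT \<zeta>|\<tau>. complex_of_real (indicator B \<zeta> * d \<zeta>))"
      by (rule integral_complex_of_real[symmetric])
    also have "\<dots> = (LINT \<zeta>:B|\<tau>. complex_of_real (d \<zeta>))"
      unfolding set_lebesgue_integral_def
      by (intro Bochner_Integration.integral_cong refl) (auto simp: indicator_def)
    finally show "form x B = (LINT \<zeta>:B|\<tau>. complex_of_real (d \<zeta>))" .
  qed
qed

text \<open>Radon-Nikodym densities of the scalar measures x^* mu x are combined by polarization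
  with the four vectors e_i + a e_j, where a is 1, -1, i, -i.\<close>

lemma trace_density_exists: "\<exists>D. is_trace_density q \<mu> D"
proof -
  define dens where "dens x = (SOME d :: complex \<Rightarrow> real. integrable \<tau> d \<and>
    (\<forall>B\<in>sets circle_borel. form x B = (LINT \<zeta>:B|\<tau>. complex_of_real (d \<zeta>))))" for x
  have "\<exists>d :: complex \<Rightarrow> real. integrable \<tau> d \<and>
    (\<forall>B\<in>sets circle_borel. form x B = (LINT \<zeta>:B|\<tau>. complex_of_real (d \<zeta>)))" for x
    by (rule form_density[of x]) blast
  then have "integrable \<tau> (dens x) \<and>
    (\<forall>B\<in>sets circle_borel. form x B = (LINT \<zeta>:B|\<tau>. complex_of_real (dens x \<zeta>)))" for x
    unfolding dens_def by (rule someI_ex)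
  then have dens: "integrable \<tau> (\<lambda>\<zeta>. complex_of_real (dens x \<zeta>))"
    "B \<in> sets circle_borel \<Longrightarrow> form x B = (LINT \<zeta>:B|\<tau>. complex_of_real (dens x \<zeta>))" for x B
    by auto
  define e :: "nat \<Rightarrow> nat \<Rightarrow> complex" where "e k r = (if r = k then 1 else 0)" for k r
  define p where "p i j a = (\<lambda>r. e i r + a * e j r)" for i j a
  define D where "D \<zeta> = mat q q (\<lambda>(i, j).
    ((complex_of_real (dens (p i j 1) \<zeta>) - complex_of_real (dens (p i j (- 1)) \<zeta>))
      - \<i> * (complex_of_real (dens (p i j \<i>) \<zeta>) - complex_of_real (dens (p i j (- \<i>)) \<zeta>))) / 4)" for \<zeta>
  have "is_trace_density q \<mu> D"
    unfolding is_trace_density_def \<tau>_def[symmetric]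
  proof (intro allI impI conjI ballI)
    fix i j assume ij: "i < q" "j < q"
    show "integrable \<tau> (\<lambda>\<zeta>. D \<zeta> $$ (i, j))"
      using ij by (simp add: D_def dens(1))
    fix B assume B: "B \<in> sets circle_borel"
    have si: "set_integrable \<tau> B (\<lambda>\<zeta>. complex_of_real (dens x \<zeta>))" for x
      unfolding set_integrable_def using B by (intro integrable_mult_indicator dens(1)) simp
    have "\<mu> B $$ (i, j) = ((form (p i j 1) B - form (p i j (- 1)) B)
        - \<i> * (form (p i j \<i>) B - form (p i j (- \<i>)) B)) / 4"
      unfolding form_def p_def e_def
      by (rule sesq_form_polarization[OF ij, of "\<lambda>r s. \<mu> B $$ (r, s)"])
    also have "\<dots> = (LINT \<zeta>:B|\<tau>. D \<zeta> $$ (i, j))"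
      using ij by (simp add: dens(2)[OF B] D_def set_integral_diff si)
    finally show "\<mu> B $$ (i, j) = (LINT \<zeta>:B|\<tau>. D \<zeta> $$ (i, j))" .
  qed
  then show ?thesis by blast
qed

text \<open>The same choice as inside \<open>mat_measure_integral\<close>, so integrals against mu
  unfold directly to integrals against this density.\<close>

definition D where "D = (SOME D. is_trace_density q \<mu> D)"

lemma D_density: "is_trace_density q \<mu> D"
  unfolding D_def by (rule someI_ex[OF trace_density_exists])

lemma circle_density_D: "i < q \<Longrightarrow> j < q \<Longrightarrow> circle_density \<tau> (\<lambda>\<zeta>. D \<zeta> $$ (i, j))"
  using D_density by unfold_locales (auto simp: is_trace_density_def \<tau>_def[symmetric])

lemma \<mu>_eq_integral:
  assumes "i < q" "j < q" "B \<in> sets circle_borel"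
  shows "\<mu> B $$ (i, j) = (LINT \<zeta>|\<tau>. indicator B \<zeta> * D \<zeta> $$ (i, j))"
proof -
  have "\<mu> B $$ (i, j) = (LINT \<zeta>:B|\<tau>. D \<zeta> $$ (i, j))"
    using D_density assms by (auto simp: is_trace_density_def \<tau>_def[symmetric])
  also have "\<dots> = (LINT \<zeta>|\<tau>. indicator B \<zeta> * D \<zeta> $$ (i, j))"
    unfolding set_lebesgue_integral_def
    by (intro Bochner_Integration.integral_cong refl) (auto simp: indicator_def)
  finally show ?thesis .
qed

text \<open>Both sides integrate to the same values over all Borel sets since each mu(B) is
  Hermitian, and densities are unique almost everywhere.\<close>

lemma D_hermitian:
  assumes ij: "i < q" "j < q"
  shows "AE \<zeta> in \<tau>. D \<zeta> $$ (i, j) = cnj (D \<zeta> $$ (j, i))"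
proof (rule finite_\<tau>[THEN finite_measure.axioms(1), THEN sigma_finite_measure.density_unique_banach])
  interpret ij: circle_density \<tau> "\<lambda>\<zeta>. D \<zeta> $$ (i, j)" by (rule circle_density_D[OF ij])
  interpret ji: circle_density \<tau> "\<lambda>\<zeta>. D \<zeta> $$ (j, i)" by (rule circle_density_D[OF ij(2,1)])
  show "integrable \<tau> (\<lambda>\<zeta>. D \<zeta> $$ (i, j))" by (rule ij.D)
  show "integrable \<tau> (\<lambda>\<zeta>. cnj (D \<zeta> $$ (j, i)))" using ji.D by simp
  fix B assume "B \<in> sets \<tau>"
  then have B: "B \<in> sets circle_borel" by simp
  have "(LINT \<zeta>:B|\<tau>. D \<zeta> $$ (i, j)) = \<mu> B $$ (i, j)"
    using D_density ij B by (auto simp: is_trace_density_def \<tau>_def[symmetric])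
  also have "\<dots> = cnj (\<mu> B $$ (j, i))" using \<mu>_hermitian[OF B ij(2,1)] .
  also have "\<mu> B $$ (j, i) = (LINT \<zeta>:B|\<tau>. D \<zeta> $$ (j, i))"
    using D_density ij B by (auto simp: is_trace_density_def \<tau>_def[symmetric])
  also have "cnj \<dots> = (LINT \<zeta>|\<tau>. cnj (indicator B \<zeta> *\<^sub>R D \<zeta> $$ (j, i)))"
    unfolding set_lebesgue_integral_def by (simp del: complex_cnj_scaleR)
  also have "\<dots> = (LINT \<zeta>:B|\<tau>. cnj (D \<zeta> $$ (j, i)))"
    unfolding set_lebesgue_integral_def by simp
  finally show "(LINT \<zeta>:B|\<tau>. D \<zeta> $$ (i, j)) = (LINT \<zeta>:B|\<tau>. cnj (D \<zeta> $$ (j, i)))" .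
qed

lemma mat_measure_integral_entry:
  "i < q \<Longrightarrow> j < q \<Longrightarrow> mat_measure_integral q \<mu> f $$ (i, j) = (LINT \<zeta>|\<tau>. f \<zeta> * D \<zeta> $$ (i, j))"
  by (simp add: mat_measure_integral_def D_def \<tau>_def Let_def)

end

section \<open>The representation of the central measure\<close>

text \<open>The conclusion holds at every point of U, including z itself, so
  \<open>remove_sings R\<close> inherits the regularity of G around z.\<close>

lemma remove_sings_eq_local:
  assumes "open U" "G holomorphic_on U" "\<And>w. w \<in> U \<Longrightarrow> w \<noteq> z \<Longrightarrow> R w = G w" and w: "w \<in> U"
  shows "remove_sings R w = G w"
proof -
  have "eventually (\<lambda>x. x \<in> U - {w} \<and> x \<noteq> z) (at w)"
  proof (cases "w = z")
    case True
    have "eventually (\<lambda>x. x \<in> U - {w}) (at w)" using assms(1) w by (rule eventually_at_in_open)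
    then show ?thesis by eventually_elim (simp add: True)
  next
    case False
    have "eventually (\<lambda>x. x \<in> (U - {z}) - {w}) (at w)"
      using assms(1) w False by (intro eventually_at_in_open open_Diff) auto
    then show ?thesis by eventually_elim auto
  qed
  then have "eventually (\<lambda>x. R x = G x) (at w)"
    by eventually_elim (use assms(3) in auto)
  then have "remove_sings R w = remove_sings G w" by (intro remove_sings_cong) auto
  also have "\<dots> = G w"
    by (intro remove_sings_at_analytic holomorphic_on_imp_analytic_at[OF assms(2,1) w])
  finally show ?thesis .
qed

section \<open>Atoms of the central measure and the regularity of Lambda_n\<close>

locale central_measure_data = toeplitz_data n q C + hermitian_measure q \<mu>
  for n q C \<mu> +
  assumes central: "central_measure q n C \<mu>"
begin

definition H where "H i j = circle_density.herglotz \<tau> (\<lambda>\<zeta>. D \<zeta> $$ (i, j))"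

abbreviation det_b where "det_b z \<equiv> det (fun_b q n C z)"

definition num where "num i j z = (fun_a q n C z * adj_mat (fun_b q n C z)) $$ (i, j)"

abbreviation N where "N \<equiv> set_N q n C"

abbreviation X where "X v i j \<equiv> mass_X q n C v $$ (i, j)"

lemma fourier_coeff_D:
  assumes "i < q" "j < q"
  shows "circle_density.fourier_coeff \<tau> (\<lambda>\<zeta>. D \<zeta> $$ (i, j)) k = c k $$ (i, j)"
proof -
  have "mat_measure_integral q \<mu> (\<lambda>\<zeta>. \<zeta> powi (- int k)) = c k"
    using central by (simp add: central_measure_def c_def)
  then show ?thesis
    using mat_measure_integral_entry[OF assms, of "\<lambda>\<zeta>. \<zeta> powi (- int k)"]
    by (simp only: circle_density.fourier_coeff_def[OF circle_density_D[OF assms]])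
qed

lemma H_sums:
  assumes "i < q" "j < q" "norm z < 1"
  shows "(\<lambda>k. (if k = 0 then 1 else 2) * c k $$ (i, j) * z ^ k) sums H i j z"
  using circle_density.herglotz_sums[OF circle_density_D[OF assms(1,2)] assms(3)]
  by (simp add: fourier_coeff_D[OF assms(1,2)] H_def)

lemma H_mult_det:
  assumes "i < q" "j < q" "norm z < 1"
  shows "H i j z * det_b z = num i j z"
  unfolding num_def using assms by (intro gen_fun_mult_det H_sums) auto

lemma num_holomorphic: "i < q \<Longrightarrow> j < q \<Longrightarrow> num i j holomorphic_on S"
  unfolding num_def by (rule a_adj_b_holomorphic)

lemma det_b_not_constant: "det_b v = 0 \<Longrightarrow> \<not> (\<lambda>z. det_b z) constant_on UNIV"
proof
  assume v: "det_b v = 0" and "(\<lambda>z. det_b z) constant_on UNIV"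
  then obtain y where "\<And>x. det_b x = y" by (auto simp: constant_on_def)
  then show False using v det_b_0 by (metis zero_neq_one)
qed

lemma finite_N: "finite N"
proof (cases "N = {}")
  case False
  then obtain v where "det_b v = 0" by (auto simp: set_N_def)
  from holomorphic_compact_finite_zeros[OF det_b_holomorphic open_UNIV connected_UNIV compact_sphere subset_UNIV
      det_b_not_constant[OF this]]
  show ?thesis unfolding set_N_def .
qed simp

lemma det_b_isolated: "\<exists>r>0. \<forall>w\<in>ball z r - {z}. det_b w \<noteq> 0"
proof (cases "det_b z = 0")
  case True
  have "det_b 0 \<noteq> 0" using det_b_0 by simp
  then obtain r where "0 < r" "\<And>w. w \<in> ball z r - {z} \<Longrightarrow> det_b w \<noteq> 0"
    using isolated_zeros[OF det_b_holomorphic open_UNIV connected_UNIV UNIV_I True UNIV_I] by blast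
  then show ?thesis by blast
next
  case False
  have "isCont (\<lambda>z. det_b z) z"
    using holomorphic_on_imp_continuous_on[OF det_b_holomorphic[of UNIV]]
    by (simp add: continuous_on_eq_continuous_at)
  then have "((\<lambda>z. det_b z) \<longlongrightarrow> det_b z) (nhds z)"
    unfolding isCont_def by (rule tendsto_at_iff_tendsto_nhds[THEN iffD1])
  from topological_tendstoD[OF this, of "- {0}"] have "eventually (\<lambda>w. det_b w \<noteq> 0) (nhds z)"
    using False by (simp add: open_Compl)
  then show ?thesis unfolding eventually_nhds_metric by (auto simp: dist_commute)
qed

lemma mass_X_local:
  assumes v: "v \<in> N" and ij: "i < q" "j < q"
  obtains s g where "0 < s" "g holomorphic_on ball v s"
    "\<And>w. w \<in> ball v s \<Longrightarrow> w \<noteq> v \<Longrightarrow> det_b w \<noteq> 0 \<and> num i j w / det_b w = g w + (v + w) / (v - w) * X v i j"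
proof -
  have nv: "norm v = 1" and dv: "det_b v = 0" using v by (auto simp: set_N_def)
  have d0: "det_b 0 \<noteq> 0" using det_b_0 by simp
  have X: "X v i j = (- of_nat (nat (zorder (\<lambda>z. det_b z) v)) /
      (2 * v * (deriv ^^ nat (zorder (\<lambda>z. det_b z) v)) (\<lambda>z. det_b z) v)) *
      (deriv ^^ (nat (zorder (\<lambda>z. det_b z) v) - 1)) (num i j) v"
    using ij by (simp add: mass_X_def mult_b_def Let_def mat_deriv_def num_def[abs_def])
  show ?thesis
  proof (rule simple_pole_on_circle[OF num_holomorphic[OF ij] det_b_holomorphic nv dv d0])
    fix z :: complex assume "z \<in> ball 0 1"
    then show "H i j z * det_b z = num i j z" using H_mult_det[OF ij] by simp
  next
    fix z :: complex assume "z \<in> ball 0 1"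
    then show "norm (H i j z) * (1 - norm z) \<le> 2 * (LINT \<zeta>|\<tau>. norm (D \<zeta> $$ (i, j)))"
      unfolding H_def using circle_density.herglotz_bound[OF circle_density_D[OF ij]] by simp
  next
    fix s g assume "0 < s" "g holomorphic_on ball v s"
      "\<And>w. w \<in> ball v s \<Longrightarrow> w \<noteq> v \<Longrightarrow> det_b w \<noteq> 0 \<and> num i j w / det_b w = g w +
        (v + w) / (v - w) * (- of_nat (nat (zorder (\<lambda>z. det_b z) v)) /
      (2 * v * (deriv ^^ nat (zorder (\<lambda>z. det_b z) v)) (\<lambda>z. det_b z) v) *
      (deriv ^^ (nat (zorder (\<lambda>z. det_b z) v) - 1)) (num i j) v)"
    then show thesis by (intro that) (simp_all only: X)
  qed
qed

lemma mass_X_eq: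
  assumes v: "v \<in> N" and ij: "i < q" "j < q"
  shows "X v i j = (LINT \<zeta>|\<tau>. indicator {v} \<zeta> * D \<zeta> $$ (i, j))"
proof -
  have nv: "norm v = 1" using v by (auto simp: set_N_def)
  obtain s g where s: "0 < s" and g: "g holomorphic_on ball v s"
    and eq: "\<And>w. w \<in> ball v s \<Longrightarrow> w \<noteq> v \<Longrightarrow> det_b w \<noteq> 0 \<and> num i j w / det_b w = g w + (v + w) / (v - w) * X v i j"
    using mass_X_local[OF assms] by blast
  define x where "x n = 1 - inverse (real (Suc n))" for n
  have x: "0 \<le> x n" "x n < 1" for n by (auto simp: x_def divide_simps)
  have xlim: "x \<longlonglongrightarrow> 1" unfolding x_def
    using tendsto_diff[OF tendsto_const LIMSEQ_inverse_real_of_nat, of 1] by simp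
  define z where "z n = of_real (x n) * v" for n
  have zlim: "z \<longlonglongrightarrow> v" unfolding z_def
    using tendsto_mult[OF tendsto_of_real[OF xlim] tendsto_const, of v] by simp
  have lim1: "(\<lambda>n. of_real ((1 - x n) / 2) * H i j (z n)) \<longlonglongrightarrow> (LINT \<zeta>|\<tau>. indicator {v} \<zeta> * D \<zeta> $$ (i, j))"
    unfolding H_def z_def by (rule circle_density.herglotz_radial_limit[OF circle_density_D[OF ij] nv xlim x])
  have "isCont g v"
    using g s by (metis centre_in_ball continuous_on_eq_continuous_at holomorphic_on_imp_continuous_on open_ball)
  then have glim: "(\<lambda>n. g (z n)) \<longlonglongrightarrow> g v" using zlim by (rule isCont_tendsto_compose)
  have "(\<lambda>n. of_real ((1 - x n) / 2) * g (z n) + of_real ((1 + x n) / 2) * X v i j)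
      \<longlonglongrightarrow> of_real ((1 - 1) / 2) * g v + of_real ((1 + 1) / 2) * X v i j"
    by (intro tendsto_add tendsto_mult glim tendsto_const tendsto_of_real tendsto_divide tendsto_diff xlim) auto
  then have lim2: "(\<lambda>n. of_real ((1 - x n) / 2) * g (z n) + of_real ((1 + x n) / 2) * X v i j)
      \<longlonglongrightarrow> X v i j" by simp
  have "eventually (\<lambda>n. z n \<in> ball v s) sequentially"
    using zlim s by (intro topological_tendstoD) auto
  then have "eventually (\<lambda>n. of_real ((1 - x n) / 2) * H i j (z n)
      = of_real ((1 - x n) / 2) * g (z n) + of_real ((1 + x n) / 2) * X v i j) sequentially"
  proof eventually_elim
    case (elim n)
    have zv: "z n \<noteq> v" and z1: "norm (z n) < 1"
      using radius_point[OF nv x, of n] by (simp_all add: z_def)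
    have "H i j (z n) = num i j (z n) / det_b (z n)"
      using eq[OF elim zv] by (simp flip: H_mult_det[OF ij z1])
    also have "\<dots> = g (z n) + (v + z n) / (v - z n) * X v i j" using eq[OF elim zv] by blast
    \<comment> \<open>At z = xv the kernel is the real number (1 + x) / (1 - x). The factor (1 - x)
      / 2 turns it into (1 + x) / 2, while the regular part g is scaled to 0.\<close>
    also have "(v + z n) / (v - z n) = of_real (1 + x n) / of_real (1 - x n)"
    proof -
      have "v + z n = of_real (1 + x n) * v" "v - z n = of_real (1 - x n) * v"
        by (simp_all add: z_def algebra_simps)
      moreover have "v \<noteq> 0" using nv by auto
      ultimately show ?thesis by simp
    qed
    finally have H: "H i j (z n) = g (z n) + of_real (1 + x n) / of_real (1 - x n) * X v i j" .
    have "1 - x n \<noteq> 0" using x(2)[of n] by simp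
    then have "complex_of_real (1 - x n) \<noteq> 0" by (simp only: of_real_eq_0_iff not_False_eq_True)
    then show ?case unfolding H
      by (simp only: of_real_divide distrib_left) (simp add: field_simps del: of_real_diff of_real_add)
  qed
  then have "(\<lambda>n. of_real ((1 - x n) / 2) * H i j (z n)) \<longlonglongrightarrow> X v i j"
    by (rule tendsto_cong[THEN iffD2]) (rule lim2)
  then show ?thesis using lim1 by (rule LIMSEQ_unique)
qed

text \<open>The trace density of \<open>\<mu>\<close> without its atoms in \<open>\<N>\<^sub>n\<close>; its Herglotz transform is \<open>\<Lambda>\<^sub>n\<close>.\<close>

definition E where "E i j \<zeta> = indicator (- N) \<zeta> * D \<zeta> $$ (i, j)"

lemma indicator_compl_N:
  "indicator (- N) \<zeta> = (1 :: complex) - (\<Sum>v\<in>N. indicator {v} \<zeta>)"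
proof -
  have "(\<Sum>v\<in>N. indicator {v} \<zeta> :: complex) = (\<Sum>v\<in>N. if v = \<zeta> then 1 else 0)"
    by (intro sum.cong refl) (auto simp: indicator_def)
  then show ?thesis using finite_N by (simp add: indicator_def)
qed

lemma circle_density_E:
  assumes ij: "i < q" "j < q"
  shows "circle_density \<tau> (E i j)"
proof -
  interpret D: circle_density \<tau> "\<lambda>\<zeta>. D \<zeta> $$ (i, j)" by (rule circle_density_D[OF ij])
  have "- N \<in> sets borel" using finite_N by (intro borel_open open_Compl finite_imp_closed)
  from D.integral_indicator[OF this] show ?thesis
    unfolding E_def[abs_def] by unfold_locales auto
qed

lemma integral_E:
  fixes f :: "complex \<Rightarrow> complex"
  assumes ij: "i < q" "j < q" and f: "integrable \<tau> (\<lambda>\<zeta>. f \<zeta> * D \<zeta> $$ (i, j))"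
  shows "(LINT \<zeta>|\<tau>. f \<zeta> * E i j \<zeta>)
    = (LINT \<zeta>|\<tau>. f \<zeta> * D \<zeta> $$ (i, j)) - (\<Sum>v\<in>N. f v * X v i j)"
proof -
  interpret D: circle_density \<tau> "\<lambda>\<zeta>. D \<zeta> $$ (i, j)" by (rule circle_density_D[OF ij])
  have "f \<zeta> * E i j \<zeta> = f \<zeta> * D \<zeta> $$ (i, j) - (\<Sum>v\<in>N. f v * (indicator {v} \<zeta> * D \<zeta> $$ (i, j)))" for \<zeta>
  proof -
    have "(\<Sum>v\<in>N. f v * (indicator {v} \<zeta> * D \<zeta> $$ (i, j))) = (\<Sum>v\<in>N. f \<zeta> * (indicator {v} \<zeta> * D \<zeta> $$ (i, j)))"
      by (intro sum.cong refl) (auto simp: indicator_def)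
    then show ?thesis
      by (simp add: E_def indicator_compl_N algebra_simps sum_distrib_left sum_distrib_right)
  qed
  moreover have int: "integrable \<tau> (\<lambda>\<zeta>. f v * (indicator {v} \<zeta> * D \<zeta> $$ (i, j)))" for v
    using D.integral_indicator[of "{v}"] by simp
  ultimately have "(LINT \<zeta>|\<tau>. f \<zeta> * E i j \<zeta>) = (LINT \<zeta>|\<tau>. f \<zeta> * D \<zeta> $$ (i, j))
      - (\<Sum>v\<in>N. LINT \<zeta>|\<tau>. f v * (indicator {v} \<zeta> * D \<zeta> $$ (i, j)))"
    using f by (simp del: integral_mult_right_zero integral_mult_right)
  then show ?thesis using ij by (simp add: mass_X_eq)
qed

definition L0 where "L0 i j = circle_density.herglotz \<tau> (E i j)"

text \<open>An atom of mass X at v has Herglotz transform (v + z) / (v - z) X. Removing the atoms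
  from the measure therefore subtracts Delta_n from the transform.\<close>

lemma L0_eq:
  assumes ij: "i < q" "j < q" and z: "norm z < 1"
  shows "L0 i j z = H i j z - (\<Sum>v\<in>N. (v + z) / (v - z) * X v i j)"
  unfolding L0_def H_def circle_density.herglotz_def[OF circle_density_E[OF ij]]
    circle_density.herglotz_def[OF circle_density_D[OF ij]]
  using circle_density.continuous_herglotz_kernel[OF circle_density_D[OF ij] z]
  by (intro integral_E ij circle_density.integrable_continuous[OF circle_density_D[OF ij]])

lemma L0_holomorphic:
  assumes ij: "i < q" "j < q"
  shows "L0 i j holomorphic_on ball 0 1"
proof -
  interpret E: circle_density \<tau> "E i j" by (rule circle_density_E[OF ij])
  show ?thesis
    by (rule power_series_holomorphic[where a = "\<lambda>k. (if k = 0 then 1 else 2) * E.fourier_coeff k"])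
      (use E.herglotz_sums in \<open>simp add: L0_def\<close>)
qed

definition R where
  "R i j w = (fun_a q n C w * the (mat_inverse (fun_b q n C w)) - fun_Delta q n C w) $$ (i, j)"

lemma fun_Lambda_entry: "i < q \<Longrightarrow> j < q \<Longrightarrow> fun_Lambda q n C z $$ (i, j) = remove_sings (R i j) z"
  by (simp add: fun_Lambda_def R_def[abs_def])

lemma mass_X_dim [simp]: "dim_row (mass_X q n C v) = q" "dim_col (mass_X q n C v) = q"
  by (simp_all add: mass_X_def Let_def mat_deriv_def)

lemma R_eq:
  assumes ij: "i < q" "j < q" and d: "det_b w \<noteq> 0"
  shows "R i j w = num i j w / det_b w - (\<Sum>v\<in>N. (v + w) / (v - w) * X v i j)"
proof -
  have D: "fun_Delta q n C w \<in> carrier_mat q q" by (simp add: fun_Delta_def mat_sum_def)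
  have "fun_Delta q n C w $$ (i, j) = (\<Sum>v\<in>N. (v + w) / (v - w) * X v i j)"
    using ij by (simp add: fun_Delta_def mat_sum_def)
  then show ?thesis
    using a_b_inverse[OF d ij] D ij unfolding R_def num_def
    by (subst index_minus_mat) (auto simp del: index_mult_mat(1))
qed

text \<open>Each point of the closed disk has a neighbourhood on which the raw difference
  \<open>R\<close>, off the point itself, is holomorphically extendable. This one statement yields
  continuity up to the circle and the identification with \<open>L0\<close> inside.\<close>

lemma Lambda_local:
  assumes ij: "i < q" "j < q" and z: "norm z \<le> 1"
  obtains U G where "open U" "z \<in> U" "G holomorphic_on U" "\<And>w. w \<in> U \<Longrightarrow> w \<noteq> z \<Longrightarrow> R i j w = G w"
    "norm z < 1 \<Longrightarrow> G z = L0 i j z"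
proof -
  obtain r where r: "0 < r" "\<And>w. w \<in> ball z r \<Longrightarrow> w \<noteq> z \<Longrightarrow> det_b w \<noteq> 0"
    using det_b_isolated[of z] by blast
  \<comment> \<open>The radius isolates z from all other zeros of det b_n, which keeps the kernels
    of the other atoms regular nearby.\<close>
  have notN: "w \<notin> N" if "w \<in> ball z r" "w \<noteq> z" for w using r(2)[OF that] by (simp add: set_N_def)
  \<comment> \<open>In the first case det b_n may vanish at z; the singularity is removable because
    the transform of the measure is defined there. In the third, the pole is cancelled by the
    summate of Delta_n at z.\<close>
  consider "norm z < 1" | "norm z = 1" "det_b z \<noteq> 0" | "z \<in> N" using z unfolding less_eq_real_def by (auto simp: set_N_def)
  then show ?thesis
  proof cases
    case 1
    show ?thesis
    proof (rule that[of "ball z r \<inter> ball 0 1" "L0 i j"])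
      show "L0 i j holomorphic_on ball z r \<inter> ball 0 1"
        by (rule holomorphic_on_subset[OF L0_holomorphic[OF ij]]) auto
      fix w assume w: "w \<in> ball z r \<inter> ball 0 1" "w \<noteq> z"
      then have d: "det_b w \<noteq> 0" using r by auto
      have "num i j w / det_b w = H i j w"
        using H_mult_det[OF ij, of w] w d by (simp add: field_simps)
      then show "R i j w = L0 i j w" using w by (simp add: R_eq[OF ij d] L0_eq[OF ij])
    qed (use 1 r in auto)
  next
    case 2
    show ?thesis
    proof (rule that[of "ball z r" "\<lambda>w. num i j w / det_b w - (\<Sum>v\<in>N. (v + w) / (v - w) * X v i j)"])
      have "det_b w \<noteq> 0" if "w \<in> ball z r" for w using r(2)[OF that] 2 by (cases "w = z") auto
      moreover then have "v - w \<noteq> 0" if "w \<in> ball z r" "v \<in> N" for v w using that by (auto simp: set_N_def)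
      ultimately show "(\<lambda>w. num i j w / det_b w - (\<Sum>v\<in>N. (v + w) / (v - w) * X v i j)) holomorphic_on ball z r"
        by (intro holomorphic_intros num_holomorphic[OF ij] det_b_holomorphic) auto
    qed (use 2 r in \<open>auto simp: R_eq[OF ij]\<close>)
  next
    case 3
    obtain s g where s: "0 < s" and g: "g holomorphic_on ball z s"
      and eq: "\<And>w. w \<in> ball z s \<Longrightarrow> w \<noteq> z \<Longrightarrow> det_b w \<noteq> 0 \<and> num i j w / det_b w = g w + (z + w) / (z - w) * X z i j"
      using mass_X_local[OF 3 ij] by blast
    show ?thesis
    proof (rule that[of "ball z (min r s)" "\<lambda>w. g w - (\<Sum>v\<in>N - {z}. (v + w) / (v - w) * X v i j)"])
      have "v - w \<noteq> 0" if "w \<in> ball z (min r s)" "v \<in> N - {z}" for v w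
        using notN[of w] that by auto
      then show "(\<lambda>w. g w - (\<Sum>v\<in>N - {z}. (v + w) / (v - w) * X v i j)) holomorphic_on ball z (min r s)"
        by (intro holomorphic_intros holomorphic_on_subset[OF g]) auto
      fix w assume w: "w \<in> ball z (min r s)" "w \<noteq> z"
      have "(\<Sum>v\<in>N. (v + w) / (v - w) * X v i j)
          = (z + w) / (z - w) * X z i j + (\<Sum>v\<in>N - {z}. (v + w) / (v - w) * X v i j)"
        using finite_N 3 by (rule sum.remove)
      then show "R i j w = g w - (\<Sum>v\<in>N - {z}. (v + w) / (v - w) * X v i j)"
        using eq[of w] w by (simp add: R_eq[OF ij])
    qed (use 3 r s in \<open>auto simp: set_N_def\<close>)
  qed
qed

lemma Lambda_continuous:
  assumes ij: "i < q" "j < q"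
  shows "continuous_on (cball 0 1) (remove_sings (R i j))"
proof (rule continuous_at_imp_continuous_on, rule ballI)
  fix z :: complex assume "z \<in> cball 0 1"
  then have z: "norm z \<le> 1" by simp
  obtain U G where U: "open U" "z \<in> U" "G holomorphic_on U" "\<And>w. w \<in> U \<Longrightarrow> w \<noteq> z \<Longrightarrow> R i j w = G w"
      "norm z < 1 \<Longrightarrow> G z = L0 i j z"
    by (rule Lambda_local[OF ij z]) (rule that)
  have "continuous_on U (remove_sings (R i j))"
    using holomorphic_on_imp_continuous_on[OF U(3)]
    by (rule continuous_on_eq) (rule remove_sings_eq_local[OF U(1,3,4), symmetric])
  then show "isCont (remove_sings (R i j)) z" using U by (simp add: continuous_on_eq_continuous_at)
qed

lemma Lambda_eq_L0:
  assumes ij: "i < q" "j < q" and z: "norm z < 1"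
  shows "remove_sings (R i j) z = L0 i j z"
proof -
  obtain U G where U: "open U" "z \<in> U" "G holomorphic_on U" "\<And>w. w \<in> U \<Longrightarrow> w \<noteq> z \<Longrightarrow> R i j w = G w"
    "norm z < 1 \<Longrightarrow> G z = L0 i j z"
    by (rule Lambda_local[OF ij less_imp_le[OF z]]) (rule that)
  show ?thesis using remove_sings_eq_local[OF U(1,3,4,2)] U(5)[OF z] by simp
qed

lemma Lambda_holomorphic:
  assumes ij: "i < q" "j < q"
  shows "remove_sings (R i j) holomorphic_on ball 0 1"
  by (rule holomorphic_transform[OF L0_holomorphic[OF ij]]) (simp add: Lambda_eq_L0[OF ij])

lemma mat_re_Lambda_entry:
  assumes "i < q" "j < q"
  shows "mat_re (fun_Lambda q n C \<zeta>) $$ (i, j) = (remove_sings (R i j) \<zeta> + cnj (remove_sings (R j i) \<zeta>)) / 2"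
proof -
  have "dim_row (fun_Lambda q n C \<zeta>) = q" "dim_col (fun_Lambda q n C \<zeta>) = q"
    by (simp_all add: fun_Lambda_def)
  then show ?thesis using assms by (simp add: mat_re_def fun_Lambda_entry)
qed

lemma representation_entry:
  assumes ij: "i < q" "j < q" and B: "B \<in> sets circle_borel"
  shows "set_integrable arc_length B (\<lambda>\<zeta>. mat_re (fun_Lambda q n C \<zeta>) $$ (i, j))"
    and "\<mu> B $$ (i, j) = 1 / (2 * pi) * (LINT \<zeta>:B|arc_length. mat_re (fun_Lambda q n C \<zeta>) $$ (i, j))
      + (\<Sum>v\<in>N. indicator B v * X v i j)"
proof -
  let ?L = "\<lambda>i j. remove_sings (R i j)"
  let ?F = "\<lambda>\<zeta>. (?L i j \<zeta> + cnj (?L j i \<zeta>)) / 2"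
  have Bb: "B \<in> sets borel" and Ba: "B \<in> sets arc_length" using B by (auto simp: sets_circle_borel)
  have "continuous_on (sphere 0 1) (?L i j)" "continuous_on (sphere 0 1) (?L j i)"
    using Lambda_continuous[OF ij] Lambda_continuous[OF ij(2,1)]
    by (auto elim: continuous_on_subset)
  then have "continuous_on (sphere 0 1) ?F" by (intro continuous_intros) auto
  from circle_density.D[OF circle_density_arc_length[OF this]]
  have "set_integrable arc_length B ?F"
    unfolding set_integrable_def by (rule integrable_mult_indicator[OF Ba])
  then show "set_integrable arc_length B (\<lambda>\<zeta>. mat_re (fun_Lambda q n C \<zeta>) $$ (i, j))"
    by (simp add: mat_re_Lambda_entry ij)
  interpret D: circle_density \<tau> "\<lambda>\<zeta>. D \<zeta> $$ (i, j)" by (rule circle_density_D[OF ij])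
  \<comment> \<open>Removing atoms respects the symmetry, so entries (i, j) and (j, i) form a
    conjugate pair of densities.\<close>
  have "AE \<zeta> in \<tau>. E i j \<zeta> = cnj (E j i \<zeta>)"
    using D_hermitian[OF ij] by eventually_elim (simp add: E_def indicator_def)
  then have "(LINT \<zeta>|\<tau>. indicator B \<zeta> * E i j \<zeta>)
      = (LINT \<zeta>|arc_length. indicator B \<zeta> * ((?L i j \<zeta> + cnj (?L j i \<zeta>)) / (4 * pi)))"
    by (intro herglotz_density[OF circle_density_E[OF ij] circle_density_E[OF ij(2,1)]] Bb
        Lambda_continuous Lambda_holomorphic ij)
      (simp_all add: Lambda_eq_L0 ij L0_def)
  \<comment> \<open>The real part contributes one factor 1/2 and the normalization 1/(2 pi);
    together they are the 1/(4 pi) of the scalar result.\<close>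
  also have "\<dots> = (LINT \<zeta>|arc_length. 1 / (2 * pi) * (indicator B \<zeta> *\<^sub>R ?F \<zeta>))"
    by (intro Bochner_Integration.integral_cong refl) (simp add: indicator_def)
  also have "\<dots> = 1 / (2 * pi) * (LINT \<zeta>:B|arc_length. mat_re (fun_Lambda q n C \<zeta>) $$ (i, j))"
    unfolding set_lebesgue_integral_def mat_re_Lambda_entry[OF ij] by (rule integral_mult_right_zero)
  finally have 1: "(LINT \<zeta>|\<tau>. indicator B \<zeta> * E i j \<zeta>)
      = 1 / (2 * pi) * (LINT \<zeta>:B|arc_length. mat_re (fun_Lambda q n C \<zeta>) $$ (i, j))" .
  have "(LINT \<zeta>|\<tau>. indicator B \<zeta> * E i j \<zeta>) = \<mu> B $$ (i, j) - (\<Sum>v\<in>N. indicator B v * X v i j)"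
    using integral_E[OF ij D.integral_indicator[OF Bb]] \<mu>_eq_integral[OF ij B] by simp
  then show "\<mu> B $$ (i, j) = 1 / (2 * pi) * (LINT \<zeta>:B|arc_length. mat_re (fun_Lambda q n C \<zeta>) $$ (i, j))
      + (\<Sum>v\<in>N. indicator B v * X v i j)" using 1 by (simp add: diff_eq_eq)
qed

end

theorem theorem5p11:
  fixes n q :: nat
    and C :: "nat \<Rightarrow> complex mat"
    and \<mu> :: "complex set \<Rightarrow> complex mat"
  assumes "1 \<le> n" and "1 \<le> q"
    and "toeplitz_nonneg q n C"
    and "central_measure q n C \<mu>"
  shows "\<forall>B\<in>sets circle_borel.
    mat_set_integrable q arc_length B (\<lambda>\<zeta>. mat_re (fun_Lambda q n C \<zeta>)) \<and>
    \<mu> B = complex_of_real (1 / (2 * pi)) \<cdot>\<^sub>m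
            mat_set_integral q arc_length B (\<lambda>\<zeta>. mat_re (fun_Lambda q n C \<zeta>))
          + mat_sum q (\<lambda>v. indicator B v \<cdot>\<^sub>m mass_X q n C v) (set_N q n C)"
proof (intro ballI conjI)
  interpret central_measure_data n q C \<mu>
    using assms by unfold_locales (auto simp: central_measure_def)
  fix B assume B: "B \<in> sets circle_borel"
  show "mat_set_integrable q arc_length B (\<lambda>\<zeta>. mat_re (fun_Lambda q n C \<zeta>))"
    unfolding mat_set_integrable_def using representation_entry(1)[OF _ _ B] by blast
  show "\<mu> B = complex_of_real (1 / (2 * pi)) \<cdot>\<^sub>m
            mat_set_integral q arc_length B (\<lambda>\<zeta>. mat_re (fun_Lambda q n C \<zeta>))
          + mat_sum q (\<lambda>v. indicator B v \<cdot>\<^sub>m mass_X q n C v) (set_N q n C)"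
    (is "_ = ?rhs")
  proof (rule eq_matI)
    fix i j assume "i < dim_row ?rhs" "j < dim_col ?rhs"
    then have ij: "i < q" "j < q" by (auto simp: mat_sum_def)
    show "\<mu> B $$ (i, j) = ?rhs $$ (i, j)"
      unfolding representation_entry(2)[OF ij B]
      using ij by (simp add: mat_sum_def mat_set_integral_def)
  qed (use \<mu>_carrier[OF B] in \<open>auto simp: mat_sum_def\<close>)
qed

end
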